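(* Let $a,a^\dagger$ be the annihilation and creation operators of a single bosonic mode, let $\beta>0$, $r\ge 0$, $\theta\in\mathbb{R}$, $\alpha\in\mathbb{C}$, and put $\xi=re^{i\theta}$. Let $\rho_{\mathrm{th}}=e^{-\beta a^\dagger a}/\operatorname{Tr}e^{-\beta a^\dagger a}$ be the thermal state, $S_\xi=\exp\!\big[\tfrac12 r\,(e^{-i\theta}a^2-e^{i\theta}a^{\dagger 2})\big]$ the squeezing operator, and $D_\alpha=\exp(\alpha a^\dagger-\alpha^{*}a)$ the displacement operator, and consider the Gaussian state $$\rho_{\mathrm G}=D_\alpha S_\xi\,\rho_{\mathrm{th}}\,S_\xi^\dagger D_\alpha^\dagger .$$ Then, for $$A=\tfrac{1}{\sqrt2}\big(e^{-i\theta/2}a+e^{i\theta/2}a^\dagger\big),\qquad B=\tfrac{i}{\sqrt2}\big(e^{-i\theta/2}a-e^{i\theta/2}a^\dagger\big),$$ one has $$(\Delta A)^2_{\rho_{\mathrm G}}=\tfrac12 e^{-2r}\coth(\beta/2),\qquad \mathcal{F}_{\rho_{\mathrm G}}(B)=2e^{2r}\tanh(\beta/2),$$ and the triple $(\rho_{\mathrm G},A,B)$ satisfies $$(\Delta A)^2_{\rho_{\mathrm G}}\;\mathcal{F}_{\rho_{\mathrm G}}(B)=\langle i[A,B]\rangle_{\rho_{\mathrm G}}^2 .$$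
   Context: The Hilbert space is the Fock space with orthonormal basis $(|k\rangle)_{k\ge0}$, $a|k\rangle=\sqrt{k}\,|k-1\rangle$, $a^\dagger|k\rangle=\sqrt{k+1}\,|k+1\rangle$, so $[a,a^\dagger]=1$. The exponentials $S_\xi$ and $D_\alpha$ denote the unitary operators generated by the (closures of the) indicated skew-adjoint operators. For a density operator $\rho$, $\langle X\rangle_\rho=\operatorname{Tr}(\rho X)$ and $(\Delta A)^2_\rho=\langle A^2\rangle_\rho-\langle A\rangle_\rho^2$. The operator $[A,B]=AB-BA$ is a scalar multiple of the identity by the canonical commutation relation. The quantum Fisher information of $\rho$ with respect to a self-adjoint operator $B$ is defined, for a spectral decomposition $\rho=\sum_i q_i|\psi_i\rangle\langle\psi_i|$ with $(\psi_i)$ an orthonormal basis (of vectors in the domain of $B$), by $$\mathcal{F}_\rho(B)=2\sum_{i,j:\;q_i+q_j>0}\frac{(q_i-q_j)^2}{q_i+q_j}\,|\langle\psi_i|B|\psi_j\rangle|^2 .$$ *)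

theory Defs
  imports "HOL-Analysis.Analysis"
begin

section \<open>The Fock space\<close>

typedef fock = "{f :: nat \<Rightarrow> complex. summable (\<lambda>k. (cmod (f k))\<^sup>2)}"
  morphisms coeff Abs_fock
  by (rule exI[of _ "\<lambda>_. 0"]) simp

setup_lifting type_definition_fock

lemma coeff_summable: "summable (\<lambda>k. (cmod (coeff f k))\<^sup>2)"
  using coeff[of f] by simp

lemma fock_eqI: "(\<And>k. coeff f k = coeff g k) \<Longrightarrow> f = g"
  by (metis coeff_inject ext)

lemma sq_summable_add:
  fixes f g :: "nat \<Rightarrow> complex"
  assumes "summable (\<lambda>k. (cmod (f k))\<^sup>2)" "summable (\<lambda>k. (cmod (g k))\<^sup>2)"
  shows "summable (\<lambda>k. (cmod (f k + g k))\<^sup>2)"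
proof (rule summable_comparison_test')
  show "summable (\<lambda>k. 2 * (cmod (f k))\<^sup>2 + 2 * (cmod (g k))\<^sup>2)"
    using assms by (intro summable_add summable_mult)
  fix k :: nat
  have "(cmod (f k + g k))\<^sup>2 \<le> (cmod (f k) + cmod (g k))\<^sup>2"
    by (intro power_mono norm_triangle_ineq) simp
  also have "\<dots> \<le> 2 * (cmod (f k))\<^sup>2 + 2 * (cmod (g k))\<^sup>2"
    using sum_squares_bound[of "cmod (f k)" "cmod (g k)"] by (simp add: power2_sum)
  finally show "norm ((cmod (f k + g k))\<^sup>2) \<le> 2 * (cmod (f k))\<^sup>2 + 2 * (cmod (g k))\<^sup>2"
    by simp
qed

lemma sq_summable_mult:
  fixes f :: "nat \<Rightarrow> complex"
  shows "summable (\<lambda>k. (cmod (f k))\<^sup>2) \<Longrightarrow> summable (\<lambda>k. (cmod (c * f k))\<^sup>2)"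
  by (simp add: norm_mult power_mult_distrib)

lift_definition scaleC :: "complex \<Rightarrow> fock \<Rightarrow> fock" (infixr "*\<^sub>C" 75)
  is "\<lambda>c f k. c * f k"
  by (rule sq_summable_mult)

instantiation fock :: real_vector
begin

lift_definition zero_fock :: fock is "\<lambda>_. 0" by simp
lift_definition plus_fock :: "fock \<Rightarrow> fock \<Rightarrow> fock" is "\<lambda>f g k. f k + g k"
  by (rule sq_summable_add)
lift_definition uminus_fock :: "fock \<Rightarrow> fock" is "\<lambda>f k. - f k" by simp
lift_definition minus_fock :: "fock \<Rightarrow> fock \<Rightarrow> fock" is "\<lambda>f g k. f k - g k"
  subgoal for f g using sq_summable_add[of f "\<lambda>k. - g k"] by simp
  done
lift_definition scaleR_fock :: "real \<Rightarrow> fock \<Rightarrow> fock" is "\<lambda>c f k. complex_of_real c * f k"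
  by (rule sq_summable_mult)

instance
  by standard (transfer; simp add: fun_eq_iff algebra_simps)+

end

lemma coeff_simps [simp]:
  "coeff 0 k = 0" "coeff (f + g) k = coeff f k + coeff g k"
  "coeff (- f) k = - coeff f k" "coeff (f - g) k = coeff f k - coeff g k"
  "coeff (c *\<^sub>R f) k = complex_of_real c * coeff f k"
  "coeff (z *\<^sub>C f) k = z * coeff f k"
  by (transfer, simp)+

definition braket :: "fock \<Rightarrow> fock \<Rightarrow> complex" where
  "braket f g = (\<Sum>k. cnj (coeff f k) * coeff g k)"

lemma braket_summable: "summable (\<lambda>k. cnj (coeff f k) * coeff g k)"
proof (rule summable_comparison_test')
  show "summable (\<lambda>k. (cmod (coeff f k))\<^sup>2 + (cmod (coeff g k))\<^sup>2)"
    by (intro summable_add coeff_summable)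
  fix k :: nat
  have "2 * (cmod (coeff f k) * cmod (coeff g k)) \<le> (cmod (coeff f k))\<^sup>2 + (cmod (coeff g k))\<^sup>2"
    using sum_squares_bound[of "cmod (coeff f k)" "cmod (coeff g k)"] by simp
  moreover have "0 \<le> cmod (coeff f k) * cmod (coeff g k)" by simp
  ultimately show "norm (cnj (coeff f k) * coeff g k) \<le> (cmod (coeff f k))\<^sup>2 + (cmod (coeff g k))\<^sup>2"
    unfolding norm_mult complex_mod_cnj by linarith
qed

lemma braket_add_left: "braket (f + g) h = braket f h + braket g h"
  unfolding braket_def
  by (subst suminf_add[OF braket_summable braket_summable]) (simp add: algebra_simps)

lemma braket_scaleC_left: "braket (c *\<^sub>C f) h = cnj c * braket f h"
  unfolding braket_def
  by (subst suminf_mult[OF braket_summable, symmetric]) (simp add: algebra_simps)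

lemma braket_commute: "braket g f = cnj (braket f g)"
proof -
  have "(\<lambda>k. cnj (coeff f k) * coeff g k) sums braket f g"
    unfolding braket_def by (rule summable_sums[OF braket_summable])
  then have "(\<lambda>k. cnj (cnj (coeff f k) * coeff g k)) sums cnj (braket f g)"
    by (simp only: sums_cnj)
  then show ?thesis
    by (simp add: braket_def sums_iff mult.commute)
qed

lemma braket_self: "braket f f = complex_of_real (\<Sum>k. (cmod (coeff f k))\<^sup>2)"
proof -
  have *: "cnj (coeff f k) * coeff f k = complex_of_real ((cmod (coeff f k))\<^sup>2)" for k
    by (simp add: complex_norm_square[symmetric] mult.commute del: of_real_power)
  show ?thesis
    unfolding braket_def * by (rule suminf_of_real[OF coeff_summable, symmetric])
qed

lemma scaleR_scaleC: "c *\<^sub>R f = complex_of_real c *\<^sub>C f" for f :: fock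
  by (rule fock_eqI) simp

instantiation fock :: real_inner
begin

definition inner_fock :: "fock \<Rightarrow> fock \<Rightarrow> real" where "inner_fock f g = Re (braket f g)"
definition norm_fock :: "fock \<Rightarrow> real" where "norm_fock f = sqrt (inner f f)"
definition sgn_fock :: "fock \<Rightarrow> fock" where "sgn_fock f = f /\<^sub>R norm f"
definition dist_fock :: "fock \<Rightarrow> fock \<Rightarrow> real" where "dist_fock f g = norm (f - g)"
definition uniformity_fock :: "(fock \<times> fock) filter" where
  "uniformity_fock = (INF e\<in>{0<..}. principal {(x, y). dist x y < e})"
definition open_fock :: "fock set \<Rightarrow> bool" where
  "open_fock U = (\<forall>x\<in>U. eventually (\<lambda>(x', y). x' = x \<longrightarrow> y \<in> U) uniformity)"

instance
proof
  fix x y z :: fock and r :: real and U :: "fock set"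
  show "dist x y = norm (x - y)" by (rule dist_fock_def)
  show "sgn x = x /\<^sub>R norm x" by (rule sgn_fock_def)
  show "uniformity = (INF e\<in>{0<..}. principal {(x, y). dist (x::fock) y < e})"
    by (rule uniformity_fock_def)
  show "open U = (\<forall>x\<in>U. eventually (\<lambda>(x', y). x' = x \<longrightarrow> y \<in> U) uniformity)"
    by (rule open_fock_def)
  show "inner x y = inner y x"
    using braket_commute[of x y] by (simp add: inner_fock_def)
  show "inner (x + y) z = inner x z + inner y z"
    by (simp add: inner_fock_def braket_add_left)
  show "inner (r *\<^sub>R x) y = r * inner x y"
    by (simp add: inner_fock_def scaleR_scaleC braket_scaleC_left)
  show "0 \<le> inner x x"
    by (simp add: inner_fock_def braket_self suminf_nonneg coeff_summable)
  show "inner x x = 0 \<longleftrightarrow> x = 0"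
  proof
    assume "inner x x = 0"
    then have "\<And>k. (cmod (coeff x k))\<^sup>2 = 0"
      using suminf_eq_zero_iff[OF coeff_summable[of x]] by (simp add: inner_fock_def braket_self)
    then show "x = 0" by (intro fock_eqI) simp
  qed (simp add: inner_fock_def braket_self)
  show "norm x = sqrt (inner x x)" by (rule norm_fock_def)
qed

end

lift_definition ket :: "nat \<Rightarrow> fock" is "\<lambda>k j. if j = k then 1 else 0"
  subgoal for k by (rule summable_finite[of "{k}"]) auto
  done

lemma coeff_ket [simp]: "coeff (ket k) j = (if j = k then 1 else 0)"
  by transfer simp

text \<open>Orthonormal bases indexed by the naturals: maximal orthonormal families.\<close>

definition orthonormal_basis :: "(nat \<Rightarrow> fock) \<Rightarrow> bool" where
  "orthonormal_basis e \<longleftrightarrow>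
     (\<forall>m n. braket (e m) (e n) = (if m = n then 1 else 0)) \<and>
     (\<forall>f. (\<forall>n. braket (e n) f = 0) \<longrightarrow> f = 0)"


section \<open>Unbounded operators\<close>

text \<open>
  An operator is identified with its graph, so its domain is the \<open>Domain\<close> of the relation, its
  operator closure is the topological \<open>closure\<close> of the graph, and sums, products and commutators
  carry their natural domains.
\<close>

type_synonym operator = "(fock \<times> fock) set"

definition graph :: "(fock \<Rightarrow> fock) \<Rightarrow> operator" where
  "graph T = {(f, T f) | f. True}"

definition op_app :: "operator \<Rightarrow> fock \<Rightarrow> fock" where
  "op_app T f = (THE g. (f, g) \<in> T)"

definition op_scale :: "complex \<Rightarrow> operator \<Rightarrow> operator" where
  "op_scale c T = {(f, c *\<^sub>C g) | f g. (f, g) \<in> T}"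

definition op_add :: "operator \<Rightarrow> operator \<Rightarrow> operator" where
  "op_add S T = {(f, g + h) | f g h. (f, g) \<in> S \<and> (f, h) \<in> T}"

definition op_diff :: "operator \<Rightarrow> operator \<Rightarrow> operator" where
  "op_diff S T = {(f, g - h) | f g h. (f, g) \<in> S \<and> (f, h) \<in> T}"

definition op_mult :: "operator \<Rightarrow> operator \<Rightarrow> operator" where
  "op_mult S T = T O S"

definition commutator :: "operator \<Rightarrow> operator \<Rightarrow> operator" where
  "commutator S T = op_diff (op_mult S T) (op_mult T S)"

definition adjoint_op :: "operator \<Rightarrow> operator" where
  "adjoint_op T = {(f, g). \<forall>(u, v) \<in> T. braket f v = braket g u}"

text \<open>
  The operator with eigenvalues \<open>q i\<close> on the orthonormal basis \<open>\<psi>\<close>, i.e. the sum of the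
  \<open>q i |\<psi> i\<rangle>\<langle>\<psi> i|\<close>; its domain consists of the vectors for which the series converges.
\<close>

definition diagonal_op :: "(nat \<Rightarrow> real) \<Rightarrow> (nat \<Rightarrow> fock) \<Rightarrow> operator" where
  "diagonal_op q \<psi> =
     {(f, g). ((\<lambda>i. (complex_of_real (q i) * braket (\<psi> i) f) *\<^sub>C \<psi> i) has_sum g) UNIV}"

definition spectral_decomposition ::
    "operator \<Rightarrow> (nat \<Rightarrow> real) \<Rightarrow> (nat \<Rightarrow> fock) \<Rightarrow> bool" where
  "spectral_decomposition T q \<psi> \<longleftrightarrow> orthonormal_basis \<psi> \<and> T = diagonal_op q \<psi>"

text \<open>Exponential of a self-adjoint operator with pure point spectrum, by functional calculus.\<close>

definition exp_selfadjoint :: "operator \<Rightarrow> operator" where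
  "exp_selfadjoint H =
     (THE E. \<exists>q \<psi>. spectral_decomposition H q \<psi> \<and> E = diagonal_op (\<lambda>i. exp (q i)) \<psi>)"

text \<open>Exponential of a skew-adjoint operator, via the unitary group it generates (Stone).\<close>

definition unitary_map :: "(fock \<Rightarrow> fock) \<Rightarrow> bool" where
  "unitary_map U \<longleftrightarrow>
     (\<forall>f g. U (f + g) = U f + U g) \<and> (\<forall>c f. U (c *\<^sub>C f) = c *\<^sub>C U f) \<and>
     (\<forall>f g. braket (U f) (U g) = braket f g) \<and> surj U"

definition unitary_group :: "(real \<Rightarrow> fock \<Rightarrow> fock) \<Rightarrow> bool" where
  "unitary_group V \<longleftrightarrow>
     (\<forall>t. unitary_map (V t)) \<and> V 0 = id \<and> (\<forall>s t. V (s + t) = V s \<circ> V t) \<and>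
     (\<forall>f. continuous_on UNIV (\<lambda>t. V t f))"

definition generator :: "(real \<Rightarrow> fock \<Rightarrow> fock) \<Rightarrow> operator" where
  "generator V = {(f, g). ((\<lambda>t. V t f) has_vector_derivative g) (at 0)}"

definition exp_skewadjoint :: "operator \<Rightarrow> operator" where
  "exp_skewadjoint K =
     (THE U. \<exists>V. unitary_group V \<and> generator V = K \<and> U = graph (V 1))"

text \<open>
  Trace of a densely defined operator having a (necessarily unique) bounded extension \<open>T'\<close> to the
  whole space. Summability, which for complex numbers is absolute, in every orthonormal basis says
  that \<open>T'\<close> is trace class. For an unbounded observable \<open>X\<close> the product \<open>\<rho> X\<close> is only densely
  defined, which is why the extension is needed in \<open>Tr (\<rho> X)\<close>.
\<close>

definition has_trace :: "operator \<Rightarrow> complex \<Rightarrow> bool" where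
  "has_trace T t \<longleftrightarrow> closure (Domain T) = UNIV \<and>
     (\<exists>T'. bounded_linear T' \<and> (\<forall>c f. T' (c *\<^sub>C f) = c *\<^sub>C T' f) \<and> T \<subseteq> graph T' \<and>
        (\<forall>e. orthonormal_basis e \<longrightarrow> ((\<lambda>n. braket (e n) (T' (e n))) has_sum t) UNIV))"

definition trace_op :: "operator \<Rightarrow> complex" where
  "trace_op T = (THE t. has_trace T t)"


section \<open>Expectation, variance and quantum Fisher information\<close>

definition expectation :: "operator \<Rightarrow> operator \<Rightarrow> complex" where
  "expectation \<rho> X = trace_op (op_mult \<rho> X)"

definition variance :: "operator \<Rightarrow> operator \<Rightarrow> complex" where
  "variance \<rho> A = expectation \<rho> (op_mult A A) - (expectation \<rho> A)\<^sup>2"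

text \<open>
  The value has to be attained by every spectral decomposition with vectors in the domain of \<open>B\<close>,
  and there has to be at least one.
\<close>

definition qfi :: "operator \<Rightarrow> operator \<Rightarrow> real" where
  "qfi \<rho> B = (THE F.
     (\<exists>q \<psi>. spectral_decomposition \<rho> q \<psi> \<and> range \<psi> \<subseteq> Domain B) \<and>
     (\<forall>q \<psi>. spectral_decomposition \<rho> q \<psi> \<longrightarrow> range \<psi> \<subseteq> Domain B \<longrightarrow>
        ((\<lambda>(i, j). 2 * ((q i - q j)\<^sup>2 / (q i + q j)) * (cmod (braket (\<psi> i) (op_app B (\<psi> j))))\<^sup>2)
           has_sum F) {(i, j). q i + q j > 0}))"


section \<open>The bosonic mode\<close>

definition annihilation :: operator where
  "annihilation =
     {(f, g). \<forall>k. coeff g k = complex_of_real (sqrt (real (Suc k))) * coeff f (Suc k)}"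

definition creation :: operator where
  "creation = adjoint_op annihilation"

lemma annihilation_ket_0: "(ket 0, 0) \<in> annihilation"
  by (simp add: annihilation_def)

lemma annihilation_ket_Suc:
  "(ket (Suc k), complex_of_real (sqrt (real (Suc k))) *\<^sub>C ket k) \<in> annihilation"
  by (simp add: annihilation_def)

lemma creation_ket:
  "(ket k, complex_of_real (sqrt (real (Suc k))) *\<^sub>C ket (Suc k)) \<in> creation"
proof -
  have *: "braket (ket m) h = coeff h m" for m h
  proof -
    have "braket (ket m) h = (\<Sum>j. if j = m then coeff h m else 0)"
      unfolding braket_def by (rule suminf_cong) simp
    then show ?thesis using sums_single[of m "coeff h"] by (simp add: sums_iff cong: if_cong)
  qed
  show ?thesis
    by (auto simp: creation_def adjoint_op_def annihilation_def * braket_scaleC_left)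
qed

definition thermal_state :: "real \<Rightarrow> operator" where
  "thermal_state \<beta> =
     (let E = exp_selfadjoint (op_scale (complex_of_real (- \<beta>)) (op_mult creation annihilation))
      in op_scale (1 / trace_op E) E)"

definition squeezing :: "real \<Rightarrow> real \<Rightarrow> operator" where
  "squeezing r \<theta> = exp_skewadjoint (closure (op_scale (complex_of_real (r / 2))
     (op_diff (op_scale (cis (- \<theta>)) (op_mult annihilation annihilation))
              (op_scale (cis \<theta>) (op_mult creation creation)))))"

definition displacement :: "complex \<Rightarrow> operator" where
  "displacement \<alpha> = exp_skewadjoint (closure
     (op_diff (op_scale \<alpha> creation) (op_scale (cnj \<alpha>) annihilation)))"

definition gaussian_state :: "real \<Rightarrow> real \<Rightarrow> real \<Rightarrow> complex \<Rightarrow> operator" where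
  "gaussian_state \<beta> r \<theta> \<alpha> =
     op_mult (displacement \<alpha>) (op_mult (squeezing r \<theta>) (op_mult (thermal_state \<beta>)
       (op_mult (adjoint_op (squeezing r \<theta>)) (adjoint_op (displacement \<alpha>)))))"

text \<open>The closures make the two quadratures self-adjoint.\<close>

definition quadrature_A :: "real \<Rightarrow> operator" where
  "quadrature_A \<theta> = closure (op_scale (complex_of_real (1 / sqrt 2))
     (op_add (op_scale (cis (- \<theta> / 2)) annihilation) (op_scale (cis (\<theta> / 2)) creation)))"

definition quadrature_B :: "real \<Rightarrow> operator" where
  "quadrature_B \<theta> = closure (op_scale (\<i> / complex_of_real (sqrt 2))
     (op_diff (op_scale (cis (- \<theta> / 2)) annihilation) (op_scale (cis (\<theta> / 2)) creation)))"

definition coth :: "real \<Rightarrow> real" where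
  "coth x = cosh x / sinh x"

end

theory Submission
  imports Defs
begin

text \<open>
  The generators of displacements and squeezings are skew quadratic expressions \<open>K\<close> in \<open>a\<close> and
  \<open>a\<^sup>\<dagger>\<close>. A linear cutoff shows that finitely supported vectors are a core for the maximal operator
  of such an expression, and they are analytic vectors: \<open>\<parallel>K\<^sup>n f\<parallel> \<le> M R\<^sup>n n!\<close>. Hence the exponential
  series converges on them for small \<open>t\<close>, is isometric there because \<open>K\<close> is skew, and extends to a
  unitary group \<open>W\<close> whose generator is the closure of \<open>K\<close>. If \<open>[X, K] = \<kappa> X + \<mu>\<close> with
  \<open>\<kappa> \<mu> = 0\<close>, then \<open>X W\<^sub>t = W\<^sub>t (e\<^sup>\<kappa>\<^sup>t X + \<mu> t)\<close>, so that \<open>D\<^sub>\<alpha> S\<^sub>\<xi>\<close> transforms \<open>A\<close> and \<open>B\<close> into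
  \<open>e\<^sup>-\<^sup>r A + const\<close> and \<open>e\<^sup>r B + const\<close>, and everything reduces to geometric series for the thermal
  state. As its spectrum is simple, its eigenbasis is unique up to order and phases.
\<close>

section \<open>Hilbert space structure of the Fock space\<close>

text \<open>Exponentials, traces and the Fisher information are specified by definite descriptions,
  so each evaluation needs existence and uniqueness. Hence the generator of the constructed group
  must be the closure of \<open>K\<close> exactly, and finitely supported vectors must be a core. A
  cutoff of slope 1/n achieves this because the weights of a quadratic expression grow only
  linearly, so that its commutator with the cutoff stays bounded. The bounds on the powers of
  \<open>K\<close> guarantee only a finite radius for the series, so long times are reached by
  iterating short ones. By \<open>[a, a\<^sup>\<dagger>] = 1\<close>, a displacement has \<kappa> =
  0, while a squeezing has \<mu> = 0 with \<kappa> = -r for A and \<kappa> = r for B; the phase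
  \<theta>/2 is what makes A and B eigenvectors. The constant added to A cancels in the variance,
  and the one added to B meets the factor \<open>(q i - q j)\<^sup>2\<close>, which vanishes on the
  diagonal. A quadrature changes the excitation number by one, so that only neighbouring levels
  contribute to the Fisher information.\<close>

lemma scaleC_simps [simp]:
  "0 *\<^sub>C f = 0" "1 *\<^sub>C f = f" "c *\<^sub>C 0 = 0" "c *\<^sub>C d *\<^sub>C f = (c * d) *\<^sub>C f"
  by (rule fock_eqI, simp)+

lemma scaleC_add_right: "c *\<^sub>C (f + g) = c *\<^sub>C f + c *\<^sub>C g"
  and scaleC_add_left: "(c + d) *\<^sub>C f = c *\<^sub>C f + d *\<^sub>C f"
  by (rule fock_eqI, simp add: algebra_simps)+

lemma braket_add_right: "braket h (f + g) = braket h f + braket h g"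
  by (metis braket_add_left braket_commute complex_cnj_add)

lemma braket_scaleC_right: "braket h (c *\<^sub>C f) = c * braket h f"
  by (metis braket_scaleC_left braket_commute complex_cnj_mult complex_cnj_cnj)

lemma braket_self_norm: "braket f f = complex_of_real ((norm f)\<^sup>2)"
proof -
  have "(norm f)\<^sup>2 = Re (braket f f)"
    by (simp add: power2_norm_eq_inner inner_fock_def)
  then show ?thesis
    by (simp add: braket_self)
qed

lemma norm_fock_sq: "(norm f)\<^sup>2 = (\<Sum>k. (cmod (coeff f k))\<^sup>2)"
  by (metis braket_self braket_self_norm of_real_eq_iff)

lemma norm_scaleC: "norm (c *\<^sub>C f) = cmod c * norm f"
proof -
  have "complex_of_real ((norm (c *\<^sub>C f))\<^sup>2) = complex_of_real ((cmod c * norm f)\<^sup>2)"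
    unfolding braket_self_norm[symmetric] braket_scaleC_left braket_scaleC_right
    by (simp add: braket_self_norm complex_norm_square power_mult_distrib algebra_simps
        del: of_real_power)
  then have "(norm (c *\<^sub>C f))\<^sup>2 = (cmod c * norm f)\<^sup>2"
    using of_real_eq_iff by blast
  then show ?thesis by (simp add: power2_eq_iff_nonneg)
qed

text \<open>The real inner product is the real part of \<open>braket\<close>. Multiplying
  \<open>f\<close> by the phase of the braket makes the braket real and nonnegative, so the real
  Cauchy-Schwarz inequality applies.\<close>

lemma braket_le_norm: "cmod (braket f g) \<le> norm f * norm g"
proof (cases "braket f g = 0")
  case False
  define z where "z = braket f g"
  define c where "c = z / complex_of_real (cmod z)"
  have "cmod c = 1" using False by (simp add: c_def z_def norm_divide)
  have "cnj c * z = complex_of_real (cmod z)"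
    using False by (simp add: c_def z_def complex_norm_square[symmetric] mult.commute
        power2_eq_square)
  then have "cmod z = inner (c *\<^sub>C f) g"
    by (simp add: inner_fock_def braket_scaleC_left z_def)
  also have "\<dots> \<le> norm (c *\<^sub>C f) * norm g" by (rule norm_cauchy_schwarz)
  finally show ?thesis by (simp add: norm_scaleC \<open>cmod c = 1\<close> z_def)
qed simp

interpretation braket: bounded_bilinear braket
proof
  fix a a' b b' :: fock and r :: real
  show "braket (a + a') b = braket a b + braket a' b" by (rule braket_add_left)
  show "braket a (b + b') = braket a b + braket a b'" by (rule braket_add_right)
  show "braket (r *\<^sub>R a) b = r *\<^sub>R braket a b"
    by (simp add: scaleR_scaleC braket_scaleC_left scaleR_conv_of_real)
  show "braket a (r *\<^sub>R b) = r *\<^sub>R braket a b"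
    by (simp add: scaleR_scaleC braket_scaleC_right scaleR_conv_of_real)
  show "\<exists>K. \<forall>a b. norm (braket a b) \<le> norm a * norm b * K"
    by (rule exI[of _ 1]) (simp add: braket_le_norm)
qed

interpretation scaleC: bounded_bilinear scaleC
proof
  fix a a' :: complex and b b' :: fock and r :: real
  show "(a + a') *\<^sub>C b = a *\<^sub>C b + a' *\<^sub>C b" by (rule scaleC_add_left)
  show "a *\<^sub>C (b + b') = a *\<^sub>C b + a *\<^sub>C b'" by (rule scaleC_add_right)
  show "(r *\<^sub>R a) *\<^sub>C b = r *\<^sub>R a *\<^sub>C b"
    by (rule fock_eqI) (simp add: scaleR_conv_of_real)
  show "a *\<^sub>C r *\<^sub>R b = r *\<^sub>R a *\<^sub>C b" by (rule fock_eqI) simp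
  show "\<exists>K. \<forall>a b. norm (a *\<^sub>C b) \<le> norm a * norm b * K"
    by (rule exI[of _ 1]) (simp add: norm_scaleC)
qed

lemma braket_ket: "braket (ket k) f = coeff f k"
proof -
  have "braket (ket k) f = (\<Sum>j. if j = k then coeff f k else 0)"
    unfolding braket_def by (rule suminf_cong) simp
  then show ?thesis using sums_single[of k "coeff f"] by (simp add: sums_iff cong: if_cong)
qed

lemma bounded_linear_coeff: "bounded_linear (\<lambda>f. coeff f k)"
  unfolding braket_ket[symmetric] by (rule braket.bounded_linear_right)

lemma orthonormal_ket: "orthonormal_basis ket"
  unfolding orthonormal_basis_def braket_ket by (auto intro: fock_eqI)

lemma norm_ket [simp]: "norm (ket k) = 1"
proof -
  have "complex_of_real ((norm (ket k))\<^sup>2) = complex_of_real 1"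
    unfolding braket_self_norm[symmetric] braket_ket by simp
  then have "(norm (ket k))\<^sup>2 = 1" using of_real_eq_iff by blast
  then show ?thesis using norm_ge_zero[of "ket k"] by (simp add: power2_eq_1_iff)
qed

text \<open>Each coordinate converges in the complex numbers. The Cauchy bound on a partial sum
  survives this limit and is uniform in the number of coordinates, which yields both square
  summability of the limit and convergence in norm.\<close>

instance fock :: complete_space
proof
  fix X :: "nat \<Rightarrow> fock"
  assume X: "Cauchy X"
  have "Cauchy (\<lambda>n. coeff (X n) k)" for k
    by (rule bounded_linear.Cauchy[OF bounded_linear_coeff X])
  then have "\<forall>k. \<exists>l. (\<lambda>n. coeff (X n) k) \<longlonglongrightarrow> l"
    by (simp add: Cauchy_convergent_iff convergent_def)
  then obtain l where l: "\<And>k. (\<lambda>n. coeff (X n) k) \<longlonglongrightarrow> l k" by metis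
  have part: "(\<Sum>k<N. (cmod (coeff (X m) k - l k))\<^sup>2) \<le> e\<^sup>2"
    if M: "\<forall>m\<ge>M. \<forall>n\<ge>M. dist (X m) (X n) < e" and "m \<ge> M" and "e > 0" for M m N and e :: real
  proof (rule LIMSEQ_le_const2)
    show "(\<lambda>n. \<Sum>k<N. (cmod (coeff (X m) k - coeff (X n) k))\<^sup>2)
        \<longlonglongrightarrow> (\<Sum>k<N. (cmod (coeff (X m) k - l k))\<^sup>2)"
      by (intro tendsto_intros l)
    show "\<exists>K. \<forall>n\<ge>K. (\<Sum>k<N. (cmod (coeff (X m) k - coeff (X n) k))\<^sup>2) \<le> e\<^sup>2"
    proof (intro exI allI impI)
      fix n assume "n \<ge> M"
      have "(\<Sum>k<N. (cmod (coeff (X m - X n) k))\<^sup>2) \<le> (norm (X m - X n))\<^sup>2"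
        unfolding norm_fock_sq by (rule sum_le_suminf[OF coeff_summable]) auto
      also have "\<dots> \<le> e\<^sup>2"
        using M \<open>m \<ge> M\<close> \<open>n \<ge> M\<close> by (intro power_mono) (auto simp: dist_norm less_imp_le)
      finally show "(\<Sum>k<N. (cmod (coeff (X m) k - coeff (X n) k))\<^sup>2) \<le> e\<^sup>2" by simp
    qed
  qed
  have summ: "summable (\<lambda>k. (cmod (coeff (X m) k - l k))\<^sup>2)"
    if "\<forall>m\<ge>M. \<forall>n\<ge>M. dist (X m) (X n) < e" and "m \<ge> M" and "e > 0" for M m and e :: real
    by (rule summableI_nonneg_bounded[of _ "e\<^sup>2"]) (auto intro: part[OF that])
  obtain M0 where M0: "\<forall>m\<ge>M0. \<forall>n\<ge>M0. dist (X m) (X n) < 1"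
    using X unfolding Cauchy_def by (meson zero_less_one)
  have "summable (\<lambda>k. (cmod (l k))\<^sup>2)"
  proof -
    have "summable (\<lambda>k. (cmod (-1 * (coeff (X M0) k - l k)))\<^sup>2)"
      using summ[OF M0 order_refl] by (intro sq_summable_mult) simp
    from sq_summable_add[OF coeff_summable[of "X M0"] this] show ?thesis by simp
  qed
  then have L: "coeff (Abs_fock l) k = l k" for k by (simp add: Abs_fock_inverse)
  have "X \<longlonglongrightarrow> Abs_fock l"
  proof (rule metric_LIMSEQ_I)
    fix r :: real assume "r > 0"
    then obtain M where M: "\<forall>m\<ge>M. \<forall>n\<ge>M. dist (X m) (X n) < r / 2"
      using X unfolding Cauchy_def by (meson half_gt_zero)
    show "\<exists>no. \<forall>n\<ge>no. dist (X n) (Abs_fock l) < r"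
    proof (intro exI allI impI)
      fix m assume "m \<ge> M"
      have "(norm (X m - Abs_fock l))\<^sup>2 \<le> (r / 2)\<^sup>2"
        unfolding norm_fock_sq coeff_simps L
        using \<open>r > 0\<close> by (intro suminf_le_const[OF summ[OF M \<open>m \<ge> M\<close>]] part[OF M \<open>m \<ge> M\<close>]) auto
      then have "norm (X m - Abs_fock l) \<le> r / 2"
        using \<open>r > 0\<close> by (simp add: power2_le_iff_abs_le)
      then show "dist (X m) (Abs_fock l) < r"
        using \<open>r > 0\<close> by (simp add: dist_norm)
    qed
  qed
  then show "convergent X" by (rule convergentI)
qed

instance fock :: banach ..

text \<open>Dominated convergence in l2: Tannery's theorem applies to the squared coordinates of the
  difference, with majorant 4 D^2.\<close>

lemma fock_tendsto_dominated:
  fixes h :: "nat \<Rightarrow> fock"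
  assumes lim: "\<And>k. (\<lambda>n. coeff (h n) k) \<longlonglongrightarrow> coeff g k"
    and dom: "\<And>n k. cmod (coeff (h n) k) \<le> D k"
    and D: "summable (\<lambda>k. (D k)\<^sup>2)"
  shows "h \<longlonglongrightarrow> g"
proof -
  have "cmod (coeff g k) \<le> D k" for k
    by (rule LIMSEQ_le_const2[OF tendsto_norm[OF lim]]) (use dom in auto)
  then have dom': "cmod (coeff (h n - g) k) \<le> 2 * D k" for n k
    using norm_triangle_ineq4[of "coeff (h n) k" "coeff g k"] dom[of n k]
    unfolding coeff_simps by (smt (verit))
  have "((\<lambda>n. \<Sum>k. (cmod (coeff (h n - g) k))\<^sup>2) \<longlongrightarrow> (\<Sum>k::nat. 0)) sequentially"
  proof (rule conjunct2[OF conjunct2[OF tannerys_theorem[where M = "\<lambda>k. 4 * (D k)\<^sup>2"]]])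
    show "(\<lambda>n. (cmod (coeff (h n - g) k))\<^sup>2) \<longlonglongrightarrow> 0" for k
      using tendsto_norm[OF LIM_zero[OF lim[of k]], THEN tendsto_power[where n = 2]] by simp
    have "norm ((cmod (coeff (h n - g) k))\<^sup>2) \<le> 4 * (D k)\<^sup>2" for n k
      using power_mono[OF dom'[of n k], of 2] by (simp add: power_mult_distrib)
    then show "\<forall>\<^sub>F (k, n) in at_top \<times>\<^sub>F sequentially.
        norm ((cmod (coeff (h n - g) k))\<^sup>2) \<le> 4 * (D k)\<^sup>2"
      by (intro always_eventually) auto
  qed (use D in \<open>auto intro: summable_mult\<close>)
  then have "(\<lambda>n. (norm (h n - g))\<^sup>2) \<longlonglongrightarrow> 0"
    by (simp add: norm_fock_sq)
  then have "(\<lambda>n. sqrt ((norm (h n - g))\<^sup>2)) \<longlonglongrightarrow> sqrt 0" by (rule tendsto_real_sqrt)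
  then show ?thesis by (simp add: LIM_zero_iff tendsto_norm_zero_iff)
qed

subsection \<open>Orthonormal bases\<close>

lemma orthonormal_basisD:
  assumes "orthonormal_basis e"
  shows "braket (e m) (e n) = (if m = n then 1 else 0)"
    and "(\<And>n. braket (e n) f = 0) \<Longrightarrow> f = 0"
  using assms by (auto simp: orthonormal_basis_def)

text \<open>Pythagoras for the projection onto finitely many basis vectors; Bessel, Parseval and
  both forms of the basis expansion rest on it.\<close>

lemma norm_sq_diff_orthonormal:
  assumes on: "orthonormal_basis e" and "finite F"
  shows "(norm (f - (\<Sum>i\<in>F. braket (e i) f *\<^sub>C e i)))\<^sup>2
    = (norm f)\<^sup>2 - (\<Sum>i\<in>F. (cmod (braket (e i) f))\<^sup>2)"
proof -
  define s where "s = (\<Sum>i\<in>F. braket (e i) f *\<^sub>C e i)"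
  have 1: "braket f s = (\<Sum>i\<in>F. complex_of_real ((cmod (braket (e i) f))\<^sup>2))"
    unfolding s_def braket.sum_right braket_scaleC_right
    by (intro sum.cong refl) (metis braket_commute complex_norm_square)
  have eis: "braket (e i) s = (if i \<in> F then braket (e i) f else 0)" for i
    unfolding s_def braket.sum_right braket_scaleC_right
    using \<open>finite F\<close> by (simp add: orthonormal_basisD(1)[OF on] if_distrib[of "(*) _"] sum.delta cong: if_cong)
  have 2: "braket s s = braket f s"
  proof -
    have "braket s s = (\<Sum>i\<in>F. cnj (braket (e i) f) * braket (e i) s)"
      by (subst (1) s_def) (simp add: braket.sum_left braket_scaleC_left)
    also have "\<dots> = braket f s"
      unfolding 1 by (rule sum.cong) (auto simp: eis complex_norm_square mult.commute simp del: of_real_power)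
    finally show ?thesis .
  qed
  have 3: "braket s f = braket f s"
    by (subst braket_commute) (simp add: 1)
  have "complex_of_real ((norm (f - s))\<^sup>2) = braket f f - braket f s"
    unfolding braket_self_norm[symmetric] braket.diff_left braket.diff_right 2 3 by simp
  also have "\<dots> = complex_of_real ((norm f)\<^sup>2 - (\<Sum>i\<in>F. (cmod (braket (e i) f))\<^sup>2))"
    unfolding 1 braket_self_norm by simp
  finally show ?thesis unfolding s_def[symmetric] using of_real_eq_iff by blast
qed

lemma bessel:
  assumes "orthonormal_basis e" "finite F"
  shows "(\<Sum>i\<in>F. (cmod (braket (e i) f))\<^sup>2) \<le> (norm f)\<^sup>2"
  using norm_sq_diff_orthonormal[OF assms, of f] zero_le_power2[of "norm _"]
  by (metis diff_ge_0_iff_ge)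

lemma bessel_summable:
  assumes "orthonormal_basis e"
  shows "summable (\<lambda>i. (cmod (braket (e i) f))\<^sup>2)"
  by (rule summableI_nonneg_bounded[of _ "(norm f)\<^sup>2"]) (auto intro: bessel[OF assms])

text \<open>Bessel makes the partial sums Cauchy. Their limit has the same coefficients as
  \<open>f\<close>, and maximality of the family identifies the two.\<close>

lemma orthonormal_expansion_sums:
  assumes on: "orthonormal_basis e"
  shows "(\<lambda>i. braket (e i) f *\<^sub>C e i) sums f"
proof -
  define s where "s n = (\<Sum>i<n. braket (e i) f *\<^sub>C e i)" for n
  have bs: "braket (e i) (s n) = (if i < n then braket (e i) f else 0)" for i n
    unfolding s_def braket.sum_right braket_scaleC_right
    by (simp add: orthonormal_basisD(1)[OF on] if_distrib[of "(*) _"] sum.delta cong: if_cong)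
  have diff: "(norm (s n - s m))\<^sup>2 = (\<Sum>i\<in>{m..<n}. (cmod (braket (e i) f))\<^sup>2)" if "m \<le> n" for m n
  proof -
    \<comment> \<open>\<open>s m\<close> is the projection of \<open>s n\<close>, so the Pythagoras
      identity is applied to \<open>s n\<close> in place of \<open>f\<close>.\<close>
    have "s m = (\<Sum>i<m. braket (e i) (s n) *\<^sub>C e i)"
      unfolding bs using that by (subst s_def) (intro sum.cong, auto)
    then have "(norm (s n - s m))\<^sup>2 = (norm (s n))\<^sup>2 - (\<Sum>i<m. (cmod (braket (e i) f))\<^sup>2)"
      using norm_sq_diff_orthonormal[OF on, of "{..<m}" "s n"] that by (simp add: bs)
    moreover have "(\<Sum>i<n. braket (e i) (s n) *\<^sub>C e i) = s n"
      unfolding bs by (subst s_def) (intro sum.cong, auto)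
    then have "(norm (s n))\<^sup>2 = (\<Sum>i<n. (cmod (braket (e i) f))\<^sup>2)"
      using norm_sq_diff_orthonormal[OF on, of "{..<n}" "s n"] by (simp only: finite_lessThan) (simp add: bs)
    ultimately show ?thesis
      using sum_diff_nat_ivl[of 0 m n "\<lambda>i. (cmod (braket (e i) f))\<^sup>2"] that
      by (simp add: lessThan_atLeast0)
  qed
  have "Cauchy s"
  proof (rule CauchyI')
    fix \<epsilon> :: real assume "\<epsilon> > 0"
    then obtain N where N: "\<And>m n. m \<ge> N \<Longrightarrow> norm (\<Sum>i\<in>{m..<n}. (cmod (braket (e i) f))\<^sup>2) < \<epsilon>\<^sup>2"
      using bessel_summable[OF on, of f] unfolding summable_Cauchy by (meson zero_less_power)
    have "norm (s m - s n) < \<epsilon>" if "m \<ge> N" "n > m" for m n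
    proof -
      have "(norm (s n - s m))\<^sup>2 < \<epsilon>\<^sup>2"
        using N[of m n] that diff[of m n] by (simp add: abs_of_nonneg sum_nonneg)
      then show ?thesis using \<open>\<epsilon> > 0\<close> by (simp add: norm_minus_commute power_less_imp_less_base)
    qed
    then show "\<exists>M. \<forall>m\<ge>M. \<forall>n>m. dist (s m) (s n) < \<epsilon>" unfolding dist_norm by blast
  qed
  then obtain g where g: "s \<longlonglongrightarrow> g" by (auto simp: Cauchy_convergent_iff convergent_def)
  have "braket (e i) (f - g) = 0" for i
  proof -
    have "(\<lambda>n. braket (e i) (s n)) \<longlonglongrightarrow> braket (e i) g"
      by (intro braket.tendsto tendsto_const g)
    moreover have "(\<lambda>n. braket (e i) (s n)) \<longlonglongrightarrow> braket (e i) f"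
    proof (rule tendsto_eventually, rule eventually_sequentiallyI)
      show "braket (e i) (s n) = braket (e i) f" if "n \<ge> Suc i" for n
        using that by (simp add: bs)
    qed
    ultimately show ?thesis using LIMSEQ_unique by (auto simp: braket.diff_right)
  qed
  then have "f = g" using orthonormal_basisD(2)[OF on, of "f - g"] by simp
  then show ?thesis using g unfolding sums_def s_def[abs_def] by simp
qed

lemma parseval_norm_has_sum:
  assumes on: "orthonormal_basis e"
  shows "((\<lambda>i. (cmod (braket (e i) f))\<^sup>2) has_sum (norm f)\<^sup>2) UNIV"
proof (rule sums_nonneg_imp_has_sum)
  have "(\<lambda>i. (norm (f - (\<Sum>j<i. braket (e j) f *\<^sub>C e j)))\<^sup>2) \<longlonglongrightarrow> (norm (f - f))\<^sup>2"
    using orthonormal_expansion_sums[OF on, of f] unfolding sums_def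
    by (intro tendsto_intros)
  then have "(\<lambda>i. (norm f)\<^sup>2 - (\<Sum>j<i. (cmod (braket (e j) f))\<^sup>2)) \<longlonglongrightarrow> 0"
    by (simp add: norm_sq_diff_orthonormal[OF on])
  from tendsto_diff[OF tendsto_const[of "(norm f)\<^sup>2"] this]
  show "(\<lambda>i. (cmod (braket (e i) f))\<^sup>2) sums (norm f)\<^sup>2"
    by (simp add: sums_def)
qed auto

text \<open>The squared remainder is the defect in Bessel's inequality, which tends to 0 along all
  finite index sets by Parseval. The unordered form is the one demanded by
  \<open>diagonal_op\<close>.\<close>

lemma orthonormal_expansion_has_sum:
  assumes on: "orthonormal_basis e"
  shows "((\<lambda>i. braket (e i) f *\<^sub>C e i) has_sum f) UNIV"
proof -
  have "((\<lambda>F. \<Sum>i\<in>F. (cmod (braket (e i) f))\<^sup>2) \<longlongrightarrow> (norm f)\<^sup>2) (finite_subsets_at_top UNIV)"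
    using parseval_norm_has_sum[OF on, of f] by (simp add: has_sum_def)
  then have "((\<lambda>F. sqrt ((norm f)\<^sup>2 - (\<Sum>i\<in>F. (cmod (braket (e i) f))\<^sup>2))) \<longlongrightarrow>
      sqrt ((norm f)\<^sup>2 - (norm f)\<^sup>2)) (finite_subsets_at_top UNIV)"
    by (intro tendsto_intros)
  then have lim: "((\<lambda>F. sqrt ((norm f)\<^sup>2 - (\<Sum>i\<in>F. (cmod (braket (e i) f))\<^sup>2))) \<longlongrightarrow> 0)
      (finite_subsets_at_top UNIV)"
    by simp
  have "((\<lambda>F. norm (f - (\<Sum>i\<in>F. braket (e i) f *\<^sub>C e i))) \<longlongrightarrow> 0) (finite_subsets_at_top UNIV)"
    by (rule Lim_transform_eventually[OF lim], rule eventually_finite_subsets_at_top_weakI)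
      (simp add: norm_sq_diff_orthonormal[OF on, symmetric])
  then have "((\<lambda>F. f - (\<Sum>i\<in>F. braket (e i) f *\<^sub>C e i)) \<longlongrightarrow> 0) (finite_subsets_at_top UNIV)"
    by (rule tendsto_norm_zero_cancel)
  from tendsto_diff[OF tendsto_const[of f] this] show ?thesis by (simp add: has_sum_def)
qed

lemma parseval_has_sum:
  assumes on: "orthonormal_basis e"
  shows "((\<lambda>i. braket f (e i) * braket (e i) g) has_sum braket f g) UNIV"
  using has_sum_bounded_linear[OF braket.bounded_linear_right orthonormal_expansion_has_sum[OF on, of g], of f]
  by (simp add: o_def braket_scaleC_right mult.commute)

section \<open>Diagonal operators and their spectral decompositions\<close>

lemma diagonal_op_coord:
  assumes on: "orthonormal_basis \<psi>" and "(f, g) \<in> diagonal_op q \<psi>"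
  shows "braket (\<psi> n) g = complex_of_real (q n) * braket (\<psi> n) f"
proof -
  have "((\<lambda>i. braket (\<psi> n) ((complex_of_real (q i) * braket (\<psi> i) f) *\<^sub>C \<psi> i)) has_sum braket (\<psi> n) g) UNIV"
    using assms(2) has_sum_bounded_linear[OF braket.bounded_linear_right]
    by (fastforce simp: diagonal_op_def o_def)
  then have "((\<lambda>i. if i = n then complex_of_real (q n) * braket (\<psi> n) f else 0) has_sum braket (\<psi> n) g) UNIV"
    by (rule has_sum_cong[THEN iffD1, rotated])
      (simp add: braket_scaleC_right orthonormal_basisD(1)[OF on])
  moreover have "((\<lambda>i. if i = n then complex_of_real (q n) * braket (\<psi> n) f else 0) has_sum
      complex_of_real (q n) * braket (\<psi> n) f) UNIV"
    by (rule has_sum_finite_neutralI[of "{n}"]) auto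
  ultimately show ?thesis by (rule has_sum_unique)
qed

text \<open>Convergence of the defining series needs no separate check: under the coordinate
  equations it is the basis expansion of \<open>g\<close>.\<close>

lemma diagonal_op_iff:
  assumes on: "orthonormal_basis \<psi>"
  shows "(f, g) \<in> diagonal_op q \<psi> \<longleftrightarrow>
    (\<forall>n. braket (\<psi> n) g = complex_of_real (q n) * braket (\<psi> n) f)"
proof
  assume "\<forall>n. braket (\<psi> n) g = complex_of_real (q n) * braket (\<psi> n) f"
  then show "(f, g) \<in> diagonal_op q \<psi>"
    using orthonormal_expansion_has_sum[OF on, of g] by (simp add: diagonal_op_def)
qed (auto intro: diagonal_op_coord[OF on])

lemma diagonal_op_basis:
  assumes "orthonormal_basis \<psi>"
  shows "(\<psi> j, complex_of_real (q j) *\<^sub>C \<psi> j) \<in> diagonal_op q \<psi>"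
  by (simp add: diagonal_op_iff assms braket_scaleC_right orthonormal_basisD(1)[OF assms])

text \<open>Pairing the eigenvalue equation of \<psi>' j with \<psi> n shows that they are
  orthogonal unless the eigenvalues agree. As \<open>q\<close> is injective, just one coefficient of
  \<psi>' j survives, and normalization makes it a phase.\<close>

lemma spectral_decomposition_simple:
  assumes s: "spectral_decomposition T q \<psi>" and "inj q"
    and s': "spectral_decomposition T q' \<psi>'"
  obtains \<sigma> c where "bij \<sigma>" "\<And>j. cmod (c j) = 1" "\<And>j. q' j = q (\<sigma> j)"
    "\<And>j. \<psi>' j = c j *\<^sub>C \<psi> (\<sigma> j)"
proof -
  have on: "orthonormal_basis \<psi>" and on': "orthonormal_basis \<psi>'"
    and T: "T = diagonal_op q \<psi>" "T = diagonal_op q' \<psi>'"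
    using s s' by (auto simp: spectral_decomposition_def)
  have eig: "(q' j = q n) \<or> braket (\<psi> n) (\<psi>' j) = 0" for j n
  proof -
    have "(\<psi>' j, complex_of_real (q' j) *\<^sub>C \<psi>' j) \<in> diagonal_op q \<psi>"
      using diagonal_op_basis[OF on'] T by metis
    from diagonal_op_coord[OF on this, of n] show ?thesis
      by (auto simp: braket_scaleC_right)
  qed
  have "\<exists>n. braket (\<psi> n) (\<psi>' j) \<noteq> 0" for j
    using orthonormal_basisD(2)[OF on, of "\<psi>' j"] orthonormal_basisD(1)[OF on', of j j]
    by (metis braket.zero_left zero_neq_one)
  then obtain \<sigma> where \<sigma>: "\<And>j. braket (\<psi> (\<sigma> j)) (\<psi>' j) \<noteq> 0" by metis
  then have q: "q' j = q (\<sigma> j)" for j using eig by blast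
  have zero: "braket (\<psi> n) (\<psi>' j) = 0" if "n \<noteq> \<sigma> j" for n j
    using eig[of j n] that q[of j] \<open>inj q\<close> by (auto dest: injD)
  define c where "c j = braket (\<psi> (\<sigma> j)) (\<psi>' j)" for j
  have \<psi>': "\<psi>' j = c j *\<^sub>C \<psi> (\<sigma> j)" for j
  proof -
    have "braket (\<psi> n) (\<psi>' j - c j *\<^sub>C \<psi> (\<sigma> j)) = 0" for n
      using zero[of n j]
      by (auto simp: braket.diff_right braket_scaleC_right orthonormal_basisD(1)[OF on] c_def)
    then show ?thesis using orthonormal_basisD(2)[OF on] by force
  qed
  have b': "braket (\<psi>' i) (\<psi>' j) = cnj (c i) * c j * (if \<sigma> i = \<sigma> j then 1 else 0)" for i j
    by (simp add: \<psi>' braket_scaleC_left braket_scaleC_right orthonormal_basisD(1)[OF on])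
  have c: "cmod (c j) = 1" for j
  proof -
    have "cmod (cnj (c j) * c j) = 1"
      using b'[of j j] orthonormal_basisD(1)[OF on', of j j] by simp
    then show ?thesis using norm_ge_zero[of "c j"]
      by (simp add: norm_mult power2_eq_square[symmetric] power2_eq_1_iff)
  qed
  have "inj \<sigma>"
  proof (rule injI)
    fix i j assume "\<sigma> i = \<sigma> j"
    then have "braket (\<psi>' i) (\<psi>' j) \<noteq> 0"
      using b'[of i j] c[of i] c[of j] by auto
    then show "i = j" using orthonormal_basisD(1)[OF on', of i j] by presburger
  qed
  \<comment> \<open>An index missed by \<sigma> would give a basis vector orthogonal to all of
    \<psi>'.\<close>
  moreover have "surj \<sigma>"
  proof (rule ccontr)
    assume "\<not> surj \<sigma>"
    then obtain n where "\<And>j. \<sigma> j \<noteq> n" unfolding surj_def by metis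
    then have "braket (\<psi>' j) (\<psi> n) = 0" for j
      by (simp add: \<psi>' braket_scaleC_left orthonormal_basisD(1)[OF on])
    then have "\<psi> n = 0" using orthonormal_basisD(2)[OF on'] by blast
    then show False using orthonormal_basisD(1)[OF on, of n n] by (simp add: braket.zero_left)
  qed
  ultimately show thesis using that[of \<sigma> c] c q \<psi>' by (auto simp: bij_def)
qed

text \<open>Any other decomposition differs by a permutation and phases. The phases drop out of the
  coordinate equations and the permutation only relabels them, so the exponential is well
  defined.\<close>

lemma exp_selfadjoint_simple:
  assumes s: "spectral_decomposition T q \<psi>" and "inj q"
  shows "exp_selfadjoint T = diagonal_op (\<lambda>i. exp (q i)) \<psi>"
  unfolding exp_selfadjoint_def
proof (rule the_equality)
  show "\<exists>q' \<psi>'. spectral_decomposition T q' \<psi>' \<and>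
      diagonal_op (\<lambda>i. exp (q i)) \<psi> = diagonal_op (\<lambda>i. exp (q' i)) \<psi>'"
    using s by blast
next
  fix E assume "\<exists>q' \<psi>'. spectral_decomposition T q' \<psi>' \<and> E = diagonal_op (\<lambda>i. exp (q' i)) \<psi>'"
  then obtain q' \<psi>' where s': "spectral_decomposition T q' \<psi>'"
    and E: "E = diagonal_op (\<lambda>i. exp (q' i)) \<psi>'" by blast
  obtain \<sigma> c where \<sigma>: "bij \<sigma>" "\<And>j. cmod (c j) = 1" "\<And>j. q' j = q (\<sigma> j)"
    "\<And>j. \<psi>' j = c j *\<^sub>C \<psi> (\<sigma> j)"
    using spectral_decomposition_simple[OF s \<open>inj q\<close> s'] by blast
  have on: "orthonormal_basis \<psi>" and on': "orthonormal_basis \<psi>'"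
    using s s' by (auto simp: spectral_decomposition_def)
  have "c j \<noteq> 0" for j using \<sigma>(2)[of j] by auto
  then have "(f, g) \<in> E \<longleftrightarrow> (\<forall>j. braket (\<psi> (\<sigma> j)) g = complex_of_real (exp (q (\<sigma> j))) * braket (\<psi> (\<sigma> j)) f)"
    for f g
    by (simp add: E diagonal_op_iff[OF on'] \<sigma>(3,4) braket_scaleC_left)
  also have "\<dots> f g \<longleftrightarrow> (f, g) \<in> diagonal_op (\<lambda>i. exp (q i)) \<psi>" for f g
    using bij_is_surj[OF \<sigma>(1)] by (simp add: diagonal_op_iff[OF on]) (metis surjD)
  finally show "E = diagonal_op (\<lambda>i. exp (q i)) \<psi>" by auto
qed

section \<open>Traces\<close>

text \<open>Two bounded extensions agree on the dense domain, hence everywhere; comparing the sums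
  in the basis \<open>ket\<close> then suffices.\<close>

lemma has_trace_unique:
  assumes "has_trace T t" "has_trace T t'"
  shows "t = t'"
proof -
  have ext: "\<exists>F. bounded_linear F \<and> T \<subseteq> graph F \<and>
      ((\<lambda>n. braket (ket n) (F (ket n))) has_sum t) UNIV" if "has_trace T t" for t
    using that orthonormal_ket unfolding has_trace_def by blast
  obtain F where F: "bounded_linear F" "T \<subseteq> graph F"
      "((\<lambda>n. braket (ket n) (F (ket n))) has_sum t) UNIV"
    using ext[OF assms(1)] by blast
  obtain G where G: "bounded_linear G" "T \<subseteq> graph G"
      "((\<lambda>n. braket (ket n) (G (ket n))) has_sum t') UNIV"
    using ext[OF assms(2)] by blast
  have d: "closure (Domain T) = UNIV" using assms(1) by (simp add: has_trace_def)
  have "closed {x. F x = G x}"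
    using F(1) G(1) by (intro closed_Collect_eq) (auto intro: linear_continuous_on)
  moreover have "Domain T \<subseteq> {x. F x = G x}"
    using F(2) G(2) by (auto simp: graph_def)
  ultimately have "F x = G x" for x
    using d closure_minimal[of "Domain T" "{x. F x = G x}"] by auto
  then show ?thesis using F(3) G(3) has_sum_unique by (metis (mono_tags, lifting) has_sum_cong)
qed

lemma trace_op_eq: "has_trace T t \<Longrightarrow> trace_op T = t"
  unfolding trace_op_def using has_trace_unique by blast

text \<open>Cauchy-Schwarz and Bessel give a bound that does not depend on the basis; it justifies
  exchanging the two sums in the trace.\<close>

lemma braket_basis_abs_bound:
  assumes on: "orthonormal_basis e" and "finite F"
  shows "(\<Sum>k\<in>F. cmod (braket f (e k) * braket (e k) g)) \<le> norm f * norm g"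
proof -
  have sq: "sqrt (\<Sum>k\<in>F. (cmod (braket (e k) h))\<^sup>2) \<le> norm h" for h
    using bessel[OF assms, of h] by (simp add: real_le_lsqrt)
  have "(\<Sum>k\<in>F. cmod (braket f (e k) * braket (e k) g))
      = (\<Sum>k\<in>F. \<bar>cmod (braket (e k) f)\<bar> * \<bar>cmod (braket (e k) g)\<bar>)"
    by (intro sum.cong refl) (metis abs_norm_cancel braket_commute complex_mod_cnj norm_mult)
  also have "\<dots> \<le> L2_set (\<lambda>k. cmod (braket (e k) f)) F * L2_set (\<lambda>k. cmod (braket (e k) g)) F"
    by (rule L2_set_mult_ineq)
  also have "\<dots> \<le> norm f * norm g"
    unfolding L2_set_def by (intro mult_mono sq) (auto simp: sum_nonneg)
  finally show ?thesis .
qed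

text \<open>
  If \<open>\<phi> n\<close> represents \<open>X\<^sup>* \<psi> n\<close>, then \<open>\<rho> X\<close> is the restriction of the absolutely convergent sum of
  the rank-one operators \<open>q n |\<psi> n\<rangle>\<langle>\<phi> n|\<close>, whose trace is computed by Fubini and Parseval.
\<close>

lemma has_trace_diagonal_mult:
  assumes on: "orthonormal_basis \<psi>"
    and dense: "closure (Domain X) = UNIV"
    and adj: "\<And>f g n. (f, g) \<in> X \<Longrightarrow> braket (\<psi> n) g = braket (\<phi> n) f"
    and summ: "summable (\<lambda>n. \<bar>q n\<bar> * norm (\<phi> n))"
    and t: "(\<lambda>n. complex_of_real (q n) * braket (\<phi> n) (\<psi> n)) sums t"
  shows "has_trace (op_mult (diagonal_op q \<psi>) X) t"
proof -
  define tm where "tm n f = (complex_of_real (q n) * braket (\<phi> n) f) *\<^sub>C \<psi> n" for n f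
  define T' where "T' f = (\<Sum>n. tm n f)" for f
  define M where "M = (\<Sum>n. \<bar>q n\<bar> * norm (\<phi> n))"
  have n\<psi>: "norm (\<psi> n) = 1" for n
  proof -
    have "complex_of_real ((norm (\<psi> n))\<^sup>2) = complex_of_real 1"
      unfolding braket_self_norm[symmetric] orthonormal_basisD(1)[OF on] by simp
    then have "(norm (\<psi> n))\<^sup>2 = 1" using of_real_eq_iff by blast
    then show ?thesis using norm_ge_zero[of "\<psi> n"] by (simp add: power2_eq_1_iff)
  qed
  have nt: "norm (tm n f) \<le> norm f * (\<bar>q n\<bar> * norm (\<phi> n))" for n f
    using mult_left_mono[OF braket_le_norm[of "\<phi> n" f], of "\<bar>q n\<bar>"]
    by (simp add: tm_def norm_scaleC n\<psi> norm_mult mult_ac)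
  have abs: "summable (\<lambda>n. norm (tm n f))" for f
    by (rule summable_comparison_test'[OF summable_mult[OF summ, of "norm f"]]) (simp add: nt)
  have sm: "summable (\<lambda>n. tm n f)" for f by (rule summable_norm_cancel[OF abs])
  have hs: "((\<lambda>n. tm n f) has_sum T' f) UNIV" for f
    unfolding T'_def by (rule norm_summable_imp_has_sum[OF abs]) (rule summable_sums[OF sm])
  have add: "T' (f + g) = T' f + T' g" for f g
    unfolding T'_def suminf_add[OF sm sm]
    by (rule suminf_cong) (simp add: tm_def braket_add_right algebra_simps scaleC_add_left)
  have scale: "T' (c *\<^sub>C f) = c *\<^sub>C T' f" for c f
    unfolding T'_def bounded_linear.suminf[OF scaleC.bounded_linear_right sm]
    by (rule suminf_cong) (simp add: tm_def braket_scaleC_right mult_ac)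
  have bdd: "norm (T' f) \<le> norm f * M" for f
  proof -
    have "norm (T' f) \<le> (\<Sum>n. norm (tm n f))"
      unfolding T'_def by (rule summable_norm[OF abs])
    also have "\<dots> \<le> (\<Sum>n. norm f * (\<bar>q n\<bar> * norm (\<phi> n)))"
      by (rule suminf_le[OF nt abs summable_mult[OF summ]])
    finally show ?thesis unfolding M_def by (simp add: suminf_mult[OF summ])
  qed
  have bl: "bounded_linear T'"
    by (rule bounded_linear_intro[of _ M]) (auto simp: add scale bdd scaleR_scaleC)
  \<comment> \<open>The series for \<open>T' f\<close> converges for every \<open>f\<close>, so the
    product loses nothing of the domain of \<open>X\<close>.\<close>
  have prod: "(f, h) \<in> op_mult (diagonal_op q \<psi>) X \<longleftrightarrow> f \<in> Domain X \<and> h = T' f" for f h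
  proof -
    have "(g, h) \<in> diagonal_op q \<psi> \<longleftrightarrow> ((\<lambda>n. tm n f) has_sum h) UNIV" if "(f, g) \<in> X" for g
    proof -
      have "braket (\<psi> i) g = braket (\<phi> i) f" for i by (rule adj[OF that])
      then show ?thesis by (simp add: diagonal_op_def tm_def)
    qed
    then have "(g, h) \<in> diagonal_op q \<psi> \<longleftrightarrow> h = T' f" if "(f, g) \<in> X" for g
      using that hs has_sum_unique by metis
    then show ?thesis unfolding op_mult_def by blast
  qed
  have "Domain (op_mult (diagonal_op q \<psi>) X) = Domain X" using prod by blast
  moreover have "op_mult (diagonal_op q \<psi>) X \<subseteq> graph T'" using prod by (auto simp: graph_def)
  moreover have "((\<lambda>k. braket (e k) (T' (e k))) has_sum t) UNIV" if e: "orthonormal_basis e" for e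
  proof -
    define a where "a n k = complex_of_real (q n) * (braket (\<phi> n) (e k) * braket (e k) (\<psi> n))" for n k
    have row: "((\<lambda>k. a n k) has_sum complex_of_real (q n) * braket (\<phi> n) (\<psi> n)) UNIV" for n
      unfolding a_def by (intro has_sum_cmult_right parseval_has_sum e)
    have rowbd: "(\<Sum>k\<in>F. cmod (a n k)) \<le> \<bar>q n\<bar> * norm (\<phi> n)" if "finite F" for n F
      using mult_left_mono[OF braket_basis_abs_bound[OF e that, of "\<phi> n" "\<psi> n"], of "\<bar>q n\<bar>"]
      by (simp add: a_def norm_mult sum_distrib_left n\<psi>)
    have rows: "(\<lambda>k. cmod (a n k)) summable_on UNIV" for n
      by (rule nonneg_bdd_above_summable_on) (auto intro!: bdd_aboveI2[of _ _ "\<bar>q n\<bar> * norm (\<phi> n)"] rowbd)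
    have "(\<lambda>n. \<bar>q n\<bar> * norm (\<phi> n)) summable_on UNIV"
      using summ by (simp add: summable_on_UNIV_nonneg_real_iff)
    then have cols: "(\<lambda>n. infsum (\<lambda>k. cmod (a n k)) UNIV) summable_on UNIV"
    proof (rule summable_on_comparison_test)
      show "infsum (\<lambda>k. cmod (a n k)) UNIV \<le> \<bar>q n\<bar> * norm (\<phi> n)" for n
        by (rule infsum_le_finite_sums[OF rows rowbd])
      show "0 \<le> infsum (\<lambda>k. cmod (a n k)) UNIV" for n
        by (rule infsum_nonneg) simp
    qed
    have "(\<lambda>(n, k). a n k) summable_on (UNIV \<times> UNIV)"
      by (rule Infinite_Sum.abs_summable_summable, rule Infinite_Sum.abs_summable_on_Sigma_iff[THEN iffD2])
        (simp add: infsum_nonneg rows cols)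
    then obtain S where S: "((\<lambda>(n, k). a n k) has_sum S) (UNIV \<times> UNIV)"
      by (auto simp: summable_on_def)
    have "((\<lambda>n. complex_of_real (q n) * braket (\<phi> n) (\<psi> n)) has_sum S) UNIV"
      by (rule has_sum_SigmaD[OF S]) (simp add: row)
    then have "(\<lambda>n. complex_of_real (q n) * braket (\<phi> n) (\<psi> n)) sums S"
      by (rule has_sum_imp_sums)
    then have "S = t" using t sums_unique2 by blast
    have "((\<lambda>(k, n). a n k) has_sum S) (UNIV \<times> UNIV)"
      using has_sum_swap[THEN iffD1, OF S] by simp
    then have "((\<lambda>k. braket (e k) (T' (e k))) has_sum S) UNIV"
    proof (rule has_sum_SigmaD)
      fix k
      show "((\<lambda>n. case (k, n) of (k, n) \<Rightarrow> a n k) has_sum braket (e k) (T' (e k))) UNIV"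
        using has_sum_bounded_linear[OF braket.bounded_linear_right hs[of "e k"], of "e k"]
        by (simp add: o_def tm_def a_def braket_scaleC_right mult_ac)
    qed
    then show ?thesis by (simp add: \<open>S = t\<close>)
  qed
  ultimately show ?thesis unfolding has_trace_def using dense bl scale by auto
qed

section \<open>Quadratic expressions in the ladder operators\<close>

text \<open>
  \<open>a\<close>, \<open>a\<^sup>\<dagger>\<close> and (below) \<open>p a\<^sup>2 + q a\<^sup>\<dagger>\<^sup>2 + u a + v a\<^sup>\<dagger>\<close> act on arbitrary coefficient sequences, square
  summable or not, so that operator identities can be checked without regard to domains.
\<close>

definition lower :: "(nat \<Rightarrow> complex) \<Rightarrow> nat \<Rightarrow> complex" where
  "lower f k = complex_of_real (sqrt (real (Suc k))) * f (Suc k)"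

text \<open>At \<open>k = 0\<close> the truncated index \<open>k - 1\<close> refers to
  \<open>f 0\<close>, but its weight is \<open>sqrt 0\<close>.\<close>

definition raise :: "(nat \<Rightarrow> complex) \<Rightarrow> nat \<Rightarrow> complex" where
  "raise f k = complex_of_real (sqrt (real k)) * f (k - 1)"

lemma raise_0 [simp]: "raise f 0 = 0"
  by (simp add: raise_def)

lemma ladder_linear:
  "lower (\<lambda>k. f k + g k) = (\<lambda>k. lower f k + lower g k)"
  "lower (\<lambda>k. c * f k) = (\<lambda>k. c * lower f k)"
  "lower (\<lambda>k. - f k) = (\<lambda>k. - lower f k)"
  "raise (\<lambda>k. f k + g k) = (\<lambda>k. raise f k + raise g k)"
  "raise (\<lambda>k. c * f k) = (\<lambda>k. c * raise f k)"
  "raise (\<lambda>k. - f k) = (\<lambda>k. - raise f k)"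
  by (simp_all add: lower_def raise_def fun_eq_iff algebra_simps)

lemma of_real_sqrt_sq: "complex_of_real (sqrt (real n)) * (complex_of_real (sqrt (real n)) * z) = of_nat n * z"
proof -
  have "complex_of_real (sqrt (real n)) * complex_of_real (sqrt (real n)) = of_nat n"
    by (metis of_real_mult of_real_of_nat_eq real_sqrt_mult_self abs_of_nat)
  then show ?thesis by (metis mult.assoc)
qed

lemma raise_lower: "raise (lower f) k = of_nat k * f k"
  by (cases k) (simp_all add: lower_def raise_def of_real_sqrt_sq del: of_nat_Suc)

text \<open>The canonical commutation relation, oriented as a rewrite rule that produces normal
  order.\<close>

lemma lower_raise: "lower (raise f) = (\<lambda>k. raise (lower f) k + f k)"
proof
  fix k
  have "lower (raise f) k = of_nat (Suc k) * f k"
    by (simp add: lower_def raise_def of_real_sqrt_sq del: of_nat_Suc)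
  then show "lower (raise f) k = raise (lower f) k + f k"
    by (simp add: raise_lower algebra_simps)
qed

definition quad :: "complex \<Rightarrow> complex \<Rightarrow> complex \<Rightarrow> complex \<Rightarrow> (nat \<Rightarrow> complex) \<Rightarrow> nat \<Rightarrow> complex" where
  "quad p q u v f k = p * lower (lower f) k + q * raise (raise f) k + u * lower f k + v * raise f k"

lemma quad_add: "quad p q u v (\<lambda>k. f k + g k) k = quad p q u v f k + quad p q u v g k"
  and quad_scale: "quad p q u v (\<lambda>k. c * f k) k = c * quad p q u v f k"
  by (simp_all add: quad_def ladder_linear algebra_simps)

text \<open>Bringing both sides to normal order leaves
  \<open>[a, a\<^sup>\<dagger>\<^sup>2] = 2 a\<^sup>\<dagger>\<close>,
  \<open>[a\<^sup>\<dagger>, a\<^sup>2] = -2 a\<close> and a scalar from the linear parts.\<close>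

lemma quad_commutator:
  "quad 0 0 x y (quad p q u v f) k
    = quad p q u v (quad 0 0 x y f) k + quad 0 0 (-2 * y * p) (2 * x * q) f k + (x * v - y * u) * f k"
  unfolding quad_def[abs_def]
  by (simp add: ladder_linear lower_raise) (simp add: algebra_simps)

text \<open>The maximal operator of the expression: its domain contains every vector that the
  expression maps back into the Fock space.\<close>

definition quad_op :: "complex \<Rightarrow> complex \<Rightarrow> complex \<Rightarrow> complex \<Rightarrow> operator" where
  "quad_op p q u v = {(f, g). \<forall>k. coeff g k = quad p q u v (coeff f) k}"

lemma quad_op_iff: "(f, g) \<in> quad_op p q u v \<longleftrightarrow> coeff g = quad p q u v (coeff f)"
  by (auto simp: quad_op_def)

lemma quad_op_fun: "(f, g) \<in> quad_op p q u v \<Longrightarrow> (f, h) \<in> quad_op p q u v \<Longrightarrow> g = h"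
  by (simp add: quad_op_iff) (metis coeff_inject)

lemma op_app_quad_op: "(f, g) \<in> quad_op p q u v \<Longrightarrow> op_app (quad_op p q u v) f = g"
  unfolding op_app_def using quad_op_fun by blast

lemma quad_op_add:
  "(f, g) \<in> quad_op p q u v \<Longrightarrow> (f', g') \<in> quad_op p q u v \<Longrightarrow> (f + f', g + g') \<in> quad_op p q u v"
  by (simp add: quad_op_iff fun_eq_iff quad_add coeff_simps(2)[abs_def])

lemma quad_op_scaleC: "(f, g) \<in> quad_op p q u v \<Longrightarrow> (c *\<^sub>C f, c *\<^sub>C g) \<in> quad_op p q u v"
  by (simp add: quad_op_iff fun_eq_iff quad_scale coeff_simps(6)[abs_def])

lemma quad_tendsto:
  assumes "\<And>k. ((\<lambda>n. f n k) \<longlongrightarrow> g k) F"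
  shows "((\<lambda>n. quad p q u v (f n) k) \<longlongrightarrow> quad p q u v g k) F"
  unfolding quad_def lower_def raise_def by (intro tendsto_intros assms)

lemma coeff_tendsto: "(f \<longlongrightarrow> g) F \<Longrightarrow> ((\<lambda>n. coeff (f n) k) \<longlongrightarrow> coeff g k) F"
  by (rule bounded_linear.tendsto[OF bounded_linear_coeff])

text \<open>A coordinate of \<open>quad\<close> involves only finitely many coordinates of its
  argument, so the defining equations survive limits and the maximal operator is closed.\<close>

lemma quad_op_tendsto:
  assumes f: "f \<longlonglongrightarrow> f'" and g: "g \<longlonglongrightarrow> g'" and fg: "\<And>n. (f n, g n) \<in> quad_op p q u v"
  shows "(f', g') \<in> quad_op p q u v"
  unfolding quad_op_iff
proof
  fix k
  have "(\<lambda>n. coeff (g n) k) \<longlonglongrightarrow> quad p q u v (coeff f') k"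
    using fg by (simp add: quad_op_iff quad_tendsto[OF coeff_tendsto[OF f]])
  then show "coeff g' k = quad p q u v (coeff f') k"
    using coeff_tendsto[OF g] LIMSEQ_unique by blast
qed

lemma closed_quad_op: "closed (quad_op p q u v)"
  unfolding closed_sequential_limits
proof (intro allI impI, elim conjE)
  fix x and l :: "fock \<times> fock"
  assume x: "\<forall>n. x n \<in> quad_op p q u v" "x \<longlonglongrightarrow> l"
  have "(fst l, snd l) \<in> quad_op p q u v"
  proof (rule quad_op_tendsto)
    show "(\<lambda>n. fst (x n)) \<longlonglongrightarrow> fst l" "(\<lambda>n. snd (x n)) \<longlonglongrightarrow> snd l"
      using x(2) by (rule tendsto_fst, rule tendsto_snd)
    show "(fst (x n), snd (x n)) \<in> quad_op p q u v" for n
      using x(1) by simp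
  qed
  then show "l \<in> quad_op p q u v" by simp
qed

subsection \<open>Finitely supported vectors\<close>

definition finvec :: "fock set" where
  "finvec = {f. \<exists>m. \<forall>k\<ge>m. coeff f k = 0}"

lemma finvecI: "(\<And>k. k \<ge> m \<Longrightarrow> coeff f k = 0) \<Longrightarrow> f \<in> finvec"
  unfolding finvec_def by blast

lemma finvecE:
  assumes "f \<in> finvec" obtains m where "\<And>k. k \<ge> m \<Longrightarrow> coeff f k = 0"
  using assms unfolding finvec_def by blast

lemma finvec_add: "f \<in> finvec \<Longrightarrow> g \<in> finvec \<Longrightarrow> f + g \<in> finvec"
proof (elim finvecE)
  fix m n assume "\<And>k. m \<le> k \<Longrightarrow> coeff f k = 0" "\<And>k. n \<le> k \<Longrightarrow> coeff g k = 0"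
  then show ?thesis by (intro finvecI[of "max m n"]) simp
qed

lemma finvec_scaleC: "f \<in> finvec \<Longrightarrow> c *\<^sub>C f \<in> finvec"
  by (auto simp: finvec_def)

lemma finvec_0: "0 \<in> finvec"
  by (simp add: finvecI)

lemma finvec_uminus: "f \<in> finvec \<Longrightarrow> - f \<in> finvec"
  by (auto simp: finvec_def)

lemma finvec_diff: "f \<in> finvec \<Longrightarrow> g \<in> finvec \<Longrightarrow> f - g \<in> finvec"
  using finvec_add[of f "- g"] finvec_uminus[of g] by simp

lemma finvec_sum: "(\<And>i. i \<in> I \<Longrightarrow> f i \<in> finvec) \<Longrightarrow> sum f I \<in> finvec"
  by (induction I rule: infinite_finite_induct) (auto intro: finvec_0 finvec_add)

lemma finvec_ket: "ket k \<in> finvec"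
  by (rule finvecI[of "Suc k"]) simp

lemma coeff_sum: "coeff (sum f I) k = (\<Sum>i\<in>I. coeff (f i) k)"
  by (rule linear_sum[OF bounded_linear.linear[OF bounded_linear_coeff]])

lemma coeff_Abs_fin:
  assumes "\<And>k. k \<ge> m \<Longrightarrow> f k = 0"
  shows "coeff (Abs_fock f) = f"
proof -
  have "summable (\<lambda>k. (cmod (f k))\<^sup>2)"
    by (rule summable_finite[of "{..<m}"]) (auto simp: assms not_less)
  then show ?thesis by (simp add: Abs_fock_inverse)
qed

definition trunc :: "nat \<Rightarrow> fock \<Rightarrow> fock" where
  "trunc n f = (\<Sum>k<n. coeff f k *\<^sub>C ket k)"

lemma coeff_trunc: "coeff (trunc n f) k = (if k < n then coeff f k else 0)"
proof -
  have "coeff (trunc n f) k = (\<Sum>i<n. if k = i then coeff f i else 0)"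
    unfolding trunc_def coeff_sum by (rule sum.cong) auto
  then show ?thesis by simp
qed

lemma trunc_eq: "(\<And>k. k \<ge> m \<Longrightarrow> coeff f k = 0) \<Longrightarrow> n \<ge> m \<Longrightarrow> trunc n f = f"
  by (rule fock_eqI) (simp add: coeff_trunc)

lemma finvec_trunc: "trunc n f \<in> finvec"
  unfolding trunc_def by (intro finvec_sum finvec_scaleC finvec_ket)

lemma trunc_tendsto: "(\<lambda>n. trunc n f) \<longlonglongrightarrow> f"
  using orthonormal_expansion_sums[OF orthonormal_ket, of f]
  by (simp add: sums_def trunc_def braket_ket)

lemma closure_finvec: "closure finvec = UNIV"
  using closure_sequential trunc_tendsto finvec_trunc by (metis UNIV_eq_I)

lemma lower_fin: "(\<And>k. k \<ge> m \<Longrightarrow> f k = 0) \<Longrightarrow> k \<ge> m \<Longrightarrow> lower f k = 0"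
  by (simp add: lower_def)

lemma raise_fin: "(\<And>k. k \<ge> m \<Longrightarrow> f k = 0) \<Longrightarrow> k \<ge> Suc m \<Longrightarrow> raise f k = 0"
  by (simp add: raise_def)

lemma quad_fin: "(\<And>k. k \<ge> m \<Longrightarrow> f k = 0) \<Longrightarrow> k \<ge> m + 2 \<Longrightarrow> quad p q u v f k = 0"
proof -
  assume f: "\<And>k. k \<ge> m \<Longrightarrow> f k = 0" and k: "k \<ge> m + 2"
  have "lower (lower f) k = 0" "lower f k = 0" "raise f k = 0"
    using k by (auto intro!: lower_fin[of m] raise_fin[of m] f)
  moreover have "raise (raise f) k = 0"
    by (rule raise_fin[of "Suc m"]) (use k in \<open>auto intro!: raise_fin[of m] f\<close>)
  ultimately show ?thesis by (simp add: quad_def)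
qed

text \<open>Meaningful on \<open>finvec\<close>, where the expression stays finitely supported;
  elsewhere \<open>Abs_fock\<close> may be applied to a sequence that is not square
  summable.\<close>

definition quadv :: "complex \<Rightarrow> complex \<Rightarrow> complex \<Rightarrow> complex \<Rightarrow> fock \<Rightarrow> fock" where
  "quadv p q u v f = Abs_fock (quad p q u v (coeff f))"

lemma coeff_quadv: "f \<in> finvec \<Longrightarrow> coeff (quadv p q u v f) = quad p q u v (coeff f)"
  unfolding quadv_def by (elim finvecE, rule coeff_Abs_fin, rule quad_fin)

lemma finvec_quadv: "f \<in> finvec \<Longrightarrow> quadv p q u v f \<in> finvec"
proof (frule finvecE)
  fix m assume f: "f \<in> finvec" and "\<And>k. m \<le> k \<Longrightarrow> coeff f k = 0"
  then show "quadv p q u v f \<in> finvec"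
    by (intro finvecI[of "m + 2"]) (simp add: coeff_quadv quad_fin[of m])
qed

lemma quadv_in_quad_op: "f \<in> finvec \<Longrightarrow> (f, quadv p q u v f) \<in> quad_op p q u v"
  by (simp add: quad_op_iff coeff_quadv)

lemma quadv_add:
  "f \<in> finvec \<Longrightarrow> g \<in> finvec \<Longrightarrow> quadv p q u v (f + g) = quadv p q u v f + quadv p q u v g"
  by (rule quad_op_fun[OF quadv_in_quad_op quad_op_add[OF quadv_in_quad_op quadv_in_quad_op]])
    (auto intro: finvec_add)

lemma quadv_scaleC: "f \<in> finvec \<Longrightarrow> quadv p q u v (c *\<^sub>C f) = c *\<^sub>C quadv p q u v f"
  by (rule quad_op_fun[OF quadv_in_quad_op quad_op_scaleC[OF quadv_in_quad_op]])
    (auto intro: finvec_scaleC)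

lemma quadv_0: "quadv p q u v 0 = 0"
  using quadv_scaleC[OF finvec_0, of p q u v 0] by simp

lemma quadv_sum:
  "finite I \<Longrightarrow> (\<And>i. i \<in> I \<Longrightarrow> f i \<in> finvec) \<Longrightarrow> quadv p q u v (sum f I) = (\<Sum>i\<in>I. quadv p q u v (f i))"
  by (induction I rule: finite_induct) (auto simp: quadv_0 quadv_add finvec_sum)

subsection \<open>Finitely supported vectors form a core\<close>

text \<open>Boundary terms of a sharp cutoff at \<open>n\<close> carry weights of order
  \<open>n\<close>. Spreading the drop over the \<open>n\<close> steps up to \<open>2 * n\<close>
  keeps the product of weight and slope bounded.\<close>

definition ramp :: "nat \<Rightarrow> nat \<Rightarrow> real" where
  "ramp n k = min 1 (real (2 * n - k) / real n)"

lemma ramp_bounds: "0 \<le> ramp n k" "ramp n k \<le> 1"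
  by (auto simp: ramp_def)

lemma ramp_eq_1: "k \<le> n \<Longrightarrow> n > 0 \<Longrightarrow> ramp n k = 1"
  by (simp add: ramp_def field_simps of_nat_diff)

lemma ramp_eq_0: "k \<ge> 2 * n \<Longrightarrow> ramp n k = 0"
  by (simp add: ramp_def)

text \<open>For k \<ge> 2n + 2 both values vanish. Otherwise two steps of slope 1/n change the ramp
  by at most 2/n, while k + 2 \<le> 2n + 3; the product is at most 10, rounded up to 12.\<close>

lemma ramp_lipschitz:
  assumes "n > 0" "j \<le> k + 2" "k \<le> j + 2"
  shows "\<bar>ramp n j - ramp n k\<bar> * real (k + 2) \<le> 12"
proof (cases "k \<ge> 2 * n + 2")
  case True
  then show ?thesis using assms by (simp add: ramp_eq_0)
next
  case False
  have "\<bar>ramp n j - ramp n k\<bar> \<le> \<bar>real (2 * n - j) / real n - real (2 * n - k) / real n\<bar>"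
    unfolding ramp_def by linarith
  also have "\<dots> = \<bar>real (2 * n - j) - real (2 * n - k)\<bar> / real n"
    by (simp add: diff_divide_distrib[symmetric] abs_divide)
  also have "\<dots> \<le> 2 / real n"
    using assms by (intro divide_right_mono) auto
  finally have "\<bar>ramp n j - ramp n k\<bar> * real (k + 2) \<le> 2 / real n * real (k + 2)"
    by (rule mult_right_mono) simp
  also have "\<dots> \<le> 12" using False assms(1) by (simp add: field_simps)
  finally show ?thesis .
qed

lemma ladder_weights:
  "sqrt (real (Suc k)) \<le> real (k + 2)" "sqrt (real k) \<le> real (k + 2)"
  "sqrt (real (Suc k)) * sqrt (real (Suc (Suc k))) \<le> real (k + 2)"
  "sqrt (real k) * sqrt (real (k - 1)) \<le> real (k + 2)"
proof -
  have *: "sqrt (real m) * sqrt (real n) \<le> real (k + 2)" if "m \<le> k + 2" "n \<le> k + 2" for m n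
  proof -
    have "sqrt (real m) * sqrt (real n) \<le> sqrt (real (k + 2)) * sqrt (real (k + 2))"
      using that by (intro mult_mono) auto
    then show ?thesis by simp
  qed
  show "sqrt (real (Suc k)) \<le> real (k + 2)" "sqrt (real k) \<le> real (k + 2)"
    using *[of "Suc k" 1] *[of k 1] by auto
  show "sqrt (real (Suc k)) * sqrt (real (Suc (Suc k))) \<le> real (k + 2)"
    "sqrt (real k) * sqrt (real (k - 1)) \<le> real (k + 2)"
    by (rule *; simp)+
qed

lemma quad_ramp_bound:
  assumes "n > 0"
  shows "cmod (quad p q u v (\<lambda>k. complex_of_real (ramp n k) * f k) k)
    \<le> cmod (quad p q u v f k) + 12 * (cmod p * cmod (f (k + 2)) + cmod q * cmod (f (k - 2))
        + cmod u * cmod (f (k + 1)) + cmod v * cmod (f (k - 1)))"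
proof -
  define r where "r j = complex_of_real (ramp n j - ramp n k)" for j
  define A where "A = p * (complex_of_real (sqrt (real (Suc k)) * sqrt (real (Suc (Suc k)))) * (r (k + 2) * f (k + 2)))"
  define B where "B = q * (complex_of_real (sqrt (real k) * sqrt (real (k - 1))) * (r (k - 2) * f (k - 2)))"
  define C where "C = u * (complex_of_real (sqrt (real (Suc k))) * (r (k + 1) * f (k + 1)))"
  define D where "D = v * (complex_of_real (sqrt (real k)) * (r (k - 1) * f (k - 1)))"
  \<comment> \<open>Pulling out the value of the ramp at \<open>k\<close> leaves its commutator with
    the expression: four neighbour terms weighted by ramp differences.\<close>
  have eq: "quad p q u v (\<lambda>k. complex_of_real (ramp n k) * f k) k
      = complex_of_real (ramp n k) * quad p q u v f k + (A + B + C + D)"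
    unfolding quad_def lower_def raise_def A_def B_def C_def D_def r_def
    by (simp add: numeral_2_eq_2) (simp add: algebra_simps)
  have bd: "cmod (c * (complex_of_real w * (r j * f j))) \<le> 12 * (cmod c * cmod (f j))"
    if "0 \<le> w" "w \<le> real (k + 2)" "j \<le> k + 2" "k \<le> j + 2" for c w j
  proof -
    have "w * \<bar>ramp n j - ramp n k\<bar> \<le> real (k + 2) * \<bar>ramp n j - ramp n k\<bar>"
      using that by (intro mult_right_mono) auto
    also have "\<dots> \<le> 12" using ramp_lipschitz[OF assms that(3,4)] by (simp add: mult.commute)
    finally have "(w * \<bar>ramp n j - ramp n k\<bar>) * (cmod c * cmod (f j)) \<le> 12 * (cmod c * cmod (f j))"
      by (intro mult_right_mono) auto
    then show ?thesis using that(1) unfolding r_def norm_mult norm_of_real by (simp add: mult_ac)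
  qed
  have "cmod A \<le> 12 * (cmod p * cmod (f (k + 2)))" unfolding A_def
    by (rule bd) (use ladder_weights in auto)
  moreover have "cmod B \<le> 12 * (cmod q * cmod (f (k - 2)))" unfolding B_def
    by (rule bd) (use ladder_weights in auto)
  moreover have "cmod C \<le> 12 * (cmod u * cmod (f (k + 1)))" unfolding C_def
    by (rule bd) (use ladder_weights in auto)
  moreover have "cmod D \<le> 12 * (cmod v * cmod (f (k - 1)))" unfolding D_def
    by (rule bd) (use ladder_weights in auto)
  moreover have "cmod (complex_of_real (ramp n k) * quad p q u v f k) \<le> cmod (quad p q u v f k)"
    using mult_right_mono[OF ramp_bounds(2)[of n k], of "cmod (quad p q u v f k)"] ramp_bounds(1)[of n k]
    by (simp add: norm_mult)
  moreover have "cmod (A + B + C + D) \<le> cmod A + cmod B + cmod C + cmod D"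
    using norm_triangle_ineq[of A B] norm_triangle_ineq[of "A + B" C]
      norm_triangle_ineq[of "A + B + C" D] by linarith
  ultimately show ?thesis unfolding eq
    using norm_triangle_ineq[of "complex_of_real (ramp n k) * quad p q u v f k" "A + B + C + D"]
    by (simp add: algebra_simps)
qed

lemma summable_sq_add:
  fixes f g :: "nat \<Rightarrow> real"
  assumes "summable (\<lambda>k. (f k)\<^sup>2)" "summable (\<lambda>k. (g k)\<^sup>2)"
  shows "summable (\<lambda>k. (f k + g k)\<^sup>2)"
  using sq_summable_add[of "\<lambda>k. complex_of_real (f k)" "\<lambda>k. complex_of_real (g k)"] assms
  unfolding of_real_add[symmetric] norm_of_real power2_abs by blast

lemma summable_sq_cmult:
  fixes f :: "nat \<Rightarrow> real"
  assumes "summable (\<lambda>k. (f k)\<^sup>2)"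
  shows "summable (\<lambda>k. (c * f k)\<^sup>2)"
  using assms by (simp add: power_mult_distrib summable_mult)

text \<open>The smoothly cut off vectors and their images converge coordinatewise, and
  \<open>quad_ramp_bound\<close> supplies a square summable majorant that does not depend on
  \<open>n\<close>.\<close>

lemma quad_op_core:
  assumes fg: "(f, g) \<in> quad_op p q u v"
  obtains h where "\<And>n. h n \<in> finvec" "h \<longlonglongrightarrow> f" "(\<lambda>n. quadv p q u v (h n)) \<longlonglongrightarrow> g"
proof -
  \<comment> \<open>\<open>Suc n\<close> avoids a ramp of slope 1/0.\<close>
  define h where "h n = Abs_fock (\<lambda>k. complex_of_real (ramp (Suc n) k) * coeff f k)" for n
  have ch: "coeff (h n) = (\<lambda>k. complex_of_real (ramp (Suc n) k) * coeff f k)" for n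
    unfolding h_def by (rule coeff_Abs_fin[of "2 * Suc n"]) (simp add: ramp_eq_0)
  have fin: "h n \<in> finvec" for n
    by (rule finvecI[of "2 * Suc n"]) (simp add: ch ramp_eq_0)
  have lim: "(\<lambda>n. coeff (h n) k) \<longlonglongrightarrow> coeff f k" for k
  proof (rule tendsto_eventually, rule eventually_sequentiallyI)
    show "coeff (h n) k = coeff f k" if "n \<ge> k" for n
      using that by (simp add: ch ramp_eq_1)
  qed
  have "h \<longlonglongrightarrow> f"
  proof (rule fock_tendsto_dominated[OF lim])
    show "cmod (coeff (h n) k) \<le> cmod (coeff f k)" for n k
      using mult_right_mono[OF ramp_bounds(2)[of "Suc n" k], of "cmod (coeff f k)"]
        ramp_bounds(1)[of "Suc n" k]
      by (simp add: ch norm_mult)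
  qed (rule coeff_summable)
  moreover have "(\<lambda>n. quadv p q u v (h n)) \<longlonglongrightarrow> g"
  proof (rule fock_tendsto_dominated)
    show "(\<lambda>n. coeff (quadv p q u v (h n)) k) \<longlonglongrightarrow> coeff g k" for k
      using quad_tendsto[OF lim] fg by (simp add: coeff_quadv fin quad_op_iff)
    show "cmod (coeff (quadv p q u v (h n)) k) \<le>
        cmod (coeff g k) + 12 * (cmod p * cmod (coeff f (k + 2)) + cmod q * cmod (coeff f (k - 2))
        + cmod u * cmod (coeff f (k + 1)) + cmod v * cmod (coeff f (k - 1)))" for n k
      using quad_ramp_bound[of "Suc n" p q u v "coeff f" k] fg
      by (simp add: coeff_quadv fin quad_op_iff ch)
    have up: "summable (\<lambda>k. (cmod (coeff f (k + i)))\<^sup>2)" for i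
      using coeff_summable[of f] by (subst summable_iff_shift)
    \<comment> \<open>Truncated subtraction repeats coordinate 0 for the first \<open>i\<close>
      indices; dropping these terms gives back the original series.\<close>
    have down: "summable (\<lambda>k. (cmod (coeff f (k - i)))\<^sup>2)" for i
      using coeff_summable[of f] summable_iff_shift[of "\<lambda>k. (cmod (coeff f (k - i)))\<^sup>2" i] by simp
    show "summable (\<lambda>k. (cmod (coeff g k) + 12 * (cmod p * cmod (coeff f (k + 2))
        + cmod q * cmod (coeff f (k - 2)) + cmod u * cmod (coeff f (k + 1))
        + cmod v * cmod (coeff f (k - 1))))\<^sup>2)"
      by (intro summable_sq_add summable_sq_cmult up down coeff_summable)
  qed
  ultimately show thesis using that fin by blast
qed

text \<open>\<open>T\<close> may have any natural domain between \<open>finvec\<close> and the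
  maximal one: closedness gives one inclusion, the core property the other.\<close>

lemma closure_eq_quad_op:
  assumes "\<And>f. f \<in> finvec \<Longrightarrow> (f, quadv p q u v f) \<in> T" and "T \<subseteq> quad_op p q u v"
  shows "closure T = quad_op p q u v"
proof
  show "closure T \<subseteq> quad_op p q u v" by (rule closure_minimal[OF assms(2) closed_quad_op])
  show "quad_op p q u v \<subseteq> closure T"
  proof (rule subrelI)
    fix f g assume "(f, g) \<in> quad_op p q u v"
    then obtain h where h: "\<And>n. h n \<in> finvec" "h \<longlonglongrightarrow> f" "(\<lambda>n. quadv p q u v (h n)) \<longlonglongrightarrow> g"
      using quad_op_core by blast
    have "(\<lambda>n. (h n, quadv p q u v (h n))) \<longlonglongrightarrow> (f, g)" by (intro tendsto_Pair h)
    moreover have "(h n, quadv p q u v (h n)) \<in> T" for n by (rule assms(1)[OF h(1)])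
    ultimately show "(f, g) \<in> closure T" unfolding closure_sequential
      by (intro exI[of _ "\<lambda>n. (h n, quadv p q u v (h n))"]) simp
  qed
qed

subsection \<open>Adjoints\<close>

text \<open>An index shift whose head term vanishes because \<open>raise f 0 = 0\<close>. Finite
  support of \<open>f\<close> makes the sums finite, so \<open>g\<close> may be an arbitrary
  sequence.\<close>

lemma suminf_cnj_lower:
  assumes "\<And>k. k \<ge> m \<Longrightarrow> f k = 0"
  shows "(\<Sum>k. cnj (f k) * lower g k) = (\<Sum>k. cnj (raise f k) * g k)"
proof -
  have "summable (\<lambda>k. cnj (raise f k) * g k)"
  proof (rule summable_finite[of "{..m}"])
    show "cnj (raise f k) * g k = 0" if "k \<notin> {..m}" for k
    proof -
      have "raise f k = 0" by (rule raise_fin[OF assms]) (use that in auto)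
      then show ?thesis by simp
    qed
  qed simp
  from suminf_split_head[OF this] show ?thesis
    by (simp add: lower_def raise_def mult_ac)
qed

lemma suminf_cnj_raise:
  assumes "\<And>k. k \<ge> m \<Longrightarrow> f k = 0"
  shows "(\<Sum>k. cnj (f k) * raise g k) = (\<Sum>k. cnj (lower f k) * g k)"
proof -
  have "summable (\<lambda>k. cnj (f k) * raise g k)"
  proof (rule summable_finite[of "{..m}"])
    show "cnj (f k) * raise g k = 0" if "k \<notin> {..m}" for k
      using assms that by simp
  qed simp
  from suminf_split_head[OF this] show ?thesis
    by (simp add: lower_def raise_def mult_ac)
qed

text \<open>The ladder operators are moved to the left one at a time. Intermediate sequences such as
  \<open>lower\<close> of \<open>g\<close> need not be square summable, so the argument uses finite
  sums of products instead of \<open>braket\<close>.\<close>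

lemma braket_quadv_adjoint:
  assumes fin: "f \<in> finvec" and gh: "(g, h) \<in> quad_op p q u v"
  shows "braket f h = braket (quadv (cnj q) (cnj p) (cnj v) (cnj u) f) g"
proof -
  obtain m where m: "\<And>k. k \<ge> m \<Longrightarrow> coeff f k = 0" using finvecE[OF fin] by blast
  let ?f = "coeff f" and ?g = "coeff g"
  have s: "summable (\<lambda>k. cnj (x k) * y k)" if "\<And>k. k \<ge> n \<Longrightarrow> x k = 0" for x y n
  proof (rule summable_finite[of "{..<n}"])
    show "cnj (x k) * y k = 0" if "k \<notin> {..<n}" for k
      using \<open>\<And>k. k \<ge> n \<Longrightarrow> x k = 0\<close> that by simp
  qed simp
  have r: "raise ?f k = 0" if "k \<ge> Suc m" for k by (rule raise_fin[OF m that])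
  have l: "lower ?f k = 0" if "k \<ge> m" for k by (rule lower_fin[OF m that])
  have rr: "raise (raise ?f) k = 0" if "k \<ge> Suc (Suc m)" for k by (rule raise_fin[OF r that])
  have ll: "lower (lower ?f) k = 0" if "k \<ge> m" for k by (rule lower_fin[OF l that])
  note sm = s[OF m] s[OF r] s[OF l] s[OF rr] s[OF ll]
  have "(\<lambda>k. p * (cnj (?f k) * lower (lower ?g) k) + q * (cnj (?f k) * raise (raise ?g) k)
      + u * (cnj (?f k) * lower ?g k) + v * (cnj (?f k) * raise ?g k))
    sums (p * (\<Sum>k. cnj (?f k) * lower (lower ?g) k) + q * (\<Sum>k. cnj (?f k) * raise (raise ?g) k)
      + u * (\<Sum>k. cnj (?f k) * lower ?g k) + v * (\<Sum>k. cnj (?f k) * raise ?g k))"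
    by (intro sums_add sums_mult summable_sums sm)
  then have 1: "braket f h = p * (\<Sum>k. cnj (?f k) * lower (lower ?g) k) + q * (\<Sum>k. cnj (?f k) * raise (raise ?g) k)
      + u * (\<Sum>k. cnj (?f k) * lower ?g k) + v * (\<Sum>k. cnj (?f k) * raise ?g k)"
    using gh unfolding braket_def quad_op_iff quad_def[abs_def]
    by (simp add: sums_iff algebra_simps)
  have "(\<lambda>k. p * (cnj (raise (raise ?f) k) * ?g k) + q * (cnj (lower (lower ?f) k) * ?g k)
      + u * (cnj (raise ?f k) * ?g k) + v * (cnj (lower ?f k) * ?g k))
    sums (p * (\<Sum>k. cnj (raise (raise ?f) k) * ?g k) + q * (\<Sum>k. cnj (lower (lower ?f) k) * ?g k)
      + u * (\<Sum>k. cnj (raise ?f k) * ?g k) + v * (\<Sum>k. cnj (lower ?f k) * ?g k))"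
    by (intro sums_add sums_mult summable_sums sm)
  then have 2: "braket (quadv (cnj q) (cnj p) (cnj v) (cnj u) f) g
    = p * (\<Sum>k. cnj (raise (raise ?f) k) * ?g k) + q * (\<Sum>k. cnj (lower (lower ?f) k) * ?g k)
      + u * (\<Sum>k. cnj (raise ?f k) * ?g k) + v * (\<Sum>k. cnj (lower ?f k) * ?g k)"
    unfolding braket_def coeff_quadv[OF fin] quad_def
    by (simp add: sums_iff algebra_simps)
  have "(\<Sum>k. cnj (?f k) * lower y k) = (\<Sum>k. cnj (raise ?f k) * y k)"
    "(\<Sum>k. cnj (raise ?f k) * lower y k) = (\<Sum>k. cnj (raise (raise ?f) k) * y k)"
    "(\<Sum>k. cnj (?f k) * raise y k) = (\<Sum>k. cnj (lower ?f k) * y k)"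
    "(\<Sum>k. cnj (lower ?f k) * raise y k) = (\<Sum>k. cnj (lower (lower ?f) k) * y k)" for y
    by (rule suminf_cnj_lower, erule m, rule suminf_cnj_lower, erule r,
      rule suminf_cnj_raise, erule m, rule suminf_cnj_raise, erule l)
  then show ?thesis unfolding 1 2 by simp
qed

lemma braket_quad_op_adjoint:
  assumes "(f, f') \<in> quad_op (cnj q) (cnj p) (cnj v) (cnj u)" and gh: "(g, h) \<in> quad_op p q u v"
  shows "braket f h = braket f' g"
proof -
  obtain x where x: "\<And>n. x n \<in> finvec" "x \<longlonglongrightarrow> f"
      "(\<lambda>n. quadv (cnj q) (cnj p) (cnj v) (cnj u) (x n)) \<longlonglongrightarrow> f'"
    using quad_op_core[OF assms(1)] by blast
  have "(\<lambda>n. braket (x n) h) \<longlonglongrightarrow> braket f h"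
    by (intro braket.tendsto x tendsto_const)
  moreover have "(\<lambda>n. braket (x n) h) \<longlonglongrightarrow> braket f' g"
    unfolding braket_quadv_adjoint[OF x(1) gh] by (intro braket.tendsto x tendsto_const)
  ultimately show ?thesis by (rule LIMSEQ_unique)
qed

text \<open>Testing against the kets suffices: the identity holds for truncations of
  \<open>f\<close>, and coordinate \<open>k\<close> of the expression is continuous along them. This
  is how adjoints and generators are shown to lie in the maximal operator.\<close>

lemma quad_op_if_weak:
  assumes "\<And>k. coeff g k = braket (quadv (cnj q) (cnj p) (cnj v) (cnj u) (ket k)) f"
  shows "(f, g) \<in> quad_op p q u v"
  unfolding quad_op_iff
proof
  fix k
  define g' where "g' = quadv (cnj q) (cnj p) (cnj v) (cnj u) (ket k)"
  have "(\<lambda>n. quad p q u v (coeff (trunc n f)) k) \<longlonglongrightarrow> quad p q u v (coeff f) k"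
    by (intro quad_tendsto coeff_tendsto trunc_tendsto)
  moreover have "quad p q u v (coeff (trunc n f)) k = braket g' (trunc n f)" for n
    using braket_quadv_adjoint[OF finvec_ket[of k] quadv_in_quad_op[OF finvec_trunc[of n f]], of p q u v]
    by (simp add: braket_ket coeff_quadv finvec_trunc g'_def)
  moreover have "(\<lambda>n. braket g' (trunc n f)) \<longlonglongrightarrow> braket g' f"
    by (intro braket.tendsto trunc_tendsto tendsto_const)
  ultimately show "coeff g k = quad p q u v (coeff f) k"
    using LIMSEQ_unique assms[of k] by (simp add: g'_def)
qed

lemma annihilation_eq: "annihilation = quad_op 0 0 1 0"
  by (auto simp: annihilation_def quad_op_def quad_def lower_def)

text \<open>The adjoint lies in the maximal operator by the weak criterion; the converse is the
  adjoint relation extended from \<open>finvec\<close> by the core property.\<close>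

lemma creation_eq: "creation = quad_op 0 0 0 1"
proof -
  have 1: "(f, g) \<in> quad_op 0 0 0 1" if "(f, g) \<in> creation" for f g
  proof (rule quad_op_if_weak)
    fix k
    have "braket f (quadv 0 0 1 0 (ket k)) = braket g (ket k)"
      using that quadv_in_quad_op[OF finvec_ket[of k], of 0 0 1 0]
      by (auto simp: creation_def adjoint_op_def annihilation_eq)
    then show "coeff g k = braket (quadv (cnj 0) (cnj 0) (cnj 1) (cnj 0) (ket k)) f"
      unfolding braket_ket[symmetric] complex_cnj_zero complex_cnj_one by (metis braket_commute)
  qed
  have 2: "(f, g) \<in> creation" if "(f, g) \<in> quad_op 0 0 0 1" for f g
    unfolding creation_def adjoint_op_def annihilation_eq
    using braket_quad_op_adjoint[of f g 0 0 0 1] that by auto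
  show ?thesis using 1 2 by (intro equalityI subrelI)
qed

section \<open>The unitary group generated by a quadratic expression\<close>

lemma pochhammer_mono:
  fixes a b :: real
  assumes "0 \<le> a" "a \<le> b"
  shows "pochhammer a n \<le> pochhammer b n"
  unfolding pochhammer_prod using assms by (intro prod_mono) auto

text \<open>Replacing k/2 by k gives (k + n)! / k! = n! (k + n choose k), and the binomial
  coefficient is at most 2^(k + n).\<close>

lemma pochhammer_half_bound: "pochhammer (real k / 2 + 1) n \<le> 2 ^ (k + n) * fact n"
proof -
  have "fact (k + n) = (fact k :: real) * pochhammer (1 + real k) n"
    using pochhammer_product[of k "k + n" "1 :: real"] by (simp add: pochhammer_fact)
  moreover have "fact (k + n) \<le> (2 ^ (k + n) * fact n) * (fact k :: real)"
  proof -
    have "fact k * fact n * ((k + n) choose k) = fact (k + n)"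
      using binomial_fact_lemma[of k "k + n"] by simp
    then have "fact (k + n) \<le> fact k * fact n * (2 ^ (k + n) :: nat)"
      using binomial_le_pow2[of "k + n" k] by (metis mult_le_mono2)
    then have "real (fact (k + n)) \<le> real (fact k * fact n * 2 ^ (k + n))"
      by (simp only: of_nat_le_iff)
    then show ?thesis by (simp add: mult_ac)
  qed
  ultimately have "fact k * pochhammer (1 + real k) n \<le> fact k * (2 ^ (k + n) * fact n)"
    by (simp add: mult_ac)
  then have "pochhammer (1 + real k) n \<le> 2 ^ (k + n) * fact n"
    by (rule mult_left_le_imp_le) simp
  moreover have "pochhammer (real k / 2 + 1) n \<le> pochhammer (1 + real k) n"
    by (rule pochhammer_mono) auto
  ultimately show ?thesis by linarith
qed

text \<open>The truncated indices \<open>k - 1\<close> and \<open>k - 2\<close> are harmless, since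
  the weights in front of them vanish for small \<open>k\<close>.\<close>

lemma quadv_ket:
  "quadv p q u v (ket k) =
    (p * complex_of_real (sqrt (real k) * sqrt (real (k - 1)))) *\<^sub>C ket (k - 2)
    + (q * complex_of_real (sqrt (real (Suc k)) * sqrt (real (Suc (Suc k))))) *\<^sub>C ket (k + 2)
    + (u * complex_of_real (sqrt (real k))) *\<^sub>C ket (k - 1)
    + (v * complex_of_real (sqrt (real (Suc k)))) *\<^sub>C ket (k + 1)"
proof (rule fock_eqI)
  fix j
  have "lower (coeff (ket k)) j = complex_of_real (sqrt (real k)) * coeff (ket (k - 1)) j" for k j
    by (cases k) (auto simp: lower_def)
  then have l: "lower (coeff (ket k)) = (\<lambda>j. complex_of_real (sqrt (real k)) * coeff (ket (k - 1)) j)" for k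
    by blast
  have "raise (coeff (ket k)) j = complex_of_real (sqrt (real (Suc k))) * coeff (ket (Suc k)) j" for k j
    by (cases j) (auto simp: raise_def)
  then have r: "raise (coeff (ket k)) = (\<lambda>j. complex_of_real (sqrt (real (Suc k))) * coeff (ket (Suc k)) j)" for k
    by blast
  show "coeff (quadv p q u v (ket k)) j = coeff (
    (p * complex_of_real (sqrt (real k) * sqrt (real (k - 1)))) *\<^sub>C ket (k - 2)
    + (q * complex_of_real (sqrt (real (Suc k)) * sqrt (real (Suc (Suc k))))) *\<^sub>C ket (k + 2)
    + (u * complex_of_real (sqrt (real k))) *\<^sub>C ket (k - 1)
    + (v * complex_of_real (sqrt (real (Suc k)))) *\<^sub>C ket (k + 1)) j"
    unfolding coeff_quadv[OF finvec_ket] quad_def l r ladder_linear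
    by (simp add: numeral_2_eq_2 mult_ac del: coeff_ket of_nat_Suc)
qed

text \<open>The formal adjoint replaces (p, q, u, v) by (cnj q, cnj p, cnj v, cnj u); the two
  conditions say that it is the negative of the expression.\<close>

locale skew_quad =
  fixes p q u v :: complex
  assumes q_def: "q = - cnj p" and v_def: "v = - cnj u"
begin

abbreviation K :: "fock \<Rightarrow> fock" where "K \<equiv> quadv p q u v"

lemma K_skew:
  assumes "f \<in> finvec" "(g, h) \<in> quad_op p q u v"
  shows "braket f h = - braket (K f) g"
proof -
  have "quadv (cnj q) (cnj p) (cnj v) (cnj u) f = - K f"
    by (rule fock_eqI) (simp add: coeff_quadv assms quad_def q_def v_def)
  then show ?thesis using braket_quadv_adjoint[OF assms] by (simp add: braket.minus_left)
qed

lemma Kpow_finvec: "f \<in> finvec \<Longrightarrow> (K ^^ n) f \<in> finvec"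
  by (induction n) (auto intro: finvec_quadv)

lemma Kpow_add: "f \<in> finvec \<Longrightarrow> g \<in> finvec \<Longrightarrow> (K ^^ n) (f + g) = (K ^^ n) f + (K ^^ n) g"
  by (induction n) (auto simp: quadv_add Kpow_finvec)

lemma Kpow_scaleC: "f \<in> finvec \<Longrightarrow> (K ^^ n) (c *\<^sub>C f) = c *\<^sub>C (K ^^ n) f"
  by (induction n) (auto simp: quadv_scaleC Kpow_finvec)

lemma Kpow_0: "(K ^^ n) 0 = 0"
  by (induction n) (auto simp: quadv_0)

lemma Kpow_sum:
  "finite I \<Longrightarrow> (\<And>i. i \<in> I \<Longrightarrow> f i \<in> finvec) \<Longrightarrow> (K ^^ n) (sum f I) = (\<Sum>i\<in>I. (K ^^ n) (f i))"
  by (induction I rule: finite_induct) (auto simp: Kpow_0 Kpow_add finvec_sum)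

lemma Kpow_skew:
  "f \<in> finvec \<Longrightarrow> g \<in> finvec \<Longrightarrow> braket ((K ^^ j) g) ((K ^^ l) f) = (-1) ^ j * braket g ((K ^^ (j + l)) f)"
proof (induction j arbitrary: l)
  case (Suc j)
  have "braket ((K ^^ Suc j) g) ((K ^^ l) f) = - braket ((K ^^ j) g) ((K ^^ Suc l) f)"
    using K_skew[OF Kpow_finvec[OF Suc.prems(2)] quadv_in_quad_op[OF Kpow_finvec[OF Suc.prems(1)]], of j l]
    by simp
  then show ?case using Suc.IH[OF Suc.prems, of "Suc l"] by simp
qed simp

section \<open>Factorial bounds for the powers of the generator\<close>

definition C :: real where "C = cmod p + cmod q + cmod u + cmod v + 1"
text \<open>One factor 2 comes from the rate \<open>2 * C\<close> in
  \<open>Kpow_ket_pochhammer\<close>, the other from \<open>pochhammer_half_bound\<close>.\<close>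

definition R :: real where "R = 4 * C"
text \<open>Half of 1/R: the double series for \<open>braket (E s g) (E t f)\<close> requires that
  the sum of the two absolute times stay below 1/R.\<close>

definition \<tau> :: real where "\<tau> = 1 / (2 * R)"

lemma C_pos: "C > 0" and R_pos: "R > 0" and tau_pos: "\<tau> > 0"
proof -
  show "C > 0" unfolding C_def by (smt (verit) norm_ge_zero)
  then show "R > 0" by (simp add: R_def)
  then show "\<tau> > 0" by (simp add: \<tau>_def)
qed

text \<open>The innermost \<open>K\<close> sends \<open>ket k\<close> to kets of index at most k + 2
  with weights at most k + 2 = 2 (k/2 + 1). Raising k by 2 raises k/2 + 1 by one, which is the
  recursion of the Pochhammer symbol.\<close>

lemma Kpow_ket_pochhammer: "norm ((K ^^ n) (ket k)) \<le> (2 * C) ^ n * pochhammer (real k / 2 + 1) n"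
proof (induction n arbitrary: k)
  case (Suc n)
  define B where "B = (2 * C) ^ n * pochhammer (real (k + 2) / 2 + 1) n"
  have B: "norm ((K ^^ n) (ket j)) \<le> B" if "j \<le> k + 2" for j
  proof -
    have "pochhammer (real j / 2 + 1) n \<le> pochhammer (real (k + 2) / 2 + 1) n"
      using that by (intro pochhammer_mono) auto
    then have "(2 * C) ^ n * pochhammer (real j / 2 + 1) n \<le> B"
      unfolding B_def using C_pos by (intro mult_left_mono) auto
    then show ?thesis using Suc[of j] by linarith
  qed
  have "0 \<le> B" using B[of 0] norm_ge_zero order_trans by blast
  have tm: "norm ((c * complex_of_real w) *\<^sub>C (K ^^ n) (ket j)) \<le> cmod c * (real (k + 2) * B)"
    if "0 \<le> w" "w \<le> real (k + 2)" "j \<le> k + 2" for c w j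
  proof -
    have "w * norm ((K ^^ n) (ket j)) \<le> real (k + 2) * B"
      using that B[of j] by (intro mult_mono) auto
    then have "cmod c * (w * norm ((K ^^ n) (ket j))) \<le> cmod c * (real (k + 2) * B)"
      by (rule mult_left_mono) simp
    then show ?thesis using that(1) unfolding norm_scaleC norm_mult norm_of_real by (simp add: mult_ac)
  qed
  define a where "a = (p * complex_of_real (sqrt (real k) * sqrt (real (k - 1)))) *\<^sub>C (K ^^ n) (ket (k - 2))"
  define b where "b = (q * complex_of_real (sqrt (real (Suc k)) * sqrt (real (Suc (Suc k))))) *\<^sub>C (K ^^ n) (ket (k + 2))"
  define c where "c = (u * complex_of_real (sqrt (real k))) *\<^sub>C (K ^^ n) (ket (k - 1))"
  define d where "d = (v * complex_of_real (sqrt (real (Suc k)))) *\<^sub>C (K ^^ n) (ket (k + 1))"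
  have "(K ^^ Suc n) (ket k) = (K ^^ n) (K (ket k))"
    by (simp add: funpow_swap1)
  also have "\<dots> = a + b + c + d"
    unfolding quadv_ket a_def b_def c_def d_def
    by (simp only: Kpow_add Kpow_scaleC finvec_add finvec_scaleC finvec_ket)
  also have "norm \<dots> \<le> norm a + norm b + norm c + norm d"
    using norm_triangle_ineq[of a b] norm_triangle_ineq[of "a + b" c]
      norm_triangle_ineq[of "a + b + c" d] by linarith
  also have "\<dots> \<le> cmod p * (real (k + 2) * B) + cmod q * (real (k + 2) * B)
      + cmod u * (real (k + 2) * B) + cmod v * (real (k + 2) * B)"
    unfolding a_def b_def c_def d_def
    by (intro add_mono tm ladder_weights) auto
  also have "\<dots> \<le> C * (real (k + 2) * B)"
    using \<open>0 \<le> B\<close> by (simp add: C_def algebra_simps)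
  also have "\<dots> = (2 * C) ^ Suc n * pochhammer (real k / 2 + 1) (Suc n)"
    unfolding B_def pochhammer_rec by (simp add: field_simps)
  finally show ?case .
qed simp

lemma Kpow_ket_bound: "norm ((K ^^ n) (ket k)) \<le> 2 ^ k * R ^ n * fact n"
proof -
  have "norm ((K ^^ n) (ket k)) \<le> (2 * C) ^ n * (2 ^ (k + n) * fact n)"
    using C_pos by (intro order_trans[OF Kpow_ket_pochhammer] mult_left_mono pochhammer_half_bound) auto
  also have "\<dots> = 2 ^ k * ((2 * C) ^ n * 2 ^ n) * fact n"
    by (simp add: power_add)
  also have "(2 * C) ^ n * 2 ^ n = R ^ n"
    unfolding R_def power_mult_distrib[symmetric] by simp
  finally show ?thesis .
qed

lemma analytic_vector:
  assumes "f \<in> finvec"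
  obtains M where "M \<ge> 0" "\<And>n. norm ((K ^^ n) f) \<le> M * R ^ n * fact n"
proof -
  obtain m where m: "\<And>k. k \<ge> m \<Longrightarrow> coeff f k = 0" using finvecE[OF assms] by blast
  define M where "M = (\<Sum>k<m. cmod (coeff f k) * 2 ^ k)"
  have "norm ((K ^^ n) f) \<le> M * R ^ n * fact n" for n
  proof -
    have "trunc m f = f" by (rule trunc_eq[of m]) (auto simp: m)
    then have "(K ^^ n) f = (K ^^ n) (\<Sum>k<m. coeff f k *\<^sub>C ket k)" by (simp add: trunc_def)
    also have "\<dots> = (\<Sum>k<m. coeff f k *\<^sub>C (K ^^ n) (ket k))"
      by (simp add: Kpow_sum finvec_scaleC finvec_ket Kpow_scaleC)
    also have "norm \<dots> \<le> (\<Sum>k<m. cmod (coeff f k) * norm ((K ^^ n) (ket k)))"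
      by (rule order_trans[OF norm_sum]) (simp add: norm_scaleC)
    also have "\<dots> \<le> (\<Sum>k<m. cmod (coeff f k) * (2 ^ k * R ^ n * fact n))"
      by (intro sum_mono mult_left_mono Kpow_ket_bound) auto
    also have "\<dots> = M * R ^ n * fact n"
      unfolding M_def sum_distrib_right by (rule sum.cong) (simp_all add: mult_ac)
    finally show ?thesis .
  qed
  then show thesis using that[of M] by (auto simp: M_def sum_nonneg)
qed

section \<open>The exponential series on finitely supported vectors\<close>

definition E :: "real \<Rightarrow> fock \<Rightarrow> fock" where
  "E t f = (\<Sum>n. (t ^ n / fact n) *\<^sub>R (K ^^ n) f)"

lemma E_term_bound:
  assumes "\<And>n. norm ((K ^^ n) f) \<le> M * R ^ n * fact n"
  shows "norm ((t ^ n / fact n) *\<^sub>R (K ^^ n) f) \<le> M * (\<bar>t\<bar> * R) ^ n"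
proof -
  have "norm ((t ^ n / fact n) *\<^sub>R (K ^^ n) f) \<le> \<bar>t\<bar> ^ n / fact n * (M * R ^ n * fact n)"
    unfolding norm_scaleR using assms[of n]
    by (intro mult_mono) (auto simp: power_abs)
  also have "\<dots> = M * (\<bar>t\<bar> * R) ^ n" by (simp add: power_mult_distrib)
  finally show ?thesis .
qed

lemma E_summable:
  assumes "f \<in> finvec" "\<bar>t\<bar> * R < 1"
  shows "summable (\<lambda>n. norm ((t ^ n / fact n) *\<^sub>R (K ^^ n) f))"
proof -
  obtain M where "M \<ge> 0" and M: "\<And>n. norm ((K ^^ n) f) \<le> M * R ^ n * fact n"
    using analytic_vector[OF assms(1)] by blast
  show ?thesis
  proof (rule summable_comparison_test')
    show "summable (\<lambda>n. M * (\<bar>t\<bar> * R) ^ n)"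
      using assms(2) R_pos by (intro summable_mult summable_geometric) (simp add: abs_mult)
    show "norm (norm ((t ^ n / fact n) *\<^sub>R (K ^^ n) f)) \<le> M * (\<bar>t\<bar> * R) ^ n" for n
      using E_term_bound[OF M, of t n] by simp
  qed
qed

lemma E_sums:
  assumes "f \<in> finvec" "\<bar>t\<bar> * R < 1"
  shows "(\<lambda>n. (t ^ n / fact n) *\<^sub>R (K ^^ n) f) sums E t f"
  unfolding E_def by (rule summable_sums[OF summable_norm_cancel[OF E_summable[OF assms]]])

lemma E_has_sum:
  assumes "f \<in> finvec" "\<bar>t\<bar> * R < 1"
  shows "((\<lambda>n. (t ^ n / fact n) *\<^sub>R (K ^^ n) f) has_sum E t f) UNIV"
  by (rule norm_summable_imp_has_sum[OF E_summable[OF assms] E_sums[OF assms]])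

lemma E_0: "E 0 f = f"
proof -
  have "(\<lambda>n. (0 ^ n / fact n) *\<^sub>R (K ^^ n) f) = (\<lambda>n. if n = 0 then f else 0)"
    by (auto simp: fun_eq_iff)
  then show ?thesis
    unfolding E_def using sums_unique[OF sums_single[of 0 "\<lambda>_. f"]] by simp
qed

lemma E_add:
  assumes "f \<in> finvec" "g \<in> finvec" "\<bar>t\<bar> * R < 1"
  shows "E t (f + g) = E t f + E t g"
  using sums_add[OF E_sums[OF assms(1,3)] E_sums[OF assms(2,3)]]
  by (simp add: Kpow_add assms E_def sums_iff scaleR_add_right)

lemma E_scaleC:
  assumes "f \<in> finvec" "\<bar>t\<bar> * R < 1"
  shows "E t (c *\<^sub>C f) = c *\<^sub>C E t f"
  using bounded_linear.sums[OF scaleC.bounded_linear_right E_sums[OF assms], of c]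
  by (simp add: Kpow_scaleC assms E_def sums_iff scaleC.scaleR_right)

end

context skew_quad begin

text \<open>
  Since \<open>K\<close> is skew, \<open>\<langle>K\<^sup>j g, K\<^sup>l f\<rangle>\<close> depends, up to sign, on \<open>j + l\<close> only, so summing the double
  series along the diagonals \<open>j + l = n\<close> yields the series for \<open>t - s\<close>.
\<close>

lemma braket_E:
  assumes f: "f \<in> finvec" and g: "g \<in> finvec" and st: "(\<bar>s\<bar> + \<bar>t\<bar>) * R < 1"
  shows "braket (E s g) (E t f) = braket g (E (t - s) f)"
proof -
  have "\<bar>s\<bar> * R \<le> (\<bar>s\<bar> + \<bar>t\<bar>) * R" "\<bar>t\<bar> * R \<le> (\<bar>s\<bar> + \<bar>t\<bar>) * R" "\<bar>t - s\<bar> * R \<le> (\<bar>s\<bar> + \<bar>t\<bar>) * R"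
    using R_pos by (intro mult_right_mono; simp)+
  then have s1: "\<bar>s\<bar> * R < 1" and t1: "\<bar>t\<bar> * R < 1" and ts1: "\<bar>t - s\<bar> * R < 1"
    using st by linarith+
  obtain M where "M \<ge> 0" and M: "\<And>n. norm ((K ^^ n) f) \<le> M * R ^ n * fact n"
    using analytic_vector[OF f] by blast
  define c where "c n = braket g ((K ^^ n) f)" for n
  define F where "F = (\<lambda>(j, l). complex_of_real ((- s) ^ j * t ^ l / (fact j * fact l)) * c (j + l))"
  define H where "H = (\<lambda>(n, j). F (j, n - j))"
  define D where "D = Sigma (UNIV :: nat set) (\<lambda>n. {..n})"
  have F: "braket ((s ^ j / fact j) *\<^sub>R (K ^^ j) g) ((t ^ l / fact l) *\<^sub>R (K ^^ l) f) = F (j, l)" for j l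
    by (simp add: braket.scaleR_left braket.scaleR_right Kpow_skew f g F_def c_def scaleR_conv_of_real
        power_minus[of s] mult_ac)
  \<comment> \<open>Since 1 / (j! (n - j)!) is the binomial coefficient over n!, each diagonal is
    dominated by a binomial expansion.\<close>
  have Fn: "cmod (F (j, n - j)) \<le> cmod (c n) / fact n * (of_nat (n choose j) * \<bar>s\<bar> ^ j * \<bar>t\<bar> ^ (n - j))"
    if "j \<le> n" for n j
    using that by (simp add: F_def norm_mult norm_divide norm_power binomial_fact field_simps)
  have cb: "cmod (c n) / fact n \<le> norm g * M * R ^ n" for n
  proof -
    have "cmod (c n) \<le> norm g * (M * R ^ n * fact n)"
      unfolding c_def by (rule order_trans[OF braket_le_norm]) (intro mult_left_mono M norm_ge_zero)
    then show ?thesis by (simp add: divide_le_eq mult_ac)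
  qed
  have row: "(\<Sum>j\<le>n. cmod (H (n, j))) \<le> norm g * M * ((\<bar>s\<bar> + \<bar>t\<bar>) * R) ^ n" for n
  proof -
    have "(\<Sum>j\<le>n. cmod (H (n, j)))
        \<le> (\<Sum>j\<le>n. cmod (c n) / fact n * (of_nat (n choose j) * \<bar>s\<bar> ^ j * \<bar>t\<bar> ^ (n - j)))"
      unfolding H_def prod.case by (intro sum_mono Fn) simp
    also have "\<dots> = cmod (c n) / fact n * (\<bar>s\<bar> + \<bar>t\<bar>) ^ n"
      unfolding sum_distrib_left[symmetric] binomial_ring ..
    also have "\<dots> \<le> norm g * M * R ^ n * (\<bar>s\<bar> + \<bar>t\<bar>) ^ n"
      by (intro mult_right_mono cb) simp
    finally show ?thesis by (simp add: power_mult_distrib mult_ac)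
  qed
  have "H summable_on D"
  proof (rule Infinite_Sum.abs_summable_summable, unfold D_def,
      rule Infinite_Sum.abs_summable_on_Sigma_iff[THEN iffD2], intro conjI ballI)
    show "(\<lambda>j. norm (H (n, j))) summable_on {..n}" for n by simp
    have "(\<lambda>n. norm g * M * ((\<bar>s\<bar> + \<bar>t\<bar>) * R) ^ n) summable_on UNIV"
      using st R_pos \<open>M \<ge> 0\<close>
      by (subst summable_on_UNIV_nonneg_real_iff) (auto intro!: summable_mult summable_geometric)
    then show "(\<lambda>n. norm (\<Sum>\<^sub>\<infinity>j\<in>{..n}. norm (H (n, j)))) summable_on UNIV"
      by (rule summable_on_comparison_test) (use row in \<open>auto simp: sum_nonneg\<close>)
  qed
  then obtain S where S: "(H has_sum S) D" by (auto simp: summable_on_def)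
  have "((\<lambda>n. c n * complex_of_real ((t - s) ^ n / fact n)) has_sum S) UNIV"
  proof (rule has_sum_SigmaD[OF S[unfolded D_def]])
    fix n :: nat
    have "(\<Sum>j\<le>n. H (n, j)) = (\<Sum>j\<le>n. c n * complex_of_real (of_nat (n choose j) * (- s) ^ j * t ^ (n - j) / fact n))"
      by (rule sum.cong) (simp_all add: H_def F_def binomial_fact)
    also have "\<dots> = c n * complex_of_real ((t - s) ^ n / fact n)"
      using binomial_ring[of "- s" t n]
      by (simp add: sum_distrib_left[symmetric] sum_divide_distrib[symmetric])
    finally show "((\<lambda>j. H (n, j)) has_sum c n * complex_of_real ((t - s) ^ n / fact n)) {..n}"
      by (simp add: has_sum_finiteI)
  qed
  moreover have "((\<lambda>n. c n * complex_of_real ((t - s) ^ n / fact n)) has_sum braket g (E (t - s) f)) UNIV"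
    using has_sum_bounded_linear[OF braket.bounded_linear_right E_has_sum[OF f ts1], of g]
    by (simp add: o_def braket.scaleR_right scaleR_conv_of_real c_def mult.commute)
  ultimately have S1: "S = braket g (E (t - s) f)" by (rule has_sum_unique)
  have "(F has_sum S) (UNIV \<times> UNIV)"
    by (rule has_sum_reindex_bij_witness[THEN iffD1, OF _ _ _ _ _ refl S, 
          of "\<lambda>(j, l). (j + l, j)" "\<lambda>(n, j). (j, n - j)"])
      (auto simp: D_def H_def)
  then have "((\<lambda>j. braket ((s ^ j / fact j) *\<^sub>R (K ^^ j) g) (E t f)) has_sum S) UNIV"
  proof (rule has_sum_SigmaD)
    fix j :: nat
    show "((\<lambda>l. F (j, l)) has_sum braket ((s ^ j / fact j) *\<^sub>R (K ^^ j) g) (E t f)) UNIV"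
      using has_sum_bounded_linear[OF braket.bounded_linear_right E_has_sum[OF f t1],
          of "(s ^ j / fact j) *\<^sub>R (K ^^ j) g"]
      by (simp add: o_def F)
  qed
  moreover have "((\<lambda>j. braket ((s ^ j / fact j) *\<^sub>R (K ^^ j) g) (E t f)) has_sum braket (E s g) (E t f)) UNIV"
    using has_sum_bounded_linear[OF braket.bounded_linear_left E_has_sum[OF g s1], of "E t f"]
    by (simp add: o_def)
  ultimately have "S = braket (E s g) (E t f)" by (rule has_sum_unique)
  then show ?thesis using S1 by simp
qed

section \<open>Extension by continuity to a local unitary group\<close>

lemma tau_bound: "\<bar>s\<bar> < \<tau> \<Longrightarrow> \<bar>t\<bar> < \<tau> \<Longrightarrow> (\<bar>s\<bar> + \<bar>t\<bar>) * R < 1"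
  and tau_R: "\<bar>t\<bar> < \<tau> \<Longrightarrow> \<bar>t\<bar> * R < 1"
proof -
  show 1: "(\<bar>s\<bar> + \<bar>t\<bar>) * R < 1" if "\<bar>s\<bar> < \<tau>" "\<bar>t\<bar> < \<tau>" for s t
  proof -
    have "(\<bar>s\<bar> + \<bar>t\<bar>) * R < (\<tau> + \<tau>) * R"
      using that R_pos by (intro mult_strict_right_mono) auto
    then show ?thesis using R_pos by (simp add: \<tau>_def)
  qed
  show "\<bar>t\<bar> * R < 1" if "\<bar>t\<bar> < \<tau>" using 1[of 0 t] that tau_pos by simp
qed

lemma norm_E:
  assumes "f \<in> finvec" "\<bar>t\<bar> < \<tau>"
  shows "norm (E t f) = norm f"
proof -
  have "complex_of_real ((norm (E t f))\<^sup>2) = complex_of_real ((norm f)\<^sup>2)"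
    unfolding braket_self_norm[symmetric]
    using braket_E[OF assms(1,1) tau_bound[OF assms(2,2)]] by (simp add: E_0)
  then have "(norm (E t f))\<^sup>2 = (norm f)\<^sup>2" using of_real_eq_iff by blast
  then show ?thesis by (simp add: power2_eq_iff_nonneg)
qed

text \<open>For small \<open>t\<close> the map \<open>E t\<close> is linear and isometric on
  \<open>finvec\<close>, so the images of the truncations are Cauchy and this limit extends
  \<open>E t\<close>. Outside that range its existence is not claimed.\<close>

definition V :: "real \<Rightarrow> fock \<Rightarrow> fock" where
  "V t f = lim (\<lambda>n. E t (trunc n f))"

lemma E_diff:
  assumes "f \<in> finvec" "g \<in> finvec" "\<bar>t\<bar> * R < 1"
  shows "E t (f - g) = E t f - E t g"
  using E_add[OF finvec_diff[OF assms(1,2)] assms(2,3)] by (simp add: algebra_simps)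

lemma V_tendsto:
  assumes t: "\<bar>t\<bar> < \<tau>"
  shows "(\<lambda>n. E t (trunc n f)) \<longlonglongrightarrow> V t f"
proof -
  have d: "dist (E t (trunc m f)) (E t (trunc n f)) = dist (trunc m f) (trunc n f)" for m n
    unfolding dist_norm E_diff[OF finvec_trunc finvec_trunc tau_R[OF t], symmetric]
    by (rule norm_E[OF finvec_diff[OF finvec_trunc finvec_trunc] t])
  have "Cauchy (\<lambda>n. trunc n f)" by (rule LIMSEQ_imp_Cauchy[OF trunc_tendsto])
  then have "Cauchy (\<lambda>n. E t (trunc n f))" unfolding Cauchy_def d .
  then show ?thesis unfolding V_def by (simp add: Cauchy_convergent_iff convergent_LIMSEQ_iff)
qed

lemma V_E:
  assumes "f \<in> finvec" "\<bar>t\<bar> < \<tau>"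
  shows "V t f = E t f"
proof -
  obtain m where m: "\<And>k. k \<ge> m \<Longrightarrow> coeff f k = 0" using finvecE[OF assms(1)] by blast
  have "(\<lambda>n. E t (trunc n f)) \<longlonglongrightarrow> E t f"
  proof (rule tendsto_eventually, rule eventually_sequentiallyI)
    show "E t (trunc n f) = E t f" if "n \<ge> m" for n
      using that m by (simp add: trunc_eq[of m])
  qed
  then show ?thesis using V_tendsto[OF assms(2)] LIMSEQ_unique by blast
qed

lemma V_add:
  assumes t: "\<bar>t\<bar> < \<tau>"
  shows "V t (f + g) = V t f + V t g"
proof -
  have "trunc n (f + g) = trunc n f + trunc n g" for n
    by (rule fock_eqI) (simp add: coeff_trunc)
  then have "(\<lambda>n. E t (trunc n f) + E t (trunc n g)) \<longlonglongrightarrow> V t (f + g)"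
    using V_tendsto[OF t, of "f + g"] by (simp add: E_add finvec_trunc tau_R[OF t])
  then show ?thesis using tendsto_add[OF V_tendsto[OF t] V_tendsto[OF t]] LIMSEQ_unique by blast
qed

lemma V_scaleC:
  assumes t: "\<bar>t\<bar> < \<tau>"
  shows "V t (c *\<^sub>C f) = c *\<^sub>C V t f"
proof -
  have "trunc n (c *\<^sub>C f) = c *\<^sub>C trunc n f" for n
    by (rule fock_eqI) (simp add: coeff_trunc)
  then have "(\<lambda>n. c *\<^sub>C E t (trunc n f)) \<longlonglongrightarrow> V t (c *\<^sub>C f)"
    using V_tendsto[OF t, of "c *\<^sub>C f"] by (simp add: E_scaleC finvec_trunc tau_R[OF t])
  moreover have "(\<lambda>n. c *\<^sub>C E t (trunc n f)) \<longlonglongrightarrow> c *\<^sub>C V t f"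
    by (intro scaleC.tendsto tendsto_const V_tendsto t)
  ultimately show ?thesis using LIMSEQ_unique by blast
qed

lemma braket_V:
  assumes "\<bar>s\<bar> < \<tau>" "\<bar>t\<bar> < \<tau>" "\<bar>t - s\<bar> < \<tau>"
  shows "braket (V s g) (V t f) = braket g (V (t - s) f)"
proof -
  have "(\<lambda>n. braket (E s (trunc n g)) (E t (trunc n f))) \<longlonglongrightarrow> braket (V s g) (V t f)"
    by (intro braket.tendsto V_tendsto assms)
  moreover have "(\<lambda>n. braket (trunc n g) (E (t - s) (trunc n f))) \<longlonglongrightarrow> braket g (V (t - s) f)"
    by (intro braket.tendsto V_tendsto trunc_tendsto assms)
  ultimately show ?thesis
    by (simp add: braket_E finvec_trunc tau_bound assms LIMSEQ_unique)
qed

lemma V_0: "V 0 = id"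
proof
  show "V 0 f = id f" for f
    using V_tendsto[of 0 f] trunc_tendsto[of f] tau_pos LIMSEQ_unique by (simp add: E_0)
qed

lemma braket_V_same: "\<bar>t\<bar> < \<tau> \<Longrightarrow> braket (V t g) (V t f) = braket g f"
  using braket_V[of t t g f] tau_pos by (simp add: V_0)

text \<open>The vector \<open>E t f\<close> need not be finitely supported, so the two series cannot
  simply be composed. Instead both sides have the norm of \<open>f\<close>, and by
  \<open>braket_V\<close> their inner product is the square of that norm; hence their distance is
  0.\<close>

lemma V_plus:
  assumes "\<bar>s\<bar> < \<tau>" "\<bar>t\<bar> < \<tau>" "\<bar>s + t\<bar> < \<tau>"
  shows "V (s + t) f = V s (V t f)"
proof -
  define x where "x = V (s + t) f"
  define y where "y = V s (V t f)"
  have yx: "braket y x = braket f f"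
    unfolding x_def y_def using braket_V[of s "s + t" "V t f" f] assms by (simp add: braket_V_same)
  then have "braket x y = braket f f"
    by (metis braket_commute)
  moreover have "braket x x = braket f f" "braket y y = braket f f"
    unfolding x_def y_def using assms by (simp_all add: braket_V_same)
  ultimately have "braket (x - y) (x - y) = 0"
    using yx by (simp add: braket.diff_left braket.diff_right)
  then show ?thesis by (simp add: braket_self_norm x_def y_def)
qed

lemma V_unitary:
  assumes t: "\<bar>t\<bar> < \<tau>"
  shows "unitary_map (V t)"
  unfolding unitary_map_def
proof (intro conjI allI)
  have "V t (V (- t) f) = f" for f
    using V_plus[of t "- t" f] t tau_pos by (simp add: V_0)
  then show "surj (V t)" by (metis surjI)
qed (simp_all add: V_add V_scaleC braket_V_same t)

end

section \<open>Unitary groups and their generators\<close>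

lemma unitary_map_norm: "unitary_map U \<Longrightarrow> norm (U f) = norm f"
  using braket_self_norm[of "U f"] braket_self_norm[of f]
  by (metis norm_ge_zero of_real_eq_iff power2_eq_iff_nonneg unitary_map_def)

lemma unitary_map_bounded_linear: "unitary_map U \<Longrightarrow> bounded_linear U"
  by (rule bounded_linear_intro[of _ 1])
    (auto simp: unitary_map_norm unitary_map_def scaleR_scaleC)

lemma unitary_map_diff: "unitary_map U \<Longrightarrow> U (f - g) = U f - U g"
  by (rule linear_diff[OF bounded_linear.linear[OF unitary_map_bounded_linear]])

lemma unitary_map_comp:
  assumes "unitary_map U" "unitary_map U'"
  shows "unitary_map (U \<circ> U')"
proof -
  have "surj (U \<circ> U')" using assms by (intro comp_surj) (auto simp: unitary_map_def)
  then show ?thesis using assms by (simp add: unitary_map_def comp_def)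
qed

lemma unitary_map_funpow: "unitary_map U \<Longrightarrow> unitary_map (U ^^ n)"
proof (induction n)
  case 0
  then show ?case by (simp add: unitary_map_def)
next
  case (Suc n)
  then show ?case using unitary_map_comp[of U "U ^^ n"] by (simp add: comp_def)
qed

lemma generator_shift:
  assumes V: "\<And>t. unitary_map (V t)" "\<And>s t. V (s + t) = V s \<circ> V t"
    and d: "((\<lambda>t. V t f) has_vector_derivative g) (at 0)"
  shows "((\<lambda>t. V t f) has_vector_derivative V s g) (at s)"
proof -
  have "((\<lambda>t. V s (V t f)) has_vector_derivative V s g) (at 0)"
    by (rule bounded_linear.has_vector_derivative[OF unitary_map_bounded_linear[OF V(1)] d])
  then have "((\<lambda>t. V s (V t f)) has_vector_derivative V s g) (at (s - s))" by simp
  moreover have "((\<lambda>t. t - s) has_vector_derivative 1) (at s)"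
    by (auto intro!: derivative_eq_intros)
  ultimately have "((\<lambda>t. V s (V t f)) \<circ> (\<lambda>t. t - s) has_vector_derivative 1 *\<^sub>R V s g) (at s)"
    by (intro vector_diff_chain_at)
  moreover have "(\<lambda>t. V s (V t f)) \<circ> (\<lambda>t. t - s) = (\<lambda>t. V t f)"
    using V(2)[of s] by (auto simp: fun_eq_iff o_def) (metis add.commute diff_add_cancel)
  ultimately show ?thesis by simp
qed

text \<open>The difference of two orbits of a domain vector stays in the domain and is
  differentiable. Its derivative is orthogonal to it in the real inner product because the generator
  is skew, so its norm remains 0; density does the rest. This resolves the description in
  \<open>exp_skewadjoint\<close>.\<close>

lemma unitary_group_unique:
  assumes V: "unitary_group V" and V': "unitary_group V'"
    and gen: "generator V = generator V'"
    and dense: "closure (Domain (generator V)) = UNIV"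
  shows "V = V'"
proof -
  have U: "\<And>t. unitary_map (V t)" "\<And>s t. V (s + t) = V s \<circ> V t" "V 0 = id"
    and U': "\<And>t. unitary_map (V' t)" "\<And>s t. V' (s + t) = V' s \<circ> V' t" "V' 0 = id"
    using V V' by (auto simp: unitary_group_def)
  have skew: "inner f g = 0" if "(f, g) \<in> generator V" for f g
  proof -
    have d: "((\<lambda>t. V t f) has_vector_derivative g) (at 0)" using that by (simp add: generator_def)
    have "((\<lambda>t. inner (V t f) (V t f)) has_vector_derivative (inner (V 0 f) g + inner g (V 0 f))) (at 0)"
      by (rule bounded_bilinear.has_vector_derivative[OF bounded_bilinear_inner d d])
    moreover have "inner (V t f) (V t f) = inner f f" for t
      using unitary_map_norm[OF U(1)] by (simp add: power2_norm_eq_inner[symmetric])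
    ultimately have "((\<lambda>t. inner f f) has_vector_derivative (inner f g + inner g f)) (at (0::real))"
      by (simp add: U(3))
    then show ?thesis
      using vector_derivative_unique_at[OF _ has_vector_derivative_const] by (force simp: inner_commute)
  qed
  have inv: "(V t f, V t g) \<in> generator V" if "(f, g) \<in> generator V"
      and "unitary_group V" for V t f g
  proof -
    have *: "((\<lambda>s. V s f) has_vector_derivative g) (at 0)" "unitary_map (V t)"
        "\<And>s. V s (V t f) = V t (V s f)"
      using that by (auto simp: generator_def unitary_group_def) (metis add.commute comp_apply)
    show ?thesis
      unfolding generator_def using bounded_linear.has_vector_derivative[OF unitary_map_bounded_linear[OF *(2)] *(1)]
      by (simp add: *(3))
  qed
  have agree: "V t f = V' t f" if "f \<in> Domain (generator V)" for t f
  proof -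
    from that obtain g where g: "(f, g) \<in> generator V" by blast
    define h where "h s = V s f - V' s f" for s
    define h' where "h' s = V s g - V' s g" for s
    have d: "((\<lambda>s. V s f) has_vector_derivative V s g) (at s)"
        "((\<lambda>s. V' s f) has_vector_derivative V' s g) (at s)" for s
      using g gen by (auto intro!: generator_shift U U' simp: generator_def)
    have dh: "(h has_vector_derivative h' s) (at s)" for s
      unfolding h_def[abs_def] h'_def by (intro derivative_intros d)
    have "inner (h s) (h' s) = 0" for s
    proof (rule skew)
      have "(V s f, V s g) \<in> generator V" "(V' s f, V' s g) \<in> generator V"
        using inv[OF g V] inv[of f g V'] g V' gen by auto
      then show "(h s, h' s) \<in> generator V"
        unfolding generator_def h_def h'_def
        using unitary_map_diff[OF U(1)]
        by (auto intro!: derivative_eq_intros)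
    qed
    then have "((\<lambda>s. inner (h s) (h s)) has_vector_derivative 0) (at s)" for s
      using bounded_bilinear.has_vector_derivative[OF bounded_bilinear_inner dh dh, of s]
      by (simp add: inner_commute)
    then have "((\<lambda>s. inner (h s) (h s)) has_real_derivative 0) (at s)" for s
      by (simp add: has_real_derivative_iff_has_vector_derivative)
    then have "inner (h t) (h t) = inner (h 0) (h 0)"
      by (intro DERIV_isconst_all) auto
    then show ?thesis by (simp add: h_def U(3) U'(3))
  qed
  show ?thesis
  proof (intro ext)
    fix t f
    have "closed {x. V t x = V' t x}"
      by (intro closed_Collect_eq linear_continuous_on unitary_map_bounded_linear U U')
    moreover have "Domain (generator V) \<subseteq> {x. V t x = V' t x}" using agree by blast
    ultimately show "V t f = V' t f"
      using dense closure_minimal[of "Domain (generator V)" "{x. V t x = V' t x}"] by auto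
  qed
qed

lemma exp_skewadjoint_eq:
  assumes "unitary_group V" "generator V = T" "closure (Domain T) = UNIV"
  shows "exp_skewadjoint T = graph (V 1)"
  unfolding exp_skewadjoint_def
proof (rule the_equality)
  fix U assume "\<exists>V'. unitary_group V' \<and> generator V' = T \<and> U = graph (V' 1)"
  then obtain V' where V': "unitary_group V'" "generator V' = T" "U = graph (V' 1)" by blast
  have "V = V'" using assms V' by (intro unitary_group_unique) auto
  then show "U = graph (V 1)" using V' by simp
qed (use assms in blast)

subsection \<open>From the local to the global group\<close>

lemma funpow_comp_commute:
  assumes "f \<circ> g = g \<circ> f"
  shows "(f \<circ> g) ^^ n = (f ^^ n) \<circ> (g ^^ n)"
proof (induction n)
  case (Suc n)
  have c: "f (g x) = g (f x)" for x using assms by (metis comp_apply)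
  have "(f ^^ n) (g x) = g ((f ^^ n) x)" for x by (induction n) (simp_all add: c)
  then show ?case using Suc by (auto simp: fun_eq_iff)
qed simp

context skew_quad begin

lemma V_funpow:
  "\<bar>real m * s\<bar> < \<tau> \<Longrightarrow> V (real m * s) = V s ^^ m"
proof (induction m)
  case 0
  then show ?case by (simp add: V_0)
next
  case (Suc m)
  have "\<bar>real m * s\<bar> \<le> \<bar>real (Suc m) * s\<bar>" "\<bar>s\<bar> \<le> \<bar>real (Suc m) * s\<bar>"
    by (simp_all add: abs_mult mult_right_mono mult_le_cancel_right1)
  then have *: "\<bar>real m * s\<bar> < \<tau>" "\<bar>s\<bar> < \<tau>" using Suc.prems by linarith+
  have "real (Suc m) * s = s + real m * s" by (simp add: algebra_simps)
  then show ?case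
    using V_plus[OF *(2,1)] Suc.prems Suc.IH[OF *(1)] by (simp add: fun_eq_iff)
qed

text \<open>Both subdivisions are compared with the common refinement into \<open>m * n\<close>
  steps.\<close>

lemma V_funpow_eq:
  assumes "\<bar>t\<bar> < real m * \<tau>" "\<bar>t\<bar> < real n * \<tau>"
  shows "V (t / real m) ^^ m = V (t / real n) ^^ n"
proof -
  have *: "V (t / real m) ^^ m = V (t / (real m * real n)) ^^ (n * m)"
    if "\<bar>t\<bar> < real m * \<tau>" "n > 0" for m n
  proof -
    have "m > 0" using that(1) by (cases m) auto
    have eq: "real n * (t / (real m * real n)) = t / real m" using that(2) by simp
    have "\<bar>t / real m\<bar> < \<tau>" using that(1) \<open>m > 0\<close> by (simp add: abs_divide divide_less_eq mult.commute)
    then have "V (t / real m) = V (t / (real m * real n)) ^^ n"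
      using V_funpow[of n "t / (real m * real n)"] eq by simp
    then show ?thesis by (simp add: funpow_mult)
  qed
  have "m > 0" "n > 0" using assms by (cases m; cases n; simp)+
  then show ?thesis
    using *[OF assms(1), of n] *[OF assms(2), of m] by (simp add: mult.commute)
qed

text \<open>\<open>LEAST\<close> merely selects one admissible number of short steps; by
  \<open>W_eq\<close> every other one gives the same map.\<close>

definition W :: "real \<Rightarrow> fock \<Rightarrow> fock" where
  "W t = (let m = (LEAST m. \<bar>t\<bar> < real m * \<tau>) in V (t / real m) ^^ m)"

lemma W_eq:
  assumes "\<bar>t\<bar> < real m * \<tau>"
  shows "W t = V (t / real m) ^^ m"
  unfolding W_def Let_def by (rule V_funpow_eq[OF LeastI[of "\<lambda>m. \<bar>t\<bar> < real m * \<tau>", OF assms] assms])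

lemma ex_step: "\<exists>m>0. \<bar>t\<bar> < real m * \<tau>"
proof -
  obtain m where "\<bar>t\<bar> / \<tau> < real m" using reals_Archimedean2 by blast
  then have "\<bar>t\<bar> < real m * \<tau>" using tau_pos by (simp add: divide_less_eq)
  moreover then have "m > 0" by (cases m) auto
  ultimately show ?thesis by blast
qed

lemma W_V: "\<bar>t\<bar> < \<tau> \<Longrightarrow> W t = V t"
  using W_eq[of t 1] by simp

lemma step_small: "\<bar>t\<bar> < real m * \<tau> \<Longrightarrow> \<bar>t / real m\<bar> < \<tau>"
  by (cases m) (simp_all add: abs_divide divide_less_eq mult.commute)

lemma W_unitary: "unitary_map (W t)"
proof -
  obtain m where m: "m > 0" "\<bar>t\<bar> < real m * \<tau>" using ex_step by blast
  then show ?thesis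
    using unitary_map_funpow[OF V_unitary[OF step_small[OF m(2)]]] by (simp add: W_eq[OF m(2)])
qed

lemma W_0: "W 0 = id"
  using W_V[of 0] tau_pos V_0 by simp

text \<open>One number of steps is chosen that serves s, t and s + t; the short-time maps commute,
  so powers of their composition split.\<close>

lemma W_add: "W (s + t) = W s \<circ> W t"
proof -
  obtain m where m: "m > 0" "\<bar>\<bar>s\<bar> + \<bar>t\<bar>\<bar> < real m * \<tau>" using ex_step by blast
  then have b: "\<bar>s\<bar> < real m * \<tau>" "\<bar>t\<bar> < real m * \<tau>" "\<bar>s + t\<bar> < real m * \<tau>" "\<bar>t + s\<bar> < real m * \<tau>"
    by linarith+
  have "V (s / real m) \<circ> V (t / real m) = V ((s + t) / real m)"
    using V_plus[OF b(1,2)[THEN step_small]] step_small[OF b(3)] by (auto simp: add_divide_distrib)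
  moreover have "V (t / real m) \<circ> V (s / real m) = V ((s + t) / real m)"
    using V_plus[OF b(2,1)[THEN step_small]] step_small[OF b(4)] by (auto simp: add_divide_distrib add.commute)
  ultimately show ?thesis
    by (metis W_eq b(1,2,3) funpow_comp_commute)
qed

section \<open>Strong continuity and the generator of the global group\<close>

lemma E_second_order:
  assumes "f \<in> finvec"
  obtains B where "B \<ge> 0" "\<And>t. \<bar>t\<bar> < \<tau> \<Longrightarrow> norm (E t f - f - t *\<^sub>R K f) \<le> B * t\<^sup>2"
proof -
  obtain M where "M \<ge> 0" and M: "\<And>n. norm ((K ^^ n) f) \<le> M * R ^ n * fact n"
    using analytic_vector[OF assms] by blast
  have "norm (E t f - f - t *\<^sub>R K f) \<le> 2 * M * R\<^sup>2 * t\<^sup>2" if t: "\<bar>t\<bar> < \<tau>" for t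
  proof -
    \<comment> \<open>The tail from the quadratic term on is geometric with ratio below 1/2, which
      accounts for the factor 2 in the bound.\<close>
    have h: "\<bar>t\<bar> * R < 1 / 2"
      using t R_pos by (simp add: \<tau>_def field_simps)
    let ?a = "\<lambda>n. (t ^ n / fact n) *\<^sub>R (K ^^ n) f"
    have s: "(\<lambda>n. ?a (n + 2)) sums (E t f - f - t *\<^sub>R K f)"
      using sums_split_initial_segment[OF E_sums[OF assms tau_R[OF t]], of 2]
      by (simp add: numeral_2_eq_2 algebra_simps)
    have g: "(\<lambda>n. M * (\<bar>t\<bar> * R) ^ (n + 2)) sums (M * (\<bar>t\<bar> * R)\<^sup>2 * (1 / (1 - \<bar>t\<bar> * R)))"
      using sums_mult[OF geometric_sums[of "\<bar>t\<bar> * R"], of "M * (\<bar>t\<bar> * R)\<^sup>2"] h R_pos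
      by (simp add: abs_mult power2_eq_square mult_ac)
    have "norm (E t f - f - t *\<^sub>R K f) \<le> M * (\<bar>t\<bar> * R)\<^sup>2 * (1 / (1 - \<bar>t\<bar> * R))"
      unfolding sums_unique[OF s] sums_unique[OF g]
      by (rule norm_suminf_le[OF E_term_bound[OF M] sums_summable[OF g]])
    also have "\<dots> \<le> M * (\<bar>t\<bar> * R)\<^sup>2 * 2"
      using h \<open>M \<ge> 0\<close> by (intro mult_left_mono) (auto simp: divide_le_eq)
    finally show ?thesis by (simp add: power_mult_distrib mult_ac)
  qed
  then show thesis using that[of "2 * M * R\<^sup>2"] \<open>M \<ge> 0\<close> by auto
qed

lemma W_deriv_finvec_0:
  assumes "f \<in> finvec"
  shows "((\<lambda>t. W t f) has_vector_derivative K f) (at 0)"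
  unfolding has_vector_derivative_def has_derivative_at_alt
proof (intro conjI allI impI)
  show "bounded_linear (\<lambda>x. x *\<^sub>R K f)" by (rule bounded_linear_scaleR_left)
  fix e :: real assume "e > 0"
  obtain B where B: "B \<ge> 0" "\<And>t. \<bar>t\<bar> < \<tau> \<Longrightarrow> norm (E t f - f - t *\<^sub>R K f) \<le> B * t\<^sup>2"
    using E_second_order[OF assms] by blast
  define d where "d = min \<tau> (e / (B + 1))"
  have "norm (W y f - W 0 f - (y - 0) *\<^sub>R K f) \<le> e * norm (y - 0)" if "norm (y - 0) < d" for y
  proof -
    have y: "\<bar>y\<bar> < \<tau>" "\<bar>y\<bar> < e / (B + 1)" using that by (auto simp: d_def)
    have "B * \<bar>y\<bar> \<le> (B + 1) * \<bar>y\<bar>" by (simp add: algebra_simps)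
    also have "\<dots> \<le> e" using y(2) B(1) by (simp add: field_simps)
    finally have "B * \<bar>y\<bar> * \<bar>y\<bar> \<le> e * \<bar>y\<bar>" by (rule mult_right_mono) simp
    then have "B * y\<^sup>2 \<le> e * \<bar>y\<bar>" by (simp add: power2_eq_square mult.assoc flip: abs_mult)
    then show ?thesis
      using B(2)[OF y(1)] by (simp add: W_0 W_V[OF y(1)] V_E[OF assms y(1)])
  qed
  moreover have "d > 0" using tau_pos \<open>e > 0\<close> B(1) by (simp add: d_def)
  ultimately show "\<exists>d>0. \<forall>y. norm (y - 0) < d \<longrightarrow>
      norm (W y f - W 0 f - (y - 0) *\<^sub>R K f) \<le> e * norm (y - 0)"
    by blast
qed

lemma W_deriv_finvec:
  "f \<in> finvec \<Longrightarrow> ((\<lambda>t. W t f) has_vector_derivative W s (K f)) (at s)"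
  by (rule generator_shift[OF W_unitary W_add W_deriv_finvec_0])

text \<open>Orbits of truncations are differentiable, and isometry makes their convergence uniform
  in time.\<close>

lemma W_continuous: "continuous_on UNIV (\<lambda>t. W t f)"
proof (rule uniform_limit_theorem)
  show "\<forall>\<^sub>F n in sequentially. continuous_on UNIV (\<lambda>t. W t (trunc n f))"
    using W_deriv_finvec[OF finvec_trunc]
    by (intro always_eventually allI continuous_at_imp_continuous_on ballI) 
      (blast intro: has_vector_derivative_continuous)
  show "uniform_limit UNIV (\<lambda>n t. W t (trunc n f)) (\<lambda>t. W t f) sequentially"
  proof (rule uniform_limitI)
    fix e :: real assume "e > 0"
    have "dist (W t (trunc n f)) (W t f) = dist (trunc n f) f" for n t
      unfolding dist_norm
      using unitary_map_diff[OF W_unitary] unitary_map_norm[OF W_unitary]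
      by metis
    then show "\<forall>\<^sub>F n in sequentially. \<forall>t\<in>UNIV. dist (W t (trunc n f)) (W t f) < e"
      using tendstoD[OF trunc_tendsto \<open>e > 0\<close>] by simp
  qed
qed simp

lemma W_group: "unitary_group W"
  unfolding unitary_group_def using W_unitary W_0 W_add W_continuous by blast

text \<open>A derivative \<open>g\<close> of an orbit is moved onto the kets by unitarity, so the
  weak criterion puts it into the maximal operator. Conversely, vectors of the maximal operator are
  limits from the core, and the differential quotients are controlled uniformly along that
  limit.\<close>

lemma W_generator: "generator W = quad_op p q u v"
proof (intro equalityI subrelI)
  fix f g assume "(f, g) \<in> generator W"
  then have d: "((\<lambda>t. W t f) has_vector_derivative g) (at 0)" by (simp add: generator_def)
  show "(f, g) \<in> quad_op p q u v"
  proof (rule quad_op_if_weak)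
    fix k
    have 1: "((\<lambda>t. braket (ket k) (W t f)) has_vector_derivative braket (ket k) g) (at 0)"
      by (rule bounded_linear.has_vector_derivative[OF braket.bounded_linear_right d])
    have "((\<lambda>t. W t (ket k)) \<circ> uminus has_vector_derivative (- 1) *\<^sub>R K (ket k)) (at 0)"
      by (rule vector_diff_chain_at)
        (auto intro!: derivative_eq_intros W_deriv_finvec_0 finvec_ket)
    then have "((\<lambda>t. braket (W (- t) (ket k)) f) has_vector_derivative braket (- K (ket k)) f) (at 0)"
      using bounded_linear.has_vector_derivative[OF braket.bounded_linear_left] by (fastforce simp: o_def)
    moreover have "braket (W (- t) (ket k)) f = braket (ket k) (W t f)" for t
    proof -
      have "braket (W (- t) (ket k)) f = braket (W t (W (- t) (ket k))) (W t f)"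
        using W_unitary by (simp add: unitary_map_def)
      also have "W t (W (- t) (ket k)) = ket k" using W_add[of t "- t"] W_0 by (metis add.right_inverse comp_apply id_apply)
      finally show ?thesis .
    qed
    ultimately have "braket (ket k) g = braket (- K (ket k)) f"
      using vector_derivative_unique_at[OF 1] by simp
    moreover have "quadv (cnj q) (cnj p) (cnj v) (cnj u) (ket k) = - K (ket k)"
      by (rule fock_eqI) (simp add: coeff_quadv finvec_ket quad_def q_def v_def)
    ultimately show "coeff g k = braket (quadv (cnj q) (cnj p) (cnj v) (cnj u) (ket k)) f"
      by (simp add: braket_ket)
  qed
next
  fix f g assume "(f, g) \<in> quad_op p q u v"
  then obtain h where h: "\<And>n. h n \<in> finvec" "h \<longlonglongrightarrow> f" "(\<lambda>n. K (h n)) \<longlonglongrightarrow> g"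
    using quad_op_core by blast
  have "((\<lambda>t. W t f) has_vector_derivative g) (at 0)"
    unfolding has_vector_derivative_def has_derivative_at_alt
  proof (intro conjI allI impI)
    show "bounded_linear (\<lambda>x. x *\<^sub>R g)" by (rule bounded_linear_scaleR_left)
    fix e :: real assume "e > 0"
    have "isCont (\<lambda>t. W t g) 0" using W_continuous by (simp add: continuous_on_eq_continuous_at)
    then obtain d where "d > 0" and d: "\<And>t. norm (t - 0) < d \<Longrightarrow> norm (W t g - W 0 g) < e"
      using \<open>e > 0\<close> unfolding continuous_at_eps_delta dist_norm by blast
    have "norm (W y f - W 0 f - (y - 0) *\<^sub>R g) \<le> e * norm (y - 0)" if y: "norm (y - 0) < d" for y
    proof (rule LIMSEQ_le)
      show "(\<lambda>n. norm (W y (h n) - W 0 (h n) - (y - 0) *\<^sub>R K (h n)))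
          \<longlonglongrightarrow> norm (W y f - W 0 f - (y - 0) *\<^sub>R g)"
        by (intro tendsto_intros bounded_linear.tendsto[OF unitary_map_bounded_linear[OF W_unitary]] h)
      have "(\<lambda>n. norm (y - 0) * (2 * norm (K (h n) - g) + e)) \<longlonglongrightarrow> norm (y - 0) * (2 * norm (g - g) + e)"
        by (intro tendsto_intros h)
      then show "(\<lambda>n. norm (y - 0) * (2 * norm (K (h n) - g) + e)) \<longlonglongrightarrow> e * norm (y - 0)"
        by (simp add: mult.commute)
      show "\<exists>N. \<forall>n\<ge>N. norm (W y (h n) - W 0 (h n) - (y - 0) *\<^sub>R K (h n))
          \<le> norm (y - 0) * (2 * norm (K (h n) - g) + e)"
      proof (intro exI[of _ 0] allI impI)
        fix n :: nat
        \<comment> \<open>Mean value inequality along the segment from 0 to \<open>y\<close>. The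
          derivative varies by at most \<open>e\<close> plus twice the distance of
          \<open>K (h n)\<close> from \<open>g\<close>, and this distance vanishes as
          \<open>n\<close> grows.\<close>
        have "norm (W y (h n) - W 0 (h n) - (y - 0) *\<^sub>R W 0 (K (h n)))
            \<le> norm (y - 0) * (2 * norm (K (h n) - g) + e)"
        proof (rule vector_differentiable_bound_linearization)
          show "((\<lambda>t. W t (h n)) has_vector_derivative W x (K (h n))) (at x within {-d<..<d})" for x
            by (rule has_vector_derivative_at_within[OF W_deriv_finvec[OF h(1)]])
          show "closed_segment 0 y \<subseteq> {-d<..<d}"
            using y \<open>d > 0\<close> by (auto simp: closed_segment_eq_real_ivl split: if_splits)
          show "0 \<in> {-d<..<d}" using \<open>d > 0\<close> by simp
          fix x assume "x \<in> {-d<..<d}"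
          then have "norm (W x g - g) < e" using d[of x] by (auto simp: W_0)
          moreover have "norm (W x (K (h n)) - W x g) = norm (K (h n) - g)"
            using unitary_map_diff[OF W_unitary] unitary_map_norm[OF W_unitary]
            by metis
          moreover have "W x (K (h n)) - K (h n) = (W x (K (h n)) - W x g) + (W x g - g) - (K (h n) - g)"
            by simp
          ultimately show "norm (W x (K (h n)) - W 0 (K (h n))) \<le> 2 * norm (K (h n) - g) + e"
            using norm_triangle_ineq4[of "(W x (K (h n)) - W x g) + (W x g - g)" "K (h n) - g"]
              norm_triangle_ineq[of "W x (K (h n)) - W x g" "W x g - g"]
            by (simp add: W_0)
        qed
        then show "norm (W y (h n) - W 0 (h n) - (y - 0) *\<^sub>R K (h n))
          \<le> norm (y - 0) * (2 * norm (K (h n) - g) + e)" by (simp add: W_0)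
      qed
    qed
    then show "\<exists>d>0. \<forall>y. norm (y - 0) < d \<longrightarrow> norm (W y f - W 0 f - (y - 0) *\<^sub>R g) \<le> e * norm (y - 0)"
      using \<open>d > 0\<close> by blast
  qed
  then show "(f, g) \<in> generator W" by (simp add: generator_def)
qed

lemma exp_skewadjoint_quad_op: "exp_skewadjoint (quad_op p q u v) = graph (W 1)"
proof (rule exp_skewadjoint_eq[OF W_group W_generator])
  have "finvec \<subseteq> Domain (quad_op p q u v)" using quadv_in_quad_op by blast
  then show "closure (Domain (quad_op p q u v)) = UNIV"
    using closure_mono closure_finvec by blast
qed

end

section \<open>Conjugation of quadratures\<close>

lemma quad_sums:
  assumes "\<And>j. (\<lambda>n. a n j) sums s j"
  shows "(\<lambda>n. quad p q u v (a n) k) sums quad p q u v s k"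
  unfolding quad_def lower_def raise_def by (intro sums_add sums_mult assms)

lemma coeff_sums: "f sums g \<Longrightarrow> (\<lambda>n. coeff (f n) k) sums coeff g k"
  by (rule bounded_linear.sums[OF bounded_linear_coeff])

text \<open>In view of \<open>quad_commutator\<close>, the coefficient conditions say
  \<open>[X, K] = \<kappa> X + \<mu>\<close>. The alternative \<open>scalar\<close> holds for a
  squeezing (\<mu> = 0) and for a displacement (\<kappa> = 0) and keeps mixed terms out of the
  integrated formula.\<close>

locale skew_quad_conj = skew_quad +
  fixes x y \<kappa> \<mu> :: complex
  assumes comm_x: "\<kappa> * x = - 2 * y * p" and comm_y: "\<kappa> * y = 2 * x * q"
    and comm_1: "\<mu> = x * v - y * u" and scalar: "\<kappa> = 0 \<or> \<mu> = 0"
begin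

abbreviation X :: "fock \<Rightarrow> fock" where "X \<equiv> quadv 0 0 x y"

lemma X_K:
  assumes f: "f \<in> finvec"
  shows "X (K f) = K (X f) + \<kappa> *\<^sub>C X f + \<mu> *\<^sub>C f"
proof (rule fock_eqI)
  fix k
  have "quad 0 0 (-2 * y * p) (2 * x * q) (coeff f) k = \<kappa> * quad 0 0 x y (coeff f) k"
    unfolding comm_x[symmetric] comm_y[symmetric] by (simp add: quad_def algebra_simps)
  then show "coeff (X (K f)) k = coeff (K (X f) + \<kappa> *\<^sub>C X f + \<mu> *\<^sub>C f) k"
    using quad_commutator[of x y p q u v "coeff f" k]
    by (simp add: coeff_quadv finvec_quadv f comm_1)
qed

definition T :: "fock \<Rightarrow> nat \<Rightarrow> nat \<Rightarrow> fock" where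
  "T f i j = (\<kappa> ^ i / (fact i * fact j)) *\<^sub>C (K ^^ j) f"

lemma T_finvec: "f \<in> finvec \<Longrightarrow> T f i j \<in> finvec"
  unfolding T_def by (intro finvec_scaleC Kpow_finvec)

text \<open>
  \<open>T f i (n - i)\<close> are the terms of the binomial expansion of \<open>(K + \<kappa>)\<^sup>n f / n!\<close>. From
  \<open>X K = (K + \<kappa>) X + \<mu>\<close> one gets \<open>X K\<^sup>n = (K + \<kappa>)\<^sup>n X + n \<mu> K\<^sup>n\<^sup>-\<^sup>1\<close>, because \<open>\<kappa> \<mu> = 0\<close>.
\<close>

lemma T_diagonal:
  assumes f: "f \<in> finvec"
  shows "of_nat (Suc n) *\<^sub>C (\<Sum>i\<le>Suc n. T f i (Suc n - i))
    = K (\<Sum>i\<le>n. T f i (n - i)) + \<kappa> *\<^sub>C (\<Sum>i\<le>n. T f i (n - i))"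
proof -
  have K: "of_nat (Suc j) *\<^sub>C T f i (Suc j) = K (T f i j)" for i j
  proof -
    have "of_nat (Suc j) * (\<kappa> ^ i / (fact i * fact (Suc j))) = \<kappa> ^ i / (fact i * fact j)"
      by (simp add: field_simps del: of_nat_Suc)
    then show ?thesis by (simp add: T_def quadv_scaleC Kpow_finvec f del: of_nat_Suc fact_Suc)
  qed
  have L: "of_nat (Suc i) *\<^sub>C T f (Suc i) j = \<kappa> *\<^sub>C T f i j" for i j
  proof -
    have "of_nat (Suc i) * (\<kappa> ^ Suc i / (fact (Suc i) * fact j)) = \<kappa> * (\<kappa> ^ i / (fact i * fact j))"
      by (simp add: field_simps del: of_nat_Suc)
    then show ?thesis by (simp add: T_def del: of_nat_Suc fact_Suc power_Suc)
  qed
  \<comment> \<open>The factor n + 1 is split as (n + 1 - i) + i: the first part recovers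
    \<open>K\<close>, the second \<kappa>, as in Pascal's rule.\<close>
  have "of_nat (Suc n) *\<^sub>C (\<Sum>i\<le>Suc n. T f i (Suc n - i))
      = (\<Sum>i\<le>Suc n. of_nat (Suc n - i) *\<^sub>C T f i (Suc n - i)) + (\<Sum>i\<le>Suc n. of_nat i *\<^sub>C T f i (Suc n - i))"
    unfolding scaleC.sum_right sum.distrib[symmetric] scaleC_add_left[symmetric] of_nat_add[symmetric]
    by (rule sum.cong) simp_all
  also have "(\<Sum>i\<le>Suc n. of_nat (Suc n - i) *\<^sub>C T f i (Suc n - i)) = (\<Sum>i\<le>n. K (T f i (n - i)))"
    unfolding sum.atMost_Suc by (simp add: Suc_diff_le K[symmetric] del: of_nat_Suc)
  also have "\<dots> = K (\<Sum>i\<le>n. T f i (n - i))"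
    by (simp add: quadv_sum T_finvec f)
  also have "(\<Sum>i\<le>Suc n. of_nat i *\<^sub>C T f i (Suc n - i)) = (\<Sum>i\<le>n. \<kappa> *\<^sub>C T f i (n - i))"
    unfolding sum.atMost_Suc_shift by (simp add: L[symmetric] del: of_nat_Suc)
  also have "\<dots> = \<kappa> *\<^sub>C (\<Sum>i\<le>n. T f i (n - i))"
    by (simp add: scaleC.sum_right)
  finally show ?thesis .
qed

lemma X_Kpow:
  assumes f: "f \<in> finvec"
  shows "(1 / fact n) *\<^sub>C X ((K ^^ n) f)
    = (\<Sum>i\<le>n. T (X f) i (n - i)) + (of_nat n * \<mu> / fact n) *\<^sub>C (K ^^ (n - 1)) f"
proof (induction n)
  case 0
  show ?case by (simp add: T_def)
next
  case (Suc n)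
  let ?D = "\<lambda>n. \<Sum>i\<le>n. T (X f) i (n - i)"
  have Df: "?D n \<in> finvec" by (intro finvec_sum T_finvec finvec_quadv f)
  \<comment> \<open>At \<open>n = 0\<close> the truncated exponent would give the wrong power, but
    the coefficient is 0.\<close>
  have KKf: "(\<mu> * of_nat n / fact n) *\<^sub>C K ((K ^^ (n - Suc 0)) f) = (\<mu> * of_nat n / fact n) *\<^sub>C (K ^^ n) f"
    by (cases n) auto
  have "(1 / fact n) *\<^sub>C X ((K ^^ Suc n) f)
      = K ((1 / fact n) *\<^sub>C X ((K ^^ n) f)) + \<kappa> *\<^sub>C (1 / fact n) *\<^sub>C X ((K ^^ n) f) + (\<mu> / fact n) *\<^sub>C (K ^^ n) f"
    by (simp add: X_K Kpow_finvec f quadv_scaleC finvec_quadv scaleC_add_right mult.commute)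
  also have "\<dots> = of_nat (Suc n) *\<^sub>C ?D (Suc n) + (of_nat (Suc n) * \<mu> / fact n) *\<^sub>C (K ^^ n) f"
    unfolding Suc.IH T_diagonal[OF finvec_quadv[OF f]]
    using scalar
    by (auto simp: quadv_add quadv_scaleC Df finvec_scaleC Kpow_finvec f KKf scaleC_add_right
        scaleC_add_left algebra_simps add_divide_distrib simp del: scaleC_simps(4))
  finally have eq: "(1 / fact n) *\<^sub>C X ((K ^^ Suc n) f)
      = of_nat (Suc n) *\<^sub>C ?D (Suc n) + (of_nat (Suc n) * \<mu> / fact n) *\<^sub>C (K ^^ n) f" .
  have c: "complex_of_nat (Suc n) \<noteq> 0" by (simp del: of_nat_Suc)
  have "(1 / fact (Suc n)) *\<^sub>C X ((K ^^ Suc n) f) = (1 / of_nat (Suc n)) *\<^sub>C (1 / fact n) *\<^sub>C X ((K ^^ Suc n) f)"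
    by (simp del: of_nat_Suc funpow.simps add: mult.commute)
  also have "\<dots> = ?D (Suc n) + (of_nat (Suc n) * \<mu> / fact (Suc n)) *\<^sub>C (K ^^ n) f"
    unfolding eq scaleC_add_right using c by (simp add: fact_Suc del: of_nat_Suc)
  finally show ?case by simp
qed

text \<open>\<open>X\<close> is unbounded but acts on each coordinate by a finite combination, so it
  can be applied termwise to the series. The binomial sums from \<open>X_Kpow\<close> are then the
  Cauchy product of the series for exp (\<kappa> t) and for \<open>E t (X f)\<close>.\<close>

lemma E_conj:
  assumes f: "f \<in> finvec" and t: "\<bar>t\<bar> < \<tau>"
  shows "(E t f, exp (\<kappa> * t) *\<^sub>C E t (X f) + (t * \<mu>) *\<^sub>C E t f) \<in> quad_op 0 0 x y"
  unfolding quad_op_iff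
proof
  fix k
  have Xf: "X f \<in> finvec" by (rule finvec_quadv[OF f])
  have "(\<lambda>n. quad 0 0 x y (coeff ((t ^ n / fact n) *\<^sub>R (K ^^ n) f)) k) sums quad 0 0 x y (coeff (E t f)) k"
    by (intro quad_sums coeff_sums E_sums f tau_R t)
  moreover have "quad 0 0 x y (coeff ((t ^ n / fact n) *\<^sub>R (K ^^ n) f)) k
      = t ^ n * coeff ((1 / fact n) *\<^sub>C X ((K ^^ n) f)) k" for n
  proof -
    have "coeff ((t ^ n / fact n) *\<^sub>R (K ^^ n) f) = (\<lambda>k. (t ^ n / fact n) * coeff ((K ^^ n) f) k)"
      by (simp add: fun_eq_iff)
    then show ?thesis by (simp only: quad_scale) (simp add: coeff_quadv Kpow_finvec f)
  qed
  ultimately have 1: "(\<lambda>n. t ^ n * coeff ((1 / fact n) *\<^sub>C X ((K ^^ n) f)) k)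
      sums quad 0 0 x y (coeff (E t f)) k" by simp
  define a where "a i = (\<kappa> * t) ^ i / fact i" for i
  define b where "b j = coeff ((t ^ j / fact j) *\<^sub>R (K ^^ j) (X f)) k" for j
  have "summable (\<lambda>j. norm (b j))"
  proof (rule summable_comparison_test'[OF E_summable[OF Xf tau_R[OF t]]])
    show "norm (norm (b j)) \<le> norm ((t ^ j / fact j) *\<^sub>R (K ^^ j) (X f))" for j
      using braket_le_norm[of "ket k" "(t ^ j / fact j) *\<^sub>R (K ^^ j) (X f)"]
      unfolding b_def braket_ket norm_ket by simp
  qed
  moreover have "summable (\<lambda>i. norm (a i))"
    using summable_norm_exp[of "\<kappa> * t"] by (simp add: a_def norm_divide norm_power scaleR_conv_of_real divide_inverse mult.commute)
  ultimately have "(\<lambda>n. \<Sum>i\<le>n. a i * b (n - i)) sums ((\<Sum>i. a i) * (\<Sum>j. b j))"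
    by (intro Cauchy_product_sums)
  moreover have "(\<Sum>i. a i) = exp (\<kappa> * t)"
    unfolding exp_def a_def by (rule suminf_cong) (simp add: scaleR_conv_of_real divide_inverse mult.commute)
  moreover have "(\<Sum>j. b j) = coeff (E t (X f)) k"
    unfolding b_def by (rule sums_unique[symmetric, OF coeff_sums[OF E_sums[OF Xf tau_R[OF t]]]])
  moreover have "(\<Sum>i\<le>n. a i * b (n - i)) = t ^ n * coeff (\<Sum>i\<le>n. T (X f) i (n - i)) k" for n
    unfolding coeff_sum sum_distrib_left
    by (rule sum.cong) (simp_all add: a_def b_def T_def power_mult_distrib power_add[symmetric]
        flip: power_add)
  ultimately have 2: "(\<lambda>n. t ^ n * coeff (\<Sum>i\<le>n. T (X f) i (n - i)) k)
      sums (exp (\<kappa> * t) * coeff (E t (X f)) k)" by simp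
  have "(\<lambda>n. (t * \<mu>) * coeff ((t ^ n / fact n) *\<^sub>R (K ^^ n) f) k) sums ((t * \<mu>) * coeff (E t f) k)"
    by (intro sums_mult coeff_sums E_sums f tau_R t)
  moreover have "(t * \<mu>) * coeff ((t ^ n / fact n) *\<^sub>R (K ^^ n) f) k
      = t ^ Suc n * coeff ((of_nat (Suc n) * \<mu> / fact (Suc n)) *\<^sub>C (K ^^ (Suc n - 1)) f) k" for n
    by (simp add: field_simps del: of_nat_Suc)
  ultimately have "(\<lambda>n. t ^ Suc n * coeff ((of_nat (Suc n) * \<mu> / fact (Suc n)) *\<^sub>C (K ^^ (Suc n - 1)) f) k)
      sums ((t * \<mu>) * coeff (E t f) k)" by simp
  \<comment> \<open>The term for \<open>n = 0\<close> vanishes, so restoring it leaves the sum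
    unchanged.\<close>
  then have 3: "(\<lambda>n. t ^ n * coeff ((of_nat n * \<mu> / fact n) *\<^sub>C (K ^^ (n - 1)) f) k)
      sums ((t * \<mu>) * coeff (E t f) k)"
    by (subst (asm) sums_Suc_iff) simp
  have "(\<lambda>n. t ^ n * coeff ((1 / fact n) *\<^sub>C X ((K ^^ n) f)) k)
      sums (exp (\<kappa> * t) * coeff (E t (X f)) k + (t * \<mu>) * coeff (E t f) k)"
    unfolding X_Kpow[OF f] coeff_simps(2) distrib_left by (rule sums_add[OF 2 3])
  from sums_unique2[OF this 1]
  show "coeff (exp (\<kappa> * t) *\<^sub>C E t (X f) + (t * \<mu>) *\<^sub>C E t f) k = quad 0 0 x y (coeff (E t f)) k"
    by simp
qed

text \<open>The relation passes from the core to the whole domain because \<open>V t\<close> is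
  continuous and \<open>quad_op\<close> is closed.\<close>

lemma V_conj:
  assumes fg: "(f, g) \<in> quad_op 0 0 x y" and t: "\<bar>t\<bar> < \<tau>"
  shows "(V t f, V t (exp (\<kappa> * t) *\<^sub>C g + (t * \<mu>) *\<^sub>C f)) \<in> quad_op 0 0 x y"
proof -
  obtain h where h: "\<And>n. h n \<in> finvec" "h \<longlonglongrightarrow> f" "(\<lambda>n. X (h n)) \<longlonglongrightarrow> g"
    using quad_op_core[OF fg] by blast
  have Vc: "(\<lambda>n. V t (z n)) \<longlonglongrightarrow> V t w" if "z \<longlonglongrightarrow> w" for z w
    by (rule bounded_linear.tendsto[OF unitary_map_bounded_linear[OF V_unitary[OF t]] that])
  show ?thesis
  proof (rule quad_op_tendsto)
    show "(\<lambda>n. V t (h n)) \<longlonglongrightarrow> V t f" by (rule Vc[OF h(2)])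
    show "(\<lambda>n. V t (exp (\<kappa> * t) *\<^sub>C X (h n) + (t * \<mu>) *\<^sub>C h n)) \<longlonglongrightarrow> V t (exp (\<kappa> * t) *\<^sub>C g + (t * \<mu>) *\<^sub>C f)"
      by (intro Vc tendsto_add scaleC.tendsto tendsto_const h)
    show "(V t (h n), V t (exp (\<kappa> * t) *\<^sub>C X (h n) + (t * \<mu>) *\<^sub>C h n)) \<in> quad_op 0 0 x y" for n
      using E_conj[OF h(1)[of n] t]
      by (simp add: V_add V_scaleC t V_E h(1) finvec_quadv)
  qed
qed

lemma V_funpow_conj:
  assumes t: "\<bar>t\<bar> < \<tau>"
  shows "(f, g) \<in> quad_op 0 0 x y \<Longrightarrow>
    ((V t ^^ n) f, (V t ^^ n) (exp (\<kappa> * (of_nat n * of_real t)) *\<^sub>C g + (of_nat n * of_real t * \<mu>) *\<^sub>C f)) \<in> quad_op 0 0 x y"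
proof (induction n)
  case (Suc n)
  define U where "U = V t ^^ n"
  define c d where "c = exp (\<kappa> * (of_nat n * of_real t))"
    and "d = of_nat n * of_real t * \<mu>"
  have U: "U (w + z) = U w + U z" "U (a *\<^sub>C w) = a *\<^sub>C U w" for a w z
    using unitary_map_funpow[OF V_unitary[OF t], of n] by (simp_all add: unitary_map_def U_def)
  have "(V t (U f), V t (exp (\<kappa> * t) *\<^sub>C U (c *\<^sub>C g + d *\<^sub>C f) + (t * \<mu>) *\<^sub>C U f)) \<in> quad_op 0 0 x y"
    using V_conj[OF Suc.IH[OF Suc.prems] t] by (simp only: U_def c_def d_def)
  also have "exp (\<kappa> * t) *\<^sub>C U (c *\<^sub>C g + d *\<^sub>C f) + (t * \<mu>) *\<^sub>C U f
      = U ((exp (\<kappa> * t) * c) *\<^sub>C g + (exp (\<kappa> * t) * d + t * \<mu>) *\<^sub>C f)"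
    by (simp add: U scaleC_add_right scaleC_add_left add.assoc)
  also have "exp (\<kappa> * t) * c = exp (\<kappa> * (of_nat (Suc n) * of_real t))"
    by (simp add: c_def exp_add[symmetric] algebra_simps)
  \<comment> \<open>If \<kappa> = 0 the exponential is 1; if \<mu> = 0 both shifts vanish.\<close>
  also have "exp (\<kappa> * t) * d + t * \<mu> = of_nat (Suc n) * of_real t * \<mu>"
    using scalar by (auto simp: d_def algebra_simps)
  finally show ?case by (simp add: U_def)
qed simp

lemma W_conj:
  assumes fg: "(f, g) \<in> quad_op 0 0 x y"
  shows "(W t f, W t (exp (\<kappa> * t) *\<^sub>C g + (t * \<mu>) *\<^sub>C f)) \<in> quad_op 0 0 x y"
proof -
  obtain m where m: "m > 0" "\<bar>t\<bar> < real m * \<tau>" using ex_step by blast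
  have "complex_of_nat m * complex_of_real (t / real m) = t" using m(1) by simp
  then show ?thesis
    using V_funpow_conj[OF step_small[OF m(2)] fg, of m] by (simp add: W_eq[OF m(2)])
qed

end

section \<open>The operators of the bosonic mode\<close>

lemma op_scale_iff: "(f, g) \<in> op_scale c T \<longleftrightarrow> (\<exists>h. (f, h) \<in> T \<and> g = c *\<^sub>C h)"
  and op_add_iff: "(f, g) \<in> op_add S T \<longleftrightarrow> (\<exists>h k. (f, h) \<in> S \<and> (f, k) \<in> T \<and> g = h + k)"
  and op_diff_iff: "(f, g) \<in> op_diff S T \<longleftrightarrow> (\<exists>h k. (f, h) \<in> S \<and> (f, k) \<in> T \<and> g = h - k)"
  and op_mult_iff: "(f, g) \<in> op_mult S T \<longleftrightarrow> (\<exists>h. (f, h) \<in> T \<and> (h, g) \<in> S)"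
  by (auto simp: op_scale_def op_add_def op_diff_def op_mult_def)

lemma annihilation_iff: "(f, g) \<in> annihilation \<longleftrightarrow> coeff g = lower (coeff f)"
  and creation_iff: "(f, g) \<in> creation \<longleftrightarrow> coeff g = raise (coeff f)"
  by (auto simp: annihilation_eq creation_eq quad_op_iff quad_def fun_eq_iff)

lemma annihilation_finvec: "f \<in> finvec \<Longrightarrow> (f, quadv 0 0 1 0 f) \<in> annihilation"
  and creation_finvec: "f \<in> finvec \<Longrightarrow> (f, quadv 0 0 0 1 f) \<in> creation"
  by (simp_all add: annihilation_eq creation_eq quadv_in_quad_op)

lemmas op_iffs = op_scale_iff op_add_iff op_diff_iff op_mult_iff

lemma closure_displacement_generator:
  "closure (op_diff (op_scale \<alpha> creation) (op_scale (cnj \<alpha>) annihilation)) = quad_op 0 0 (- cnj \<alpha>) \<alpha>"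
proof (rule closure_eq_quad_op)
  fix f assume f: "f \<in> finvec"
  have "quadv 0 0 (- cnj \<alpha>) \<alpha> f = \<alpha> *\<^sub>C quadv 0 0 0 1 f - cnj \<alpha> *\<^sub>C quadv 0 0 1 0 f"
    by (rule fock_eqI) (simp add: coeff_quadv f quad_def)
  then show "(f, quadv 0 0 (- cnj \<alpha>) \<alpha> f) \<in> op_diff (op_scale \<alpha> creation) (op_scale (cnj \<alpha>) annihilation)"
    using annihilation_finvec[OF f] creation_finvec[OF f] by (auto simp: op_iffs)
next
  show "op_diff (op_scale \<alpha> creation) (op_scale (cnj \<alpha>) annihilation) \<subseteq> quad_op 0 0 (- cnj \<alpha>) \<alpha>"
    by (auto simp: op_iffs annihilation_iff creation_iff quad_op_iff quad_def fun_eq_iff)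
qed

text \<open>The natural domain requires both second powers to be defined separately. It still
  contains \<open>finvec\<close>, so taking the closure recovers the maximal operator.\<close>

lemma closure_squeezing_generator:
  "closure (op_scale (complex_of_real (r / 2))
     (op_diff (op_scale (cis (- \<theta>)) (op_mult annihilation annihilation))
              (op_scale (cis \<theta>) (op_mult creation creation))))
   = quad_op (complex_of_real r / 2 * cis (- \<theta>)) (- (complex_of_real r / 2 * cis \<theta>)) 0 0" (is "closure ?T = quad_op ?p ?q 0 0")
proof (rule closure_eq_quad_op)
  fix f assume f: "f \<in> finvec"
  have aa: "(f, quadv 0 0 1 0 (quadv 0 0 1 0 f)) \<in> op_mult annihilation annihilation"
    and cc: "(f, quadv 0 0 0 1 (quadv 0 0 0 1 f)) \<in> op_mult creation creation"
    unfolding op_mult_iff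
    using annihilation_finvec[OF f] annihilation_finvec[OF finvec_quadv[OF f]]
      creation_finvec[OF f] creation_finvec[OF finvec_quadv[OF f]] by blast+
  have "quadv ?p ?q 0 0 f = complex_of_real (r / 2) *\<^sub>C
      (cis (- \<theta>) *\<^sub>C quadv 0 0 1 0 (quadv 0 0 1 0 f) - cis \<theta> *\<^sub>C quadv 0 0 0 1 (quadv 0 0 0 1 f))"
    by (rule fock_eqI) (simp add: coeff_quadv f finvec_quadv quad_def[abs_def] algebra_simps)
  then show "(f, quadv ?p ?q 0 0 f) \<in> ?T"
    using aa cc unfolding op_scale_iff op_diff_iff by blast
next
  show "?T \<subseteq> quad_op ?p ?q 0 0"
  proof (rule subrelI)
    fix f g assume "(f, g) \<in> ?T"
    then obtain h k where "coeff h = lower (lower (coeff f))" "coeff k = raise (raise (coeff f))"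
        "g = complex_of_real (r / 2) *\<^sub>C (cis (- \<theta>) *\<^sub>C h - cis \<theta> *\<^sub>C k)"
      unfolding op_iffs annihilation_iff creation_iff by auto
    then show "(f, g) \<in> quad_op ?p ?q 0 0"
      by (simp add: quad_op_iff quad_def fun_eq_iff algebra_simps)
  qed
qed

lemma quadrature_A_eq:
  "quadrature_A \<theta> = quad_op 0 0 (cis (- \<theta> / 2) / sqrt 2) (cnj (cis (- \<theta> / 2) / sqrt 2))" (is "_ = quad_op 0 0 ?x ?y")
  unfolding quadrature_A_def
proof (rule closure_eq_quad_op)
  fix f assume f: "f \<in> finvec"
  have "quadv 0 0 ?x ?y f = complex_of_real (1 / sqrt 2) *\<^sub>C
      (cis (- \<theta> / 2) *\<^sub>C quadv 0 0 1 0 f + cis (\<theta> / 2) *\<^sub>C quadv 0 0 0 1 f)"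
    by (rule fock_eqI) (simp add: coeff_quadv f quad_def cis_cnj algebra_simps add_divide_distrib)
  then show "(f, quadv 0 0 ?x ?y f) \<in> op_scale (complex_of_real (1 / sqrt 2))
     (op_add (op_scale (cis (- \<theta> / 2)) annihilation) (op_scale (cis (\<theta> / 2)) creation))"
    using annihilation_finvec[OF f] creation_finvec[OF f] unfolding op_scale_iff op_add_iff by blast
next
  show "op_scale (complex_of_real (1 / sqrt 2))
     (op_add (op_scale (cis (- \<theta> / 2)) annihilation) (op_scale (cis (\<theta> / 2)) creation)) \<subseteq> quad_op 0 0 ?x ?y"
    (is "?T \<subseteq> _")
  proof (rule subrelI)
    fix f g assume "(f, g) \<in> ?T"
    then obtain h k where "coeff h = lower (coeff f)" "coeff k = raise (coeff f)"
        "g = complex_of_real (1 / sqrt 2) *\<^sub>C (cis (- \<theta> / 2) *\<^sub>C h + cis (\<theta> / 2) *\<^sub>C k)"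
      unfolding op_iffs annihilation_iff creation_iff by auto
    then show "(f, g) \<in> quad_op 0 0 ?x ?y"
      by (simp add: quad_op_iff quad_def fun_eq_iff cis_cnj add_divide_distrib algebra_simps)
  qed
qed

lemma quadrature_B_eq:
  "quadrature_B \<theta> = quad_op 0 0 (\<i> * cis (- \<theta> / 2) / sqrt 2) (cnj (\<i> * cis (- \<theta> / 2) / sqrt 2))" (is "_ = quad_op 0 0 ?x ?y")
  unfolding quadrature_B_def
proof (rule closure_eq_quad_op)
  fix f assume f: "f \<in> finvec"
  have "quadv 0 0 ?x ?y f = (\<i> / complex_of_real (sqrt 2)) *\<^sub>C
      (cis (- \<theta> / 2) *\<^sub>C quadv 0 0 1 0 f - cis (\<theta> / 2) *\<^sub>C quadv 0 0 0 1 f)"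
    by (rule fock_eqI) (simp add: coeff_quadv f quad_def cis_cnj algebra_simps diff_divide_distrib)
  then show "(f, quadv 0 0 ?x ?y f) \<in> op_scale (\<i> / complex_of_real (sqrt 2))
     (op_diff (op_scale (cis (- \<theta> / 2)) annihilation) (op_scale (cis (\<theta> / 2)) creation))"
    using annihilation_finvec[OF f] creation_finvec[OF f] unfolding op_scale_iff op_diff_iff by blast
next
  show "op_scale (\<i> / complex_of_real (sqrt 2))
     (op_diff (op_scale (cis (- \<theta> / 2)) annihilation) (op_scale (cis (\<theta> / 2)) creation)) \<subseteq> quad_op 0 0 ?x ?y"
    (is "?T \<subseteq> _")
  proof (rule subrelI)
    fix f g assume "(f, g) \<in> ?T"
    then obtain h k where "coeff h = lower (coeff f)" "coeff k = raise (coeff f)"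
        "g = (\<i> / complex_of_real (sqrt 2)) *\<^sub>C (cis (- \<theta> / 2) *\<^sub>C h - cis (\<theta> / 2) *\<^sub>C k)"
      unfolding op_iffs annihilation_iff creation_iff by auto
    then show "(f, g) \<in> quad_op 0 0 ?x ?y"
      by (simp add: quad_op_iff quad_def fun_eq_iff cis_cnj diff_divide_distrib algebra_simps)
  qed
qed

text \<open>The generator is linear in the ladder operators, so its commutator with a quadrature is
  a scalar: \<kappa> = 0 and \<mu> = x \<alpha> + y cnj \<alpha>.\<close>

lemma displacement_unitary:
  obtains U where "unitary_map U" "displacement \<alpha> = graph U"
    "\<And>x y f g. (f, g) \<in> quad_op 0 0 x y \<Longrightarrow>
      (U f, U (g + (x * \<alpha> + y * cnj \<alpha>) *\<^sub>C f)) \<in> quad_op 0 0 x y"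
proof -
  interpret skew_quad 0 0 "- cnj \<alpha>" \<alpha> by standard auto
  have "(W 1 f, W 1 (g + (x * \<alpha> + y * cnj \<alpha>) *\<^sub>C f)) \<in> quad_op 0 0 x y"
    if fg: "(f, g) \<in> quad_op 0 0 x y" for x y f g
  proof -
    interpret skew_quad_conj 0 0 "- cnj \<alpha>" \<alpha> x y 0 "x * \<alpha> + y * cnj \<alpha>" by standard auto
    show ?thesis using W_conj[OF fg, of 1] by simp
  qed
  moreover have "displacement \<alpha> = graph (W 1)"
    unfolding displacement_def closure_displacement_generator by (rule exp_skewadjoint_quad_op)
  ultimately show thesis using that[of "W 1"] W_unitary by blast
qed

text \<open>The generator is purely quadratic, so \<mu> = 0; the two equations state that (x, y) is
  an eigenvector of commutation with it, for the eigenvalue \<kappa>.\<close>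

lemma squeezing_unitary:
  obtains U where "unitary_map U" "squeezing r \<theta> = graph U"
    "\<And>x y \<kappa> f g. \<kappa> * x = - (r * y * cis (- \<theta>)) \<Longrightarrow> \<kappa> * y = - (r * x * cis \<theta>) \<Longrightarrow>
      (f, g) \<in> quad_op 0 0 x y \<Longrightarrow> (U f, U (exp \<kappa> *\<^sub>C g)) \<in> quad_op 0 0 x y"
proof -
  interpret skew_quad "complex_of_real r / 2 * cis (- \<theta>)" "- (complex_of_real r / 2 * cis \<theta>)" 0 0 by standard (auto simp: cis_cnj)
  have "(W 1 f, W 1 (exp \<kappa> *\<^sub>C g)) \<in> quad_op 0 0 x y"
    if "\<kappa> * x = - (r * y * cis (- \<theta>))" "\<kappa> * y = - (r * x * cis \<theta>)"
      and fg: "(f, g) \<in> quad_op 0 0 x y" for x y \<kappa> :: complex and f g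
  proof -
    interpret skew_quad_conj "complex_of_real r / 2 * cis (- \<theta>)" "- (complex_of_real r / 2 * cis \<theta>)" 0 0 x y \<kappa> 0
      by standard (use that in \<open>auto simp: mult_ac\<close>)
    show ?thesis using W_conj[OF fg, of 1] by simp
  qed
  moreover have "squeezing r \<theta> = graph (W 1)"
    unfolding squeezing_def closure_squeezing_generator by (rule exp_skewadjoint_quad_op)
  ultimately show thesis using that[of "W 1"] W_unitary by blast
qed

subsection \<open>The thermal and the Gaussian state\<close>

text \<open>The point is the domain: from square summability of k f(k) follows that of sqrt k f(k),
  so the intermediate vector in the product exists.\<close>

lemma op_mult_creation_annihilation:
  "(f, h) \<in> op_mult creation annihilation \<longleftrightarrow> (\<forall>k. coeff h k = of_nat k * coeff f k)"
proof
  assume "(f, h) \<in> op_mult creation annihilation"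
  then show "\<forall>k. coeff h k = of_nat k * coeff f k"
    by (auto simp: op_mult_iff annihilation_iff creation_iff raise_lower)
next
  assume h: "\<forall>k. coeff h k = of_nat k * coeff f k"
  have "summable (\<lambda>k. (cmod (lower (coeff f) k))\<^sup>2)"
  proof (rule summable_comparison_test')
    show "summable (\<lambda>k. (cmod (coeff h (k + 1)))\<^sup>2)"
      using coeff_summable[of h] by (subst summable_iff_shift)
    fix k :: nat
    have "real (Suc k) * (cmod (coeff f (Suc k)))\<^sup>2 \<le> (real (Suc k))\<^sup>2 * (cmod (coeff f (Suc k)))\<^sup>2"
      by (intro mult_right_mono) (auto simp: power2_eq_square)
    then show "norm ((cmod (lower (coeff f) k))\<^sup>2) \<le> (cmod (coeff h (k + 1)))\<^sup>2"
      using h by (simp add: lower_def norm_mult power_mult_distrib del: of_nat_Suc)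
  qed
  then have l: "coeff (Abs_fock (lower (coeff f))) = lower (coeff f)" by (simp add: Abs_fock_inverse)
  then have "coeff h = raise (coeff (Abs_fock (lower (coeff f))))"
    unfolding l using h by (simp add: fun_eq_iff raise_lower)
  then show "(f, h) \<in> op_mult creation annihilation"
    using l unfolding op_mult_iff annihilation_iff creation_iff by blast
qed

lemma sums_geometric_weights:
  fixes z :: real
  assumes "0 < z" "z < 1"
  shows "(\<lambda>n. (1 - z) * z ^ n) sums 1"
    and "(\<lambda>n. (1 - z) * z ^ n * real (Suc n)) sums (1 / (1 - z))"
  using sums_mult[OF geometric_sums[of z], of "1 - z"]
    sums_mult[OF geometric_deriv_sums[of z], of "1 - z"] assms
  by (auto simp: power2_eq_square mult_ac)

lemma thermal_state_eq:
  assumes "\<beta> > 0"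
  defines "z \<equiv> exp (- \<beta>)"
  shows "thermal_state \<beta> = diagonal_op (\<lambda>n. (1 - z) * z ^ n) ket"
proof -
  have z: "0 < z" "z < 1" using assms by (auto simp: z_def)
  let ?H = "op_scale (complex_of_real (- \<beta>)) (op_mult creation annihilation)"
  have "(f, h) \<in> ?H \<longleftrightarrow> (f, h) \<in> diagonal_op (\<lambda>n. - \<beta> * n) ket" for f h
  proof -
    have "(f, h) \<in> ?H \<longleftrightarrow> (\<forall>k. coeff h k = complex_of_real (- \<beta> * k) * coeff f k)"
    proof
      assume h: "\<forall>k. coeff h k = complex_of_real (- \<beta> * k) * coeff f k"
      have "(f, (- 1 / complex_of_real \<beta>) *\<^sub>C h) \<in> op_mult creation annihilation"
        unfolding op_mult_creation_annihilation using assms(1) by (simp add: h)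
      moreover have "h = complex_of_real (- \<beta>) *\<^sub>C (- 1 / complex_of_real \<beta>) *\<^sub>C h"
        using assms(1) by simp
      ultimately show "(f, h) \<in> ?H" unfolding op_scale_iff by blast
    qed (auto simp: op_scale_iff op_mult_creation_annihilation)
    then show ?thesis by (simp add: diagonal_op_iff[OF orthonormal_ket] braket_ket)
  qed
  then have "spectral_decomposition ?H (\<lambda>n. - \<beta> * n) ket"
    unfolding spectral_decomposition_def using orthonormal_ket by auto
  moreover have "inj (\<lambda>n. - \<beta> * real n)" using assms by (auto simp: inj_def)
  ultimately have E: "exp_selfadjoint ?H = diagonal_op (\<lambda>n. z ^ n) ket"
    by (simp add: exp_selfadjoint_simple z_def exp_of_nat_mult[symmetric] mult.commute)
  \<comment> \<open>Composition with \<open>Id\<close> brings the partition function under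
    \<open>has_trace_diagonal_mult\<close>; it is the geometric series in z.\<close>
  have "has_trace (op_mult (diagonal_op (\<lambda>n. z ^ n) ket) Id) (1 / (1 - z))"
  proof (rule has_trace_diagonal_mult[OF orthonormal_ket, where \<phi> = ket])
    show "summable (\<lambda>n. \<bar>z ^ n\<bar> * norm (ket n))" using z by (simp add: summable_geometric)
    have "(\<lambda>n. complex_of_real (z ^ n)) sums (1 / (1 - z))"
      using geometric_sums[of "complex_of_real z"] z by simp
    then show "(\<lambda>n. complex_of_real (z ^ n) * braket (ket n) (ket n)) sums (1 / (1 - z))"
      by (simp add: braket_ket)
  qed auto
  then have "trace_op (diagonal_op (\<lambda>n. z ^ n) ket) = 1 / (1 - z)"
    by (intro trace_op_eq) (simp add: op_mult_def)
  then have "thermal_state \<beta> = op_scale (1 - z) (diagonal_op (\<lambda>n. z ^ n) ket)"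
    unfolding thermal_state_def Let_def E by simp
  also have "\<dots> = diagonal_op (\<lambda>n. (1 - z) * z ^ n) ket"
  proof -
    have z1: "1 - complex_of_real z \<noteq> 0" using z of_real_eq_1_iff[of z, where 'a = complex] by auto
    have "(f, h) \<in> op_scale (1 - z) (diagonal_op (\<lambda>n. z ^ n) ket) \<longleftrightarrow>
        (f, (1 / (1 - complex_of_real z)) *\<^sub>C h) \<in> diagonal_op (\<lambda>n. z ^ n) ket" for f h
      unfolding op_scale_iff using z1 by (auto intro!: exI[of _ "(1 / (1 - complex_of_real z)) *\<^sub>C h"])
    then have "(f, h) \<in> op_scale (1 - z) (diagonal_op (\<lambda>n. z ^ n) ket) \<longleftrightarrow>
        (f, h) \<in> diagonal_op (\<lambda>n. (1 - z) * z ^ n) ket" for f h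
      using z1 by (simp add: diagonal_op_iff[OF orthonormal_ket] braket_ket divide_eq_eq mult_ac)
    then show ?thesis by auto
  qed
  finally show ?thesis .
qed

lemma orthonormal_basis_unitary:
  assumes U: "unitary_map U" and on: "orthonormal_basis e"
  shows "orthonormal_basis (\<lambda>n. U (e n))"
  unfolding orthonormal_basis_def
proof (intro conjI allI impI)
  have b: "braket (U f) (U g) = braket f g" for f g using U by (simp add: unitary_map_def)
  show "braket (U (e m)) (U (e n)) = (if m = n then 1 else 0)" for m n
    by (simp add: b orthonormal_basisD(1)[OF on])
  fix f assume f: "\<forall>n. braket (U (e n)) f = 0"
  obtain g where g: "f = U g" using U unfolding unitary_map_def surj_def by blast
  have "g = 0" using f orthonormal_basisD(2)[OF on, of g] by (simp add: g b)
  then show "f = 0" using unitary_map_norm[OF U, of 0] by (simp add: g)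
qed

lemma adjoint_graph_unitary:
  assumes U: "unitary_map U"
  shows "(f, g) \<in> adjoint_op (graph U) \<longleftrightarrow> f = U g"
proof
  have b: "braket (U f) (U g) = braket f g" for f g using U by (simp add: unitary_map_def)
  show "f = U g \<Longrightarrow> (f, g) \<in> adjoint_op (graph U)" by (auto simp: adjoint_op_def graph_def b)
  assume a: "(f, g) \<in> adjoint_op (graph U)"
  obtain h where h: "f = U h" using U unfolding unitary_map_def surj_def by blast
  have "braket (h - g) u = 0" for u
    using a by (auto simp: adjoint_op_def graph_def h b braket.diff_left)
  from this[of "h - g"] show "f = U g" by (simp add: h braket_self_norm)
qed

lemma gaussian_state_eq:
  assumes "\<beta> > 0"
    and S: "unitary_map S" "squeezing r \<theta> = graph S"
    and D: "unitary_map D" "displacement \<alpha> = graph D"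
  defines "z \<equiv> exp (- \<beta>)"
  shows "gaussian_state \<beta> r \<theta> \<alpha> = diagonal_op (\<lambda>n. (1 - z) * z ^ n) (\<lambda>n. D (S (ket n)))"
proof -
  let ?q = "\<lambda>n. (1 - z) * z ^ n"
  have U: "unitary_map (\<lambda>f. D (S f))" using unitary_map_comp[OF D(1) S(1)] by (simp add: comp_def)
  then have b: "braket (D (S f)) (D (S g)) = braket f g" for f g by (simp add: unitary_map_def)
  have "(f, h) \<in> gaussian_state \<beta> r \<theta> \<alpha> \<longleftrightarrow>
      (\<exists>g k. f = D (S g) \<and> (g, k) \<in> diagonal_op ?q ket \<and> h = D (S k))" for f h
    unfolding gaussian_state_def S D op_mult_iff thermal_state_eq[OF assms(1)] z_def
      adjoint_graph_unitary[OF S(1)] adjoint_graph_unitary[OF D(1)]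
    by (auto simp: graph_def)
  also have "\<dots> f h \<longleftrightarrow> (f, h) \<in> diagonal_op ?q (\<lambda>n. D (S (ket n)))" for f h
  proof -
    obtain g k where gk: "f = D (S g)" "h = D (S k)"
      using U unfolding unitary_map_def surj_def by metis
    have inj: "D (S x) = D (S y) \<longleftrightarrow> x = y" for x y
    proof
      assume "D (S x) = D (S y)"
      then have "norm (x - y) = 0"
        using unitary_map_norm[OF U, of "x - y"] unitary_map_diff[OF U, of x y] by simp
      then show "x = y" by simp
    qed simp
    show ?thesis
      by (simp add: gk inj diagonal_op_iff[OF orthonormal_basis_unitary[OF U orthonormal_ket]]
          diagonal_op_iff[OF orthonormal_ket] b)
  qed
  finally show ?thesis by auto
qed

section \<open>A quadrature in a unitarily transformed thermal state\<close>

text \<open>With w = sqrt z the terms are squares of (n + 3) w^n. This sequence is summable, hence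
  eventually below 1, and then dominates its squares.\<close>

lemma summable_square_geometric:
  fixes z :: real
  assumes "0 < z" "z < 1"
  shows "summable (\<lambda>n. (real (n + 3))\<^sup>2 * z ^ n)"
proof -
  define w where "w = sqrt z"
  have w: "0 < w" "w < 1" "w\<^sup>2 = z" using assms by (auto simp: w_def)
  have "summable (\<lambda>n. real (Suc n) * w ^ n)"
    using geometric_deriv_sums[of w] w by (simp add: sums_iff)
  then have "summable (\<lambda>n. real (Suc (n + 2)) * w ^ (n + 2))" by (subst summable_iff_shift)
  then have s: "summable (\<lambda>n. (1 / w\<^sup>2) * (real (Suc (n + 2)) * w ^ (n + 2)))" by (rule summable_mult)
  have "(1 / w\<^sup>2) * (real (Suc (n + 2)) * w ^ (n + 2)) = real (n + 3) * w ^ n" for n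
    using w(1) by (simp add: power2_eq_square)
  then have u: "summable (\<lambda>n. real (n + 3) * w ^ n)" using s by (simp only:)
  show ?thesis
  proof (rule summable_comparison_test_ev[OF _ u])
    have "\<forall>\<^sub>F n in sequentially. real (n + 3) * w ^ n < 1"
      using order_tendstoD(2)[OF summable_LIMSEQ_zero[OF u]] by simp
    then show "\<forall>\<^sub>F n in sequentially. norm ((real (n + 3))\<^sup>2 * z ^ n) \<le> real (n + 3) * w ^ n"
    proof (rule eventually_mono)
      fix n assume "real (n + 3) * w ^ n < 1"
      moreover have "0 \<le> real (n + 3) * w ^ n" using w by simp
      ultimately have "(real (n + 3) * w ^ n) * (real (n + 3) * w ^ n) \<le> real (n + 3) * w ^ n"
        using mult_left_le[of "real (n + 3) * w ^ n" "real (n + 3) * w ^ n"] by simp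
      moreover have "(real (n + 3))\<^sup>2 * z ^ n = (real (n + 3) * w ^ n) * (real (n + 3) * w ^ n)"
        by (simp add: w(3)[symmetric] power2_eq_square power_mult_distrib mult_ac)
      ultimately show "norm ((real (n + 3))\<^sup>2 * z ^ n) \<le> real (n + 3) * w ^ n"
        using assms by (simp add: abs_mult)
    qed
  qed
qed

text \<open>\<open>conj\<close> expresses that \<open>U\<close> transforms the quadrature
  \<open>X\<close> into \<open>e X + a\<close>; both A and B are instances, with their own dilation
  \<open>e\<close> and real shift \<open>a\<close>.\<close>

locale transformed_quadrature =
  fixes U :: "fock \<Rightarrow> fock" and x a :: complex and e z :: real
  assumes U: "unitary_map U" and z: "0 < z" "z < 1" and a_real: "cnj a = a"
    and x: "(cmod x)\<^sup>2 = 1 / 2"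
    and conj: "\<And>f g. (f, g) \<in> quad_op 0 0 x (cnj x) \<Longrightarrow>
      (U f, U (of_real e *\<^sub>C g + a *\<^sub>C f)) \<in> quad_op 0 0 x (cnj x)"
begin

abbreviation X :: operator where "X \<equiv> quad_op 0 0 x (cnj x)"

definition q :: "nat \<Rightarrow> real" where "q n = (1 - z) * z ^ n"
definition \<psi> :: "nat \<Rightarrow> fock" where "\<psi> n = U (ket n)"
definition Y :: "fock \<Rightarrow> fock" where "Y f = of_real e *\<^sub>C quadv 0 0 x (cnj x) f + a *\<^sub>C f"

lemma braket_U: "braket (U f) (U g) = braket f g"
  using U by (simp add: unitary_map_def)

lemma onb: "orthonormal_basis \<psi>"
  using orthonormal_basis_unitary[OF U orthonormal_ket] by (simp add: \<psi>_def[abs_def])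

lemma q_pos: "q n > 0"
  using z by (simp add: q_def)

lemma Y_finvec: "f \<in> finvec \<Longrightarrow> Y f \<in> finvec"
  unfolding Y_def by (intro finvec_add finvec_scaleC finvec_quadv)

lemma Y_add: "f \<in> finvec \<Longrightarrow> g \<in> finvec \<Longrightarrow> Y (f + g) = Y f + Y g"
  by (simp add: Y_def quadv_add scaleC_add_right)

lemma Y_scaleC: "f \<in> finvec \<Longrightarrow> Y (c *\<^sub>C f) = c *\<^sub>C Y f"
  by (simp add: Y_def quadv_scaleC scaleC_add_right mult_ac)

lemma X_U: "f \<in> finvec \<Longrightarrow> (U f, U (Y f)) \<in> X"
  unfolding Y_def by (intro conj quadv_in_quad_op)

lemma X_symmetric: "(f, f') \<in> X \<Longrightarrow> (g, g') \<in> X \<Longrightarrow> braket f g' = braket f' g"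
  using braket_quad_op_adjoint[of f f' 0 0 "cnj x" x g g'] by simp

lemma X_dense: "closure (Domain X) = UNIV"
proof -
  have "finvec \<subseteq> Domain X" using quadv_in_quad_op by blast
  then show ?thesis using closure_mono closure_finvec by blast
qed

lemma XX_dense: "closure (Domain (op_mult X X)) = UNIV"
proof -
  have "finvec \<subseteq> Domain (op_mult X X)"
    unfolding op_mult_def using quadv_in_quad_op finvec_quadv by blast
  then show ?thesis using closure_mono closure_finvec by blast
qed

section \<open>Matrix elements and norm bounds of the transformed quadrature\<close>

lemma Y_ket: "Y (ket n) = (of_real (e * sqrt n) * x) *\<^sub>C ket (n - 1)
    + (of_real (e * sqrt (Suc n)) * cnj x) *\<^sub>C ket (Suc n) + a *\<^sub>C ket n"
  unfolding Y_def quadv_ket by (simp add: scaleC_add_right mult_ac)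

lemma YY_ket: "Y (Y (ket n)) = (of_real (e * sqrt n) * x) *\<^sub>C Y (ket (n - 1))
    + (of_real (e * sqrt (Suc n)) * cnj x) *\<^sub>C Y (ket (Suc n)) + a *\<^sub>C Y (ket n)"
  using arg_cong[OF Y_ket[of n], of Y]
  by (simp only: Y_add Y_scaleC finvec_add finvec_scaleC finvec_ket)

lemma coeff_Y_ket: "coeff (Y (ket n)) m =
    (if Suc m = n then of_real (e * sqrt n) * x else 0)
    + (if m = Suc n then of_real (e * sqrt m) * cnj x else 0) + (if m = n then a else 0)"
  unfolding Y_ket by (cases n) auto

text \<open>The paths through levels n - 1 and n + 1 contribute n/2 and (n + 1)/2 times the square
  of \<open>e\<close>, and the diagonal constant contributes the square of \<open>a\<close>. The
  form \<open>Suc n - 1 / 2\<close> matches the derivative of the geometric series.\<close>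

lemma coeff_YY_ket: "coeff (Y (Y (ket n))) n = of_real (e\<^sup>2 * (real (Suc n) - 1 / 2)) + a\<^sup>2"
proof -
  have xx: "x * cnj x = 1 / 2"
    unfolding complex_norm_square[symmetric] x by simp
  have sq: "complex_of_real (sqrt (real k)) * complex_of_real (sqrt (real k)) = of_nat k" for k
    using of_real_sqrt_sq[of k 1] by simp
  have "coeff (Y (Y (ket n))) n
      = (of_real (e * sqrt n) * x) * coeff (Y (ket (n - 1))) n
        + (of_real (e * sqrt (Suc n)) * cnj x) * coeff (Y (ket (Suc n))) n + a * coeff (Y (ket n)) n"
    unfolding YY_ket coeff_simps ..
  also have "\<dots> = of_real (e\<^sup>2) * (x * cnj x) * of_nat n + of_real (e\<^sup>2) * (x * cnj x) * of_nat (Suc n) + a\<^sup>2"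
    unfolding coeff_Y_ket sq[symmetric]
    by (cases n) (simp_all add: power2_eq_square mult_ac del: of_nat_Suc)
  also have "\<dots> = of_real (e\<^sup>2 * (real (Suc n) - 1 / 2)) + a\<^sup>2"
    unfolding xx by (simp add: field_simps)
  finally show ?thesis .
qed

definition C :: real where "C = 2 * \<bar>e\<bar> * cmod x + cmod a"

lemma C_nonneg: "C \<ge> 0"
  by (simp add: C_def)

text \<open>Stated for arbitrary vectors \<open>h j\<close>, so that \<open>h = ket\<close> bounds
  one application of \<open>Y\<close> and \<open>h j = Y (ket j)\<close> bounds two.\<close>

lemma norm_ladder_combination:
  assumes "\<And>j. j \<le> Suc n \<Longrightarrow> norm (h j) \<le> B"
  shows "norm ((of_real (e * sqrt n) * x) *\<^sub>C h (n - 1)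
    + (of_real (e * sqrt (Suc n)) * cnj x) *\<^sub>C h (Suc n) + a *\<^sub>C h n) \<le> C * (real (n + 2) * B)"
proof -
  have "0 \<le> B" using assms[of 0] norm_ge_zero order_trans by blast
  have s: "sqrt n \<le> real (n + 2)" "sqrt (Suc n) \<le> real (n + 2)" by (rule ladder_weights)+
  have 1: "norm ((of_real (e * sqrt n) * x) *\<^sub>C h (n - 1)) \<le> \<bar>e\<bar> * cmod x * (real (n + 2) * B)"
  proof -
    have "sqrt n * norm (h (n - 1)) \<le> real (n + 2) * B"
      using s assms[of "n - 1"] by (intro mult_mono) auto
    then have "\<bar>e\<bar> * cmod x * (sqrt n * norm (h (n - 1))) \<le> \<bar>e\<bar> * cmod x * (real (n + 2) * B)"
      by (intro mult_left_mono) auto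
    then show ?thesis by (simp add: norm_scaleC norm_mult abs_mult mult_ac)
  qed
  have 2: "norm ((of_real (e * sqrt (Suc n)) * cnj x) *\<^sub>C h (Suc n)) \<le> \<bar>e\<bar> * cmod x * (real (n + 2) * B)"
  proof -
    have "sqrt (Suc n) * norm (h (Suc n)) \<le> real (n + 2) * B"
      using s assms[of "Suc n"] by (intro mult_mono) auto
    then have "\<bar>e\<bar> * cmod x * (sqrt (Suc n) * norm (h (Suc n))) \<le> \<bar>e\<bar> * cmod x * (real (n + 2) * B)"
      by (intro mult_left_mono) auto
    then show ?thesis by (simp add: norm_scaleC norm_mult abs_mult mult_ac del: of_nat_Suc)
  qed
  have "1 * norm (h n) \<le> real (n + 2) * B"
    using assms[of n] by (intro mult_mono) auto
  then have 3: "norm (a *\<^sub>C h n) \<le> cmod a * (real (n + 2) * B)"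
    by (simp add: norm_scaleC mult_left_mono)
  show ?thesis
    using 1 2 3 norm_triangle_ineq[of "(of_real (e * sqrt n) * x) *\<^sub>C h (n - 1)" "(of_real (e * sqrt (Suc n)) * cnj x) *\<^sub>C h (Suc n)"]
      norm_triangle_ineq[of "(of_real (e * sqrt n) * x) *\<^sub>C h (n - 1) + (of_real (e * sqrt (Suc n)) * cnj x) *\<^sub>C h (Suc n)" "a *\<^sub>C h n"]
    by (simp add: C_def algebra_simps)
qed

lemma norm_Y_ket: "norm (Y (ket n)) \<le> C * real (n + 2)"
  unfolding Y_ket using norm_ladder_combination[of n ket 1] by simp

lemma norm_YY_ket: "norm (Y (Y (ket n))) \<le> C * (real (n + 2) * (C * real (n + 3)))"
proof -
  have "norm (Y (ket j)) \<le> C * real (n + 3)" if "j \<le> Suc n" for j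
    using norm_Y_ket[of j] mult_left_mono[OF _ C_nonneg, of "real (j + 2)" "real (n + 3)"] that by simp
  from norm_ladder_combination[of n "\<lambda>j. Y (ket j)", OF this]
  show ?thesis by (simp only: YY_ket)
qed

lemma norm_U: "norm (U f) = norm f"
  by (rule unitary_map_norm[OF U])

lemma summable_quadratic_bound:
  assumes "\<And>n. norm (h n) \<le> B * (real (n + 3))\<^sup>2"
  shows "summable (\<lambda>n. \<bar>q n\<bar> * norm (U (h n)))"
proof (rule summable_comparison_test')
  show "summable (\<lambda>n. ((1 - z) * B) * ((real (n + 3))\<^sup>2 * z ^ n))"
    by (intro summable_mult summable_square_geometric z)
  fix n :: nat
  have "norm (\<bar>q n\<bar> * norm (U (h n))) = q n * norm (h n)"
    using q_pos[of n] by (simp add: norm_U abs_mult)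
  also have "\<dots> \<le> q n * (B * (real (n + 3))\<^sup>2)"
    by (intro mult_left_mono assms less_imp_le q_pos)
  also have "\<dots> = ((1 - z) * B) * ((real (n + 3))\<^sup>2 * z ^ n)"
    by (simp add: q_def mult_ac)
  finally show "norm (\<bar>q n\<bar> * norm (U (h n))) \<le> ((1 - z) * B) * ((real (n + 3))\<^sup>2 * z ^ n)" .
qed

section \<open>First and second moments of the quadrature\<close>

lemma q_sums:
  "(\<lambda>n. complex_of_real (q n)) sums 1"
  "(\<lambda>n. complex_of_real (q n) * (real (Suc n) - 1 / 2)) sums ((1 + z) / (2 * (1 - z)))"
proof -
  show 1: "(\<lambda>n. complex_of_real (q n)) sums 1"
    using sums_of_real[OF sums_geometric_weights(1)[OF z], where 'a = complex] by (simp add: q_def)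
  have "(\<lambda>n. (1 - z) * z ^ n * real (Suc n) - (1 / 2) * ((1 - z) * z ^ n)) sums (1 / (1 - z) - (1 / 2) * 1)"
    by (intro sums_diff sums_mult sums_geometric_weights z)
  moreover have "1 / (1 - z) - (1 / 2) * 1 = (1 + z) / (2 * (1 - z))"
    using z by (simp add: field_simps)
  ultimately have "(\<lambda>n. q n * (real (Suc n) - 1 / 2)) sums ((1 + z) / (2 * (1 - z)))"
    by (simp add: q_def algebra_simps)
  from sums_of_real[OF this, where 'a = complex]
  show "(\<lambda>n. complex_of_real (q n) * (real (Suc n) - 1 / 2)) sums ((1 + z) / (2 * (1 - z)))"
    by simp
qed

lemma expectation_X: "expectation (diagonal_op q \<psi>) X = a"
  unfolding expectation_def
proof (rule trace_op_eq[OF has_trace_diagonal_mult[OF onb X_dense]])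
  \<comment> \<open>As \<open>X\<close> is symmetric and \<psi> n lies in its domain,
    \<open>U (Y (ket n))\<close> is the adjoint vector required by the trace lemma.\<close>
  show "braket (\<psi> n) g = braket (U (Y (ket n))) f" if "(f, g) \<in> X" for f g n
    unfolding \<psi>_def by (rule X_symmetric[OF X_U[OF finvec_ket] that])
  show "summable (\<lambda>n. \<bar>q n\<bar> * norm (U (Y (ket n))))"
  proof (rule summable_quadratic_bound)
    fix n
    have "real (n + 2) \<le> (real (n + 3))\<^sup>2" by (simp add: power2_eq_square algebra_simps)
    then show "norm (Y (ket n)) \<le> C * (real (n + 3))\<^sup>2"
      using norm_Y_ket[of n] mult_left_mono[OF _ C_nonneg] order_trans by blast
  qed
  have "braket (U (Y (ket n))) (\<psi> n) = a" for n
    unfolding \<psi>_def braket_U by (subst braket_commute) (simp add: braket_ket coeff_Y_ket a_real)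
  then show "(\<lambda>n. complex_of_real (q n) * braket (U (Y (ket n))) (\<psi> n)) sums a"
    using sums_mult2[OF q_sums(1), of a] by simp
qed

lemma expectation_XX:
  "expectation (diagonal_op q \<psi>) (op_mult X X) = of_real (e\<^sup>2 * ((1 + z) / (2 * (1 - z)))) + a\<^sup>2"
  unfolding expectation_def
proof (rule trace_op_eq[OF has_trace_diagonal_mult[OF onb XX_dense]])
  show "braket (\<psi> n) g = braket (U (Y (Y (ket n)))) f" if "(f, g) \<in> op_mult X X" for f g n
  proof -
    obtain h where h: "(f, h) \<in> X" "(h, g) \<in> X" using \<open>(f, g) \<in> op_mult X X\<close> by (auto simp: op_mult_iff)
    have "braket (\<psi> n) g = braket (U (Y (ket n))) h"
      unfolding \<psi>_def by (rule X_symmetric[OF X_U[OF finvec_ket] h(2)])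
    also have "\<dots> = braket (U (Y (Y (ket n)))) f"
      by (rule X_symmetric[OF X_U[OF Y_finvec[OF finvec_ket]] h(1)])
    finally show ?thesis .
  qed
  show "summable (\<lambda>n. \<bar>q n\<bar> * norm (U (Y (Y (ket n)))))"
  proof (rule summable_quadratic_bound)
    fix n
    have "C * (real (n + 2) * (C * real (n + 3))) \<le> C * (real (n + 3) * (C * real (n + 3)))"
      using C_nonneg by (intro mult_left_mono mult_right_mono) auto
    then show "norm (Y (Y (ket n))) \<le> C\<^sup>2 * (real (n + 3))\<^sup>2"
      using norm_YY_ket[of n] by (simp add: power2_eq_square mult_ac)
  qed
  have "braket (U (Y (Y (ket n)))) (\<psi> n) = of_real (e\<^sup>2 * (real (Suc n) - 1 / 2)) + a\<^sup>2" for n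
    unfolding \<psi>_def braket_U
    by (subst braket_commute) (simp add: braket_ket coeff_YY_ket a_real)
  moreover have "(\<lambda>n. complex_of_real (e\<^sup>2) * (complex_of_real (q n) * (real (Suc n) - 1 / 2)) + complex_of_real (q n) * a\<^sup>2)
      sums (complex_of_real (e\<^sup>2) * ((1 + z) / (2 * (1 - z))) + 1 * a\<^sup>2)"
    by (intro sums_add sums_mult sums_mult2 q_sums)
  ultimately show "(\<lambda>n. complex_of_real (q n) * braket (U (Y (Y (ket n)))) (\<psi> n))
      sums (of_real (e\<^sup>2 * ((1 + z) / (2 * (1 - z)))) + a\<^sup>2)"
    by (simp add: algebra_simps)
qed

lemma variance_X: "variance (diagonal_op q \<psi>) X = of_real (e\<^sup>2 * ((1 + z) / (2 * (1 - z))))"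
  unfolding variance_def expectation_X expectation_XX by simp

text \<open>Made for the rescaled commutator of A and B, which on its natural domain is a
  restriction of the identity; density of that domain suffices for the trace.\<close>

lemma expectation_identity:
  assumes dense: "closure (Domain T) = UNIV" and T: "\<And>f g. (f, g) \<in> T \<Longrightarrow> g = f"
  shows "expectation (diagonal_op q \<psi>) T = 1"
  unfolding expectation_def
proof (rule trace_op_eq[OF has_trace_diagonal_mult[OF onb dense]])
  show "braket (\<psi> n) g = braket (\<psi> n) f" if "(f, g) \<in> T" for f g n using T[OF that] by simp
  show "summable (\<lambda>n. \<bar>q n\<bar> * norm (\<psi> n))"
    unfolding \<psi>_def
  proof (rule summable_quadratic_bound)
    show "norm (ket n) \<le> 1 * (real (n + 3))\<^sup>2" for n by (simp add: power2_eq_square algebra_simps)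
  qed
  show "(\<lambda>n. complex_of_real (q n) * braket (\<psi> n) (\<psi> n)) sums 1"
    using q_sums(1) by (simp add: orthonormal_basisD(1)[OF onb])
qed

subsection \<open>The quantum Fisher information\<close>

lemma q_inj: "inj q"
proof (rule linorder_injI)
  fix m n :: nat assume "m < n"
  then have "z ^ n < z ^ m" using z by (intro power_strict_decreasing) auto
  then have "q n < q m" unfolding q_def using z by (intro mult_strict_left_mono) simp_all
  then show "q m \<noteq> q n" by simp
qed

definition G :: "nat \<times> nat \<Rightarrow> real" where
  "G = (\<lambda>(i, j). 2 * ((q i - q j)\<^sup>2 / (q i + q j)) * (cmod (braket (\<psi> i) (op_app X (\<psi> j))))\<^sup>2)"

lemma braket_op_app: "braket (\<psi> i) (op_app X (\<psi> j)) = coeff (Y (ket j)) i"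
proof -
  have "op_app X (\<psi> j) = U (Y (ket j))"
    unfolding \<psi>_def by (rule op_app_quad_op[OF X_U[OF finvec_ket]])
  then show ?thesis by (simp add: \<psi>_def braket_U braket_ket)
qed

lemma q_ratio: "(q n - q (Suc n))\<^sup>2 / (q n + q (Suc n)) = (1 - z) ^ 3 / (1 + z) * z ^ n"
proof -
  have "q n - q (Suc n) = q n * (1 - z)" "q n + q (Suc n) = q n * (1 + z)"
    by (simp_all add: q_def algebra_simps)
  then have "(q n - q (Suc n))\<^sup>2 / (q n + q (Suc n)) = q n * (1 - z)\<^sup>2 / (1 + z)"
    using q_pos[of n] by (simp add: power2_eq_square)
  then show ?thesis by (simp add: q_def power2_eq_square power3_eq_cube mult_ac)
qed

text \<open>\<open>Y\<close> is tridiagonal in the number basis. Its diagonal entry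
  \<open>a\<close>, the trace of the displacement, meets the factor q i - q i = 0, so only
  neighbouring levels remain.\<close>

lemma G_values:
  "G (n, Suc n) = e\<^sup>2 * (1 - z)\<^sup>2 / (1 + z) * ((1 - z) * z ^ n * real (Suc n))"
  "G (Suc n, n) = e\<^sup>2 * (1 - z)\<^sup>2 / (1 + z) * ((1 - z) * z ^ n * real (Suc n))"
  "j \<noteq> Suc i \<Longrightarrow> i \<noteq> Suc j \<Longrightarrow> G (i, j) = 0"
proof -
  have sym: "(q (Suc n) - q n)\<^sup>2 / (q (Suc n) + q n) = (q n - q (Suc n))\<^sup>2 / (q n + q (Suc n))"
    by (simp add: power2_commute add.commute)
  have c: "(cmod (of_real (e * sqrt (Suc n)) * x))\<^sup>2 = e\<^sup>2 * real (Suc n) / 2"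
    "(cmod (of_real (e * sqrt (Suc n)) * cnj x))\<^sup>2 = e\<^sup>2 * real (Suc n) / 2"
    unfolding norm_mult norm_of_real complex_mod_cnj power_mult_distrib power2_abs x
    by (simp_all del: of_nat_Suc)
  show "G (n, Suc n) = e\<^sup>2 * (1 - z)\<^sup>2 / (1 + z) * ((1 - z) * z ^ n * real (Suc n))"
    unfolding G_def prod.case braket_op_app coeff_Y_ket q_ratio
    using c by (simp add: power2_eq_square power3_eq_cube del: of_nat_Suc)
  show "G (Suc n, n) = e\<^sup>2 * (1 - z)\<^sup>2 / (1 + z) * ((1 - z) * z ^ n * real (Suc n))"
    unfolding G_def prod.case braket_op_app coeff_Y_ket sym q_ratio
    using c by (simp add: power2_eq_square power3_eq_cube del: of_nat_Suc)
  show "j \<noteq> Suc i \<Longrightarrow> i \<noteq> Suc j \<Longrightarrow> G (i, j) = 0"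
    unfolding G_def prod.case braket_op_app coeff_Y_ket by auto
qed

lemma G_has_sum: "(G has_sum 2 * e\<^sup>2 * (1 - z) / (1 + z)) UNIV"
proof -
  define c where "c n = e\<^sup>2 * (1 - z)\<^sup>2 / (1 + z) * ((1 - z) * z ^ n * real (Suc n))" for n
  have "c sums (e\<^sup>2 * (1 - z)\<^sup>2 / (1 + z) * (1 / (1 - z)))"
    unfolding c_def[abs_def] by (intro sums_mult sums_geometric_weights z)
  also have "e\<^sup>2 * (1 - z)\<^sup>2 / (1 + z) * (1 / (1 - z)) = e\<^sup>2 * (1 - z) / (1 + z)"
    using z by (simp add: power2_eq_square)
  finally have "c sums (e\<^sup>2 * (1 - z) / (1 + z))" .
  moreover have "c n \<ge> 0" for n using z by (simp add: c_def)
  ultimately have c: "(c has_sum e\<^sup>2 * (1 - z) / (1 + z)) UNIV"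
    by (rule sums_nonneg_imp_has_sum)
  have "G \<circ> (\<lambda>n. (n, Suc n)) = c" "G \<circ> (\<lambda>n. (Suc n, n)) = c"
    unfolding fun_eq_iff comp_apply G_values c_def by blast+
  then have up: "(G has_sum e\<^sup>2 * (1 - z) / (1 + z)) (range (\<lambda>n. (n, Suc n)))"
    and down: "(G has_sum e\<^sup>2 * (1 - z) / (1 + z)) (range (\<lambda>n. (Suc n, n)))"
    using c by (simp_all add: has_sum_reindex inj_def)
  have "(G has_sum (e\<^sup>2 * (1 - z) / (1 + z) + e\<^sup>2 * (1 - z) / (1 + z)))
      (range (\<lambda>n. (n, Suc n)) \<union> range (\<lambda>n. (Suc n, n)))"
    by (rule has_sum_Un_disjoint[OF up down]) auto
  then have "(G has_sum 2 * e\<^sup>2 * (1 - z) / (1 + z)) (range (\<lambda>n. (n, Suc n)) \<union> range (\<lambda>n. (Suc n, n)))"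
    by (simp add: mult_ac add_divide_distrib[symmetric])
  then show ?thesis
    by (rule has_sum_cong_neutral[THEN iffD1, rotated -1]) (auto intro!: G_values(3))
qed

lemma spectral: "spectral_decomposition (diagonal_op q \<psi>) q \<psi>"
  by (simp add: spectral_decomposition_def onb)

lemma \<psi>_Domain: "range \<psi> \<subseteq> Domain X"
  unfolding \<psi>_def using X_U[OF finvec_ket] by blast

lemma qfi_X: "qfi (diagonal_op q \<psi>) X = 2 * e\<^sup>2 * (1 - z) / (1 + z)"
proof -
  let ?F = "2 * e\<^sup>2 * (1 - z) / (1 + z)"
  let ?S = "\<lambda>q \<psi> F. ((\<lambda>(i, j). 2 * ((q i - q j)\<^sup>2 / (q i + q j)) * (cmod (braket (\<psi> i) (op_app X (\<psi> j))))\<^sup>2)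
           has_sum F) {(i, j). q i + q j > (0 :: real)}"
  have base: "?S q \<psi> ?F"
  proof -
    have "{(i, j). q i + q j > 0} = UNIV" using q_pos by (auto intro: add_pos_pos)
    then show ?thesis using G_has_sum by (simp add: G_def)
  qed
  \<comment> \<open>The spectrum is simple, so another decomposition permutes the indices by
    \<sigma>, which reindexes the double sum, and inserts phases, which the modulus removes.\<close>
  have all: "?S q' \<psi>' ?F" if s': "spectral_decomposition (diagonal_op q \<psi>) q' \<psi>'" for q' \<psi>'
  proof -
    obtain \<sigma> c where \<sigma>: "bij \<sigma>" "\<And>j. cmod (c j) = 1" "\<And>j. q' j = q (\<sigma> j)"
      "\<And>j. \<psi>' j = c j *\<^sub>C \<psi> (\<sigma> j)"
      using spectral_decomposition_simple[OF spectral q_inj s'] by blast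
    have app: "op_app X (c j *\<^sub>C \<psi> (\<sigma> j)) = c j *\<^sub>C op_app X (\<psi> (\<sigma> j))" for j
    proof -
      have "(\<psi> (\<sigma> j), op_app X (\<psi> (\<sigma> j))) \<in> X"
        using X_U[OF finvec_ket[of "\<sigma> j"]] op_app_quad_op[OF X_U[OF finvec_ket[of "\<sigma> j"]]]
        by (simp add: \<psi>_def)
      then show ?thesis by (intro op_app_quad_op quad_op_scaleC)
    qed
    have "cmod (braket (\<psi>' i) (op_app X (\<psi>' j))) = cmod (braket (\<psi> (\<sigma> i)) (op_app X (\<psi> (\<sigma> j))))" for i j
      unfolding \<sigma>(4) app braket_scaleC_left braket_scaleC_right by (simp add: norm_mult \<sigma>(2))
    then have "(\<lambda>(i, j). 2 * ((q' i - q' j)\<^sup>2 / (q' i + q' j)) * (cmod (braket (\<psi>' i) (op_app X (\<psi>' j))))\<^sup>2)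
        = (\<lambda>p. G (map_prod \<sigma> \<sigma> p))"
      by (auto simp: fun_eq_iff G_def \<sigma>(3))
    moreover have "{(i, j). q' i + q' j > 0} = UNIV"
      unfolding \<sigma>(3) using q_pos by (auto intro: add_pos_pos)
    moreover have "bij_betw (map_prod \<sigma> \<sigma>) UNIV UNIV"
      using bij_betw_map_prod[OF \<sigma>(1,1)] by simp
    ultimately show ?thesis
      using has_sum_reindex_bij_betw[of "map_prod \<sigma> \<sigma>" UNIV UNIV G ?F] G_has_sum by simp
  qed
  show ?thesis
    unfolding qfi_def
  proof (rule the_equality)
    show "(\<exists>q' \<psi>'. spectral_decomposition (diagonal_op q \<psi>) q' \<psi>' \<and> range \<psi>' \<subseteq> Domain X) \<and>
      (\<forall>q' \<psi>'. spectral_decomposition (diagonal_op q \<psi>) q' \<psi>' \<longrightarrow> range \<psi>' \<subseteq> Domain X \<longrightarrow> ?S q' \<psi>' ?F)"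
      using spectral \<psi>_Domain all by blast
  next
    fix F
    assume "(\<exists>q' \<psi>'. spectral_decomposition (diagonal_op q \<psi>) q' \<psi>' \<and> range \<psi>' \<subseteq> Domain X) \<and>
      (\<forall>q' \<psi>'. spectral_decomposition (diagonal_op q \<psi>) q' \<psi>' \<longrightarrow> range \<psi>' \<subseteq> Domain X \<longrightarrow> ?S q' \<psi>' F)"
    then have "?S q \<psi> F" using spectral \<psi>_Domain by blast
    then show "F = ?F" using base has_sum_unique by blast
  qed
qed

end

section \<open>Gaussian states\<close>

lemma commutator_quad_op:
  assumes "(f, g) \<in> commutator (quad_op 0 0 x y) (quad_op 0 0 u v)"
  shows "g = (x * v - y * u) *\<^sub>C f"
proof -
  obtain h k l m where "(f, h) \<in> quad_op 0 0 u v" "(h, k) \<in> quad_op 0 0 x y"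
    "(f, l) \<in> quad_op 0 0 x y" "(l, m) \<in> quad_op 0 0 u v" and g: "g = k - m"
    using assms by (auto simp: commutator_def op_diff_iff op_mult_iff)
  then have "coeff k = quad 0 0 x y (quad 0 0 u v (coeff f))" "coeff m = quad 0 0 u v (quad 0 0 x y (coeff f))"
    by (simp_all add: quad_op_iff)
  then show ?thesis unfolding g
    by (intro fock_eqI) (simp add: quad_commutator[of x y 0 0 u v], simp add: quad_def)
qed

lemma finvec_Domain_commutator: "finvec \<subseteq> Domain (commutator (quad_op 0 0 x y) (quad_op 0 0 u v))"
proof
  fix f assume f: "f \<in> finvec"
  have "(f, quadv 0 0 x y (quadv 0 0 u v f)) \<in> op_mult (quad_op 0 0 x y) (quad_op 0 0 u v)"
    "(f, quadv 0 0 u v (quadv 0 0 x y f)) \<in> op_mult (quad_op 0 0 u v) (quad_op 0 0 x y)"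
    unfolding op_mult_iff using quadv_in_quad_op[OF f] quadv_in_quad_op[OF finvec_quadv[OF f]] by blast+
  then show "f \<in> Domain (commutator (quad_op 0 0 x y) (quad_op 0 0 u v))"
    unfolding commutator_def Domain_iff op_diff_iff by blast
qed

lemma thermal_occupation_tanh:
  assumes "\<beta> > 0"
  shows "(1 - exp (- \<beta>)) / (1 + exp (- \<beta>)) = tanh (\<beta> / 2)"
    and "(1 + exp (- \<beta>)) / (1 - exp (- \<beta>)) = coth (\<beta> / 2)"
    and "coth (\<beta> / 2) * tanh (\<beta> / 2) = 1"
proof -
  show t: "(1 - exp (- \<beta>)) / (1 + exp (- \<beta>)) = tanh (\<beta> / 2)"
    using tanh_real_altdef[of "\<beta> / 2"] by simp
  have ct: "coth (\<beta> / 2) = 1 / tanh (\<beta> / 2)"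
    by (simp add: coth_def tanh_def)
  then show "(1 + exp (- \<beta>)) / (1 - exp (- \<beta>)) = coth (\<beta> / 2)"
    unfolding t[symmetric] by simp
  have "sinh (\<beta> / 2) > 0" using assms by simp
  then have "tanh (\<beta> / 2) \<noteq> 0" using assms by (simp add: tanh_def cosh_real_nonzero)
  then show "coth (\<beta> / 2) * tanh (\<beta> / 2) = 1" by (simp add: ct)
qed

theorem mainTheorem2:
  fixes \<beta> r \<theta> :: real and \<alpha> :: complex
  assumes "\<beta> > 0" and "r \<ge> 0"
  defines "\<rho> \<equiv> gaussian_state \<beta> r \<theta> \<alpha>"
    and "A \<equiv> quadrature_A \<theta>"
    and "B \<equiv> quadrature_B \<theta>"
  shows "variance \<rho> A = complex_of_real (1 / 2 * exp (- 2 * r) * coth (\<beta> / 2)) \<and>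
    qfi \<rho> B = 2 * exp (2 * r) * tanh (\<beta> / 2) \<and>
    variance \<rho> A * complex_of_real (qfi \<rho> B) =
      (expectation \<rho> (op_scale \<i> (commutator A B)))\<^sup>2"
proof -
  define z where "z = exp (- \<beta>)"
  define x where "x = cis (- \<theta> / 2) / complex_of_real (sqrt 2)"
  define y where "y = \<i> * x"
  have A: "A = quad_op 0 0 x (cnj x)" and B: "B = quad_op 0 0 y (cnj y)"
    by (simp_all add: A_def B_def quadrature_A_eq quadrature_B_eq x_def y_def)
  obtain S where S: "unitary_map S" "squeezing r \<theta> = graph S"
    and conjS: "\<And>(x :: complex) (y :: complex) \<kappa> f g. \<kappa> * x = - (r * y * cis (- \<theta>)) \<Longrightarrow> \<kappa> * y = - (r * x * cis \<theta>) \<Longrightarrow>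
      (f, g) \<in> quad_op 0 0 x y \<Longrightarrow> (S f, S (exp \<kappa> *\<^sub>C g)) \<in> quad_op 0 0 x y"
    by (rule squeezing_unitary[of r \<theta>]) (rule that)
  obtain D where D: "unitary_map D" "displacement \<alpha> = graph D"
    and conjD: "\<And>(x :: complex) (y :: complex) f g. (f, g) \<in> quad_op 0 0 x y \<Longrightarrow>
      (D f, D (g + (x * \<alpha> + y * cnj \<alpha>) *\<^sub>C f)) \<in> quad_op 0 0 x y"
    by (rule displacement_unitary[of \<alpha>]) (rule that)
  define U where "U f = D (S f)" for f
  have U: "unitary_map U"
    using unitary_map_comp[OF D(1) S(1)] by (simp add: comp_def U_def[abs_def])
  have conjU: "(U f, U (exp \<kappa> *\<^sub>C g + (w * \<alpha> + cnj w * cnj \<alpha>) *\<^sub>C f)) \<in> quad_op 0 0 w (cnj w)"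
    if "\<kappa> * w = - (r * cnj w * cis (- \<theta>))" "\<kappa> * cnj w = - (r * w * cis \<theta>)"
      and "(f, g) \<in> quad_op 0 0 w (cnj w)" for w \<kappa> :: complex and f g
    using conjD[OF conjS[OF that]] S(1) by (simp add: U_def unitary_map_def)
  \<comment> \<open>Hence cnj x cis (-\<theta>) = x, so x meets the squeezing condition with
    \<kappa> = -r. For y = \<i> x conjugation contributes a sign, and \<kappa> = r.\<close>
  have half: "cis (\<theta> / 2) * cis (- \<theta>) = cis (- \<theta> / 2)" "cis (- (\<theta> / 2)) * cis \<theta> = cis (\<theta> / 2)"
    by (simp_all add: cis_mult)
  have z: "0 < z" "z < 1" using assms by (auto simp: z_def)
  have x2: "(cmod x)\<^sup>2 = 1 / 2" "(cmod y)\<^sup>2 = 1 / 2"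
    by (simp_all add: x_def y_def norm_mult norm_divide power_divide)
  interpret A: transformed_quadrature U x "x * \<alpha> + cnj x * cnj \<alpha>" "exp (- r)" z
  proof
    show "(U f, U (of_real (exp (- r)) *\<^sub>C g + (x * \<alpha> + cnj x * cnj \<alpha>) *\<^sub>C f)) \<in> quad_op 0 0 x (cnj x)"
      if fg: "(f, g) \<in> quad_op 0 0 x (cnj x)" for f g
      using conjU[OF _ _ fg, of "- of_real r"] half
      by (simp add: x_def cis_cnj mult_ac exp_of_real[symmetric])
  qed (use U z x2 in auto)
  interpret B: transformed_quadrature U y "y * \<alpha> + cnj y * cnj \<alpha>" "exp r" z
  proof
    show "(U f, U (of_real (exp r) *\<^sub>C g + (y * \<alpha> + cnj y * cnj \<alpha>) *\<^sub>C f)) \<in> quad_op 0 0 y (cnj y)"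
      if fg: "(f, g) \<in> quad_op 0 0 y (cnj y)" for f g
      using conjU[OF _ _ fg, of "of_real r"] half
      by (simp add: x_def y_def cis_cnj mult_ac exp_of_real[symmetric])
  qed (use U z x2 in auto)
  have \<rho>: "\<rho> = diagonal_op A.q A.\<psi>" "\<rho> = diagonal_op B.q B.\<psi>"
    unfolding \<rho>_def gaussian_state_eq[OF assms(1) S D] A.q_def[abs_def] A.\<psi>_def[abs_def]
      B.q_def[abs_def] B.\<psi>_def[abs_def]
    by (simp_all add: z_def U_def)
  have var: "variance \<rho> A = complex_of_real (1 / 2 * exp (- 2 * r) * coth (\<beta> / 2))"
  proof -
    have "variance \<rho> A = complex_of_real ((exp (- r))\<^sup>2 * ((1 + z) / (2 * (1 - z))))"
      unfolding \<rho>(1) A by (rule A.variance_X)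
    also have "(exp (- r))\<^sup>2 * ((1 + z) / (2 * (1 - z))) = 1 / 2 * exp (- 2 * r) * coth (\<beta> / 2)"
      unfolding z_def thermal_occupation_tanh(2)[OF assms(1), symmetric]
      by (simp add: exp_double[symmetric] power2_eq_square exp_add[symmetric])
    finally show ?thesis .
  qed
  have fisher: "qfi \<rho> B = 2 * exp (2 * r) * tanh (\<beta> / 2)"
  proof -
    have "qfi \<rho> B = 2 * (exp r)\<^sup>2 * (1 - z) / (1 + z)"
      unfolding \<rho>(2) B by (rule B.qfi_X)
    also have "\<dots> = 2 * exp (2 * r) * tanh (\<beta> / 2)"
      unfolding z_def thermal_occupation_tanh(1)[OF assms(1), symmetric] by (simp add: exp_double)
    finally show ?thesis .
  qed
  have comm: "expectation \<rho> (op_scale \<i> (commutator A B)) = 1"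
    unfolding \<rho>(1)
  proof (rule A.expectation_identity)
    have xx: "x * cnj x = 1 / 2" unfolding complex_norm_square[symmetric] x2 by simp
    have "finvec \<subseteq> Domain (commutator A B)"
      unfolding A B by (rule finvec_Domain_commutator)
    moreover have "Domain (op_scale \<i> (commutator A B)) = Domain (commutator A B)"
      by (auto simp: op_scale_def)
    ultimately have "finvec \<subseteq> Domain (op_scale \<i> (commutator A B))" by simp
    then show "closure (Domain (op_scale \<i> (commutator A B))) = UNIV"
      using closure_mono closure_finvec by blast
    show "g = f" if "(f, g) \<in> op_scale \<i> (commutator A B)" for f g
    proof -
      obtain h where h: "(f, h) \<in> commutator A B" "g = \<i> *\<^sub>C h" using \<open>_ \<in> op_scale _ _\<close> by (auto simp: op_scale_iff)
      \<comment> \<open>The scalar by which the commutator of A and B acts on its domain; multiplied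
        by \<i> it becomes 1.\<close>
      have "x * cnj y - cnj x * y = - \<i> * (2 * (x * cnj x))" by (simp add: y_def algebra_simps)
      also have "\<dots> = - \<i>" unfolding xx by simp
      finally show ?thesis using h commutator_quad_op[of f h x "cnj x" y "cnj y"] by (simp add: A B)
    qed
  qed
  have "1 / 2 * exp (- 2 * r) * coth (\<beta> / 2) * (2 * exp (2 * r) * tanh (\<beta> / 2))
      = (exp (- 2 * r) * exp (2 * r)) * (coth (\<beta> / 2) * tanh (\<beta> / 2))" by (simp add: mult_ac)
  also have "\<dots> = 1" using thermal_occupation_tanh(3)[OF assms(1)] by (simp add: exp_add[symmetric])
  finally have prod: "variance \<rho> A * complex_of_real (qfi \<rho> B) = 1"
    unfolding var fisher of_real_mult[symmetric] by simp
  show ?thesis by (intro conjI var fisher) (simp only: prod comm power_one)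
qed

end
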